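(* Let $n,m\ge1$ and let $\mathfrak{g}$ be of type $C_n$. The multiplicity of the trivial representation in $\left(\bigwedge V\right)^{\otimes m}$ (equivalently, of $B(0)$ in $\left(\bigwedge B(\omega_1)\right)^{\otimes m}$) equals the determinant of the $n\times n$ Hankel matrix \[ \left[\operatorname{Cat}_{m+1+i+j}\right]_{i,j=0}^{n-1}. \]
   Context: $V=V(\omega_1)$ is the natural $2n$-dimensional representation of $\mathfrak{sp}_{2n}$ and $\bigwedge V=\bigoplus_{k=0}^{2n}\bigwedge^k V$ is its exterior algebra, viewed as a representation. $\operatorname{Cat}_k=\frac{1}{k+1}\binom{2k}{k}$ is the $k$-th Catalan number. *)

theory Defs
  imports Complex_Main "HOL-Library.Function_Algebras" "Jordan_Normal_Form.Determinant"
begin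

definition catalan :: "nat \<Rightarrow> nat" where
  "catalan k = (2 * k choose k) div (k + 1)"

definition symp_form :: "nat \<Rightarrow> nat \<Rightarrow> nat \<Rightarrow> complex" where
  "symp_form n i j = (if i < n \<and> j = i + n then 1
                      else if n \<le> i \<and> i < 2 * n \<and> j = i - n then -1 else 0)"

text \<open>The Lie algebra sp_(2n)(C): (2n x 2n)-matrices X (entries indexed by nat,
  zero outside the range) with omega(X e_i, e_j) + omega(e_i, X e_j) = 0.
  X e_j = sum_i X i j e_i.\<close>
definition sp :: "nat \<Rightarrow> (nat \<Rightarrow> nat \<Rightarrow> complex) set" where
  "sp n = {X. (\<forall>i j. (i \<ge> 2 * n \<or> j \<ge> 2 * n) \<longrightarrow> X i j = 0) \<and>
              (\<forall>i<2*n. \<forall>j<2*n.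
                 (\<Sum>k<2*n. X k i * symp_form n k j) + (\<Sum>k<2*n. symp_form n i k * X k j) = 0)}"

text \<open>Basis of the exterior algebra of V: e_S = e_(s_1) \<and> ... \<and> e_(s_k), s_1 < ... < s_k,
  for S a subset of {0..<2n}. Action of a matrix X on e_S (as a derivation),
  written as coefficient function of the basis: replacing e_j (j in S) by e_i (i not in S)
  and re-sorting gives sign (-1)^(number of elements of S strictly between i and j).\<close>
definition wedge_act :: "nat \<Rightarrow> (nat \<Rightarrow> nat \<Rightarrow> complex) \<Rightarrow> nat set \<Rightarrow> nat set \<Rightarrow> complex" where
  "wedge_act n X S T =
     (\<Sum>j\<in>S. \<Sum>i<2*n.
        (if i = j then (if T = S then X j j else 0)
         else if i \<in> S then 0
         else if T = insert i (S - {j})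
           then (-1) ^ card {k\<in>S. min i j < k \<and> k < max i j} * X i j
         else 0))"

text \<open>Basis of (\<And>V)^(\<otimes>m): lists of length m of subsets of {0..<2n}.\<close>
definition tbasis :: "nat \<Rightarrow> nat \<Rightarrow> nat set list set" where
  "tbasis n m = {Bs. length Bs = m \<and> (\<forall>S\<in>set Bs. S \<subseteq> {..<2*n})}"

text \<open>Action of X on a basis tensor e_(B_1) \<otimes> ... \<otimes> e_(B_m) (Leibniz rule).\<close>
definition tensor_act_basis ::
  "nat \<Rightarrow> (nat \<Rightarrow> nat \<Rightarrow> complex) \<Rightarrow> nat set list \<Rightarrow> nat set list \<Rightarrow> complex" where
  "tensor_act_basis n X Bs T =
     (\<Sum>p<length Bs.
        (if length T = length Bs \<and> (\<forall>q<length Bs. q \<noteq> p \<longrightarrow> T ! q = Bs ! q)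
         then wedge_act n X (Bs ! p) (T ! p) else 0))"

definition tensor_act ::
  "nat \<Rightarrow> nat \<Rightarrow> (nat \<Rightarrow> nat \<Rightarrow> complex) \<Rightarrow> (nat set list \<Rightarrow> complex) \<Rightarrow> (nat set list \<Rightarrow> complex)" where
  "tensor_act n m X w = (\<lambda>T. \<Sum>Bs\<in>tbasis n m. w Bs * tensor_act_basis n X Bs T)"

definition tvectors :: "nat \<Rightarrow> nat \<Rightarrow> (nat set list \<Rightarrow> complex) set" where
  "tvectors n m = {w. \<forall>T. T \<notin> tbasis n m \<longrightarrow> w T = 0}"

definition invariants :: "nat \<Rightarrow> nat \<Rightarrow> (nat set list \<Rightarrow> complex) set" where
  "invariants n m = {w \<in> tvectors n m. \<forall>X\<in>sp n. tensor_act n m X w = 0}"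

definition cscale :: "complex \<Rightarrow> (nat set list \<Rightarrow> complex) \<Rightarrow> (nat set list \<Rightarrow> complex)" where
  "cscale c w = (\<lambda>x. c * w x)"

text \<open>Multiplicity of the trivial representation in (\<And>V)^(\<otimes>m)
  = dim Hom_g(C, (\<And>V)^(\<otimes>m)) = complex dimension of the space of invariants.\<close>
definition mult_trivial :: "nat \<Rightarrow> nat \<Rightarrow> nat" where
  "mult_trivial n m = vector_space.dim cscale (invariants n m)"

lemma vector_space_cscale: "vector_space cscale"
  by unfold_locales (auto simp: cscale_def fun_eq_iff algebra_simps)

end

theory Submission
  imports Defs
begin

text \<open>
  Let \<open>p\<^sub>0, \<dots>, p\<^sub>n\<^sub>-\<^sub>1, q\<^sub>0, \<dots>, q\<^sub>n\<^sub>-\<^sub>1\<close> be the symplectic basis of \<open>V\<close>. Both sides count families of \<open>n\<close>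
  vicious walkers that make \<open>2m\<close> unit steps, where walker \<open>r\<close> starts and ends at \<open>2r + 2\<close> and all
  walkers stay positive.

  By a Karlin--McGregor argument their number is the determinant of the numbers of walks from
  \<open>2i + 2\<close> to \<open>2j + 2\<close> that avoid \<open>0\<close>, and splitting Dyck paths after \<open>2i + 1\<close> and before the last
  \<open>2j + 1\<close> steps factors the Hankel matrix of Catalan numbers as this matrix between two unitriangular ones.

  Upper bound: a basis tensor is read as a walker family in which the presence of \<open>p\<^sub>r\<close> and the
  absence of \<open>q\<^sub>r\<close> are up-steps. For a suitable lexicographic order, the part of an invariant that
  extends a fixed prefix of its leading term is killed by the lowering operators, so by unitarity its
  weight is antidominant. Hence the leading term is a walker family, and an invariant that vanishes
  on all walker families is zero.

  Lower bound: the exterior algebra of \<open>V \<otimes> \<complex>\<^sup>m\<close> contains the quadratic invariants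
  \<open>\<omega>\<^sub>a\<^sub>b = \<Sum>\<^sub>i (p\<^sub>i\<^sup>a q\<^sub>i\<^sup>b + p\<^sub>i\<^sup>b q\<^sub>i\<^sup>a)\<close>. A walker family is a chain of \<open>n\<close> order ideals in the poset of
  intervals \<open>[a, b]\<close>; the product of \<open>\<omega>\<^sub>a\<^sub>b\<close> over the maximal intervals of these ideals is an
  invariant, and by the rearrangement inequality these invariants are triangular with respect to the
  statistic \<open>\<Sum> a b\<close>.
\<close>

section \<open>Vicious walkers and Catalan numbers\<close>

text \<open>Number of sequences of \<open>t\<close> steps \<open>1\<close> or \<open>- 1\<close>
  with sum \<open>d\<close>; integer-valued, because the reflection formula subtracts two such
  numbers.\<close>

fun walks :: "nat \<Rightarrow> int \<Rightarrow> int" where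
  "walks 0 d = (if d = 0 then 1 else 0)"
| "walks (Suc t) d = walks t (d - 1) + walks t (d + 1)"

lemma walks_minus: "walks t (- d) = walks t d"
proof (induction t arbitrary: d)
  case (Suc t)
  have "- d - 1 = - (d + 1)" "- d + 1 = - (d - 1)" by auto
  then show ?case using Suc by (metis add.commute walks.simps(2))
qed simp

lemma walks_eq_0: "\<bar>d\<bar> > int t \<Longrightarrow> walks t d = 0"
  by (induction t arbitrary: d) auto

text \<open>A walk with \<open>k\<close> up-steps ends at \<open>2 * k - t\<close>, and the
  recursion is Pascal's rule.\<close>

lemma walks_choose: "walks t (2 * int k - int t) = int (t choose k)"
proof (induction t arbitrary: k)
  case 0
  then show ?case by (cases k) auto
next
  case (Suc t)
  show ?case
  proof (cases k)
    case 0
    have "walks t (- 1 - int t - 1) = 0" by (rule walks_eq_0) auto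
    moreover have "walks t (- int t) = 1" using Suc[of 0] by simp
    ultimately show ?thesis using 0 by (simp add: algebra_simps)
  next
    case (Suc j)
    have "2 * int k - int (Suc t) - 1 = 2 * int j - int t"
         "2 * int k - int (Suc t) + 1 = 2 * int k - int t" using Suc by auto
    then have "walks (Suc t) (2 * int k - int (Suc t)) = walks t (2 * int j - int t) + walks t (2 * int k - int t)"
      unfolding walks.simps by metis
    then show ?thesis unfolding Suc.IH using Suc by simp
  qed
qed

text \<open>Reflection principle: for positive \<open>a\<close>, \<open>b\<close> this counts the walks from \<open>a\<close> to \<open>b\<close>
  with \<open>t\<close> steps that avoid \<open>0\<close>; the formula extends it to an odd function of \<open>a\<close>.\<close>
definition pwalks :: "nat \<Rightarrow> int \<Rightarrow> int \<Rightarrow> int" where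
  "pwalks t a b = walks t (b - a) - walks t (b + a)"

lemma pwalks_Suc: "pwalks (Suc t) a b = pwalks t (a - 1) b + pwalks t (a + 1) b"
  by (simp add: pwalks_def algebra_simps)

lemma pwalks_commute: "pwalks t a b = pwalks t b a"
  using walks_minus[of t "b - a"] by (simp add: pwalks_def add.commute)

lemma pwalks_minus: "pwalks t (- a) b = - pwalks t a b"
  by (simp add: pwalks_def)

lemma pwalks_0_left [simp]: "pwalks t 0 b = 0"
  by (simp add: pwalks_def)

text \<open>Chapman-Kolmogorov equation for walks killed at 0. Since \<open>pwalks\<close> is odd in
  the start, \<open>a\<close> may be any integer, and the induction passes to \<open>a - 1\<close>
  and \<open>a + 1\<close> without a case distinction at the wall. The bound \<open>Z\<close> covers
  every point reachable in \<open>s\<close> steps.\<close>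

lemma pwalks_add:
  assumes "\<bar>a\<bar> + int s \<le> Z"
  shows "pwalks (s + t) a b = (\<Sum>z\<in>{1..Z}. pwalks s a z * pwalks t z b)"
  using assms
proof (induction s arbitrary: a)
  case 0
  have *: "pwalks 0 a z = (if z = a then 1 else 0) - (if z = - a then 1 else 0)" for z
    by (auto simp: pwalks_def)
  have "(\<Sum>z\<in>{1..Z}. pwalks 0 a z * pwalks t z b)
      = (\<Sum>z\<in>{1..Z}. if z = a then pwalks t z b else 0) - (\<Sum>z\<in>{1..Z}. if z = - a then pwalks t z b else 0)"
    by (simp add: * left_diff_distrib sum_subtractf if_distrib[of "\<lambda>x. x * _"] cong: if_cong)
  also have "\<dots> = (if a \<in> {1..Z} then pwalks t a b else 0) - (if - a \<in> {1..Z} then pwalks t (-a) b else 0)"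
    by (simp add: sum.delta)
  also have "\<dots> = pwalks t a b"
    using 0 pwalks_minus[of t a b] by (cases "a = 0") auto
  finally show ?case by simp
next
  case (Suc s)
  have "\<bar>a - 1\<bar> + int s \<le> Z" "\<bar>a + 1\<bar> + int s \<le> Z" using Suc.prems by auto
  then show ?case using Suc.IH
    by (simp add: pwalks_Suc sum.distrib distrib_right)
qed

text \<open>Walks from 1 to 1 avoiding 0 are shifted Dyck paths; the reflection formula becomes a
  difference of two neighbouring binomial coefficients.\<close>

lemma pwalks_catalan: "pwalks (2 * k) 1 1 = int (catalan k)"
proof -
  have 1: "walks (2 * k) 0 = int (2 * k choose k)" using walks_choose[of "2*k" k] by simp
  have 2: "walks (2 * k) 2 = int (2 * k choose (k + 1))" using walks_choose[of "2*k" "k+1"] by simp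
  have a: "Suc k * (2 * k choose Suc k) = k * (2 * k choose k)"
  proof -
    have "Suc k * (2 * k choose Suc k) = (2 * k choose k) * (2 * k - k)"
      using binomial_absorb_comp[of "2*k" k] binomial_absorption[of k "2*k"]
      by (metis Suc_times_binomial_eq  binomial_absorption mult.commute binomial_absorb_comp diff_mult_distrib2)
    then show ?thesis by simp
  qed
  have le: "(2 * k choose Suc k) \<le> (2 * k choose k)"
    using binomial_maximum'[of k "Suc k"] by simp
  \<comment> \<open>This shows that the division by \<open>k + 1\<close> in \<open>catalan\<close>
    is exact.\<close>
  have "(k + 1) * ((2 * k choose k) - (2 * k choose Suc k)) = (2 * k choose k)"
    using a by (simp add: diff_mult_distrib2)
  then have "catalan k = (2 * k choose k) - (2 * k choose Suc k)"
    unfolding catalan_def by (metis Suc_eq_plus1 nat.distinct(1) nonzero_mult_div_cancel_left)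
  then show ?thesis using 1 2 le by (simp add: pwalks_def of_nat_diff)
qed

section \<open>Factorisation of the Hankel matrix\<close>

text \<open>After \<open>2 * i + 1\<close> steps from 1 the farthest point is
  \<open>2 * i + 2\<close>, and exactly one walk reaches it. Hence the matrix \<open>L\<close> used
  below is lower unitriangular.\<close>

lemma pwalks_from_1_eq_0: "i < a \<Longrightarrow> pwalks (2 * i + 1) 1 (2 * int a + 2) = 0"
  by (simp add: pwalks_def walks_eq_0)

lemma pwalks_from_1_diag: "pwalks (2 * i + 1) 1 (2 * int i + 2) = 1"
proof -
  have "walks (2 * i + 1) (2 * int (2*i+1) - int (2*i+1)) = 1"
    unfolding walks_choose by simp
  moreover have "walks (2 * i + 1) (2 * int i + 2 + 1) = 0" by (rule walks_eq_0) auto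
  ultimately show ?thesis by (simp add: pwalks_def algebra_simps)
qed

lemma pwalks_parity: "odd (int t + a + b) \<Longrightarrow> pwalks t a b = 0"
proof (induction t arbitrary: a)
  case 0
  then have "b \<noteq> a" "b \<noteq> - a" by auto
  then show ?case by (auto simp: pwalks_def)
next
  case (Suc t)
  have "odd (int t + (a - 1) + b)" "odd (int t + (a + 1) + b)" using Suc.prems by auto
  from this[THEN Suc.IH] show ?case by (simp add: pwalks_Suc)
qed

lemma sum_even_positive:
  fixes f :: "int \<Rightarrow> int"
  assumes "\<And>z. odd z \<Longrightarrow> f z = 0" "\<And>z. z > 2 * int n \<Longrightarrow> f z = 0" "2 * int n \<le> Z"
  shows "(\<Sum>z\<in>{1..Z}. f z) = (\<Sum>a<n. f (2 * int a + 2))"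
proof -
  have "(\<Sum>a<n. f (2 * int a + 2)) = sum f ((\<lambda>a. 2 * int a + 2) ` {..<n})"
    by (subst sum.reindex) (auto simp: inj_on_def)
  also have "\<dots> = sum f {1..Z}"
  proof (rule sum.mono_neutral_left)
    show "(\<lambda>a. 2 * int a + 2) ` {..<n} \<subseteq> {1..Z}" using assms(3) by auto
    show "\<forall>z\<in>{1..Z} - (\<lambda>a. 2 * int a + 2) ` {..<n}. f z = 0"
    proof
      fix z assume z: "z \<in> {1..Z} - (\<lambda>a. 2 * int a + 2) ` {..<n}"
      show "f z = 0"
      proof (cases "odd z \<or> z > 2 * int n")
        case False
        then obtain w where w: "z = 2 * w" by auto
        with z False have "z = 2 * int (nat (w - 1)) + 2" "nat (w - 1) < n" by auto
        then show ?thesis using z by blast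
      qed (use assms in auto)
    qed
  qed simp
  finally show ?thesis by simp
qed

text \<open>A walk of length \<open>2 * (m + 1 + i + j)\<close> from 1 to 1 is cut into pieces of
  \<open>2 * i + 1\<close>, \<open>2 * m\<close> and \<open>2 * j + 1\<close> steps. This writes the
  Hankel matrix as \<open>L * G * L\<^sup>T\<close> with \<open>det L = 1\<close>.\<close>

lemma det_pwalks_eq_det_catalan:
  "det (mat n n (\<lambda>(i, j). pwalks (2 * m) (2 * int i + 2) (2 * int j + 2)))
   = det (mat n n (\<lambda>(i, j). int (catalan (m + 1 + i + j))))"
proof -
  define G where "G = mat n n (\<lambda>(i, j). pwalks (2 * m) (2 * int i + 2) (2 * int j + 2))"
  define L where "L = mat n n (\<lambda>(i, a). pwalks (2 * i + 1) 1 (2 * int a + 2))"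
  have G[simp]: "G \<in> carrier_mat n n" and L[simp]: "L \<in> carrier_mat n n"
    by (auto simp: G_def L_def)
  have detL: "det L = 1"
  proof -
    have "det L = prod_list (diag_mat L)"
      by (rule det_lower_triangular[of n]) (auto simp: L_def pwalks_from_1_eq_0[simplified])
    also have "diag_mat L = replicate n 1"
      unfolding diag_mat_def L_def using pwalks_from_1_diag
      by (intro nth_equalityI) (auto simp: add.commute)
    finally show ?thesis by simp
  qed
  have split: "pwalks (2 * i + 1 + t) 1 b = (\<Sum>a<n. pwalks (2 * i + 1) 1 (2 * int a + 2) * pwalks t (2 * int a + 2) b)"
    if "i < n" for i t b
  proof -
    have "pwalks (2 * i + 1 + t) 1 b = (\<Sum>z\<in>{1..2 * int n}. pwalks (2 * i + 1) 1 z * pwalks t z b)"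
      by (rule pwalks_add) (use that in auto)
    \<comment> \<open>An odd number of steps from 1 leads to an even point, and because of
      \<open>i < n\<close> not beyond \<open>2 * n\<close>; only the points \<open>2 * a + 2\<close>
      with \<open>a < n\<close> remain.\<close>
    also have "\<dots> = (\<Sum>a<n. pwalks (2 * i + 1) 1 (2 * int a + 2) * pwalks t (2 * int a + 2) b)"
    proof (rule sum_even_positive)
      fix z :: int
      show "odd z \<Longrightarrow> pwalks (2 * i + 1) 1 z * pwalks t z b = 0"
        by (subst pwalks_parity) auto
      show "2 * int n < z \<Longrightarrow> pwalks (2 * i + 1) 1 z * pwalks t z b = 0"
        using that by (simp add: pwalks_def walks_eq_0)
    qed auto
    finally show ?thesis .
  qed
  have "mat n n (\<lambda>(i, j). int (catalan (m + 1 + i + j))) = L * G * L\<^sup>T"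
  proof (rule eq_matI)
    fix i j assume "i < dim_row (L * G * L\<^sup>T)" "j < dim_col (L * G * L\<^sup>T)"
    then have ij: "i < n" "j < n" by (auto simp: L_def)
    have "int (catalan (m + 1 + i + j)) = pwalks (2 * i + 1 + (2 * m + (2 * j + 1))) 1 1"
      by (subst pwalks_catalan[symmetric]) (simp add: algebra_simps)
    also have "\<dots> = (\<Sum>a<n. L $$ (i, a) * pwalks (2 * j + 1 + 2 * m) 1 (2 * int a + 2))"
      using ij by (subst split) (auto simp: L_def pwalks_commute[of _ 1] add_ac intro!: sum.cong)
    also have "\<dots> = (\<Sum>a<n. L $$ (i, a) * (\<Sum>b<n. L $$ (j, b) * G $$ (a, b)))"
      using ij by (intro sum.cong refl) (subst split, auto simp: L_def G_def intro!: sum.cong pwalks_commute)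
    also have "\<dots> = (\<Sum>b<n. \<Sum>a<n. L $$ (i, a) * G $$ (a, b) * L $$ (j, b))"
      by (subst sum.swap) (simp add: sum_distrib_left algebra_simps)
    also have "\<dots> = (L * G * L\<^sup>T) $$ (i, j)"
      using ij G L by (simp add: times_mat_def scalar_prod_def sum_distrib_right atLeast0LessThan carrier_matD[OF L] carrier_matD[OF G])
    finally show "mat n n (\<lambda>(i, j). int (catalan (m + 1 + i + j))) $$ (i, j) = (L * G * L\<^sup>T) $$ (i, j)"
      using ij by simp
  qed (auto simp: L_def)
  then have "det (mat n n (\<lambda>(i, j). int (catalan (m + 1 + i + j)))) = det (L * G * L\<^sup>T)" by simp
  also have "\<dots> = det L * det G * det (L\<^sup>T)"
    by (simp add: det_mult[of _ n] mult_carrier_mat[OF L G])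
  finally show ?thesis using detL det_transpose[OF L] by (simp add: G_def)
qed


section \<open>The Karlin-McGregor argument\<close>

text \<open>The open Weyl chamber of type C.\<close>

definition chamber :: "nat \<Rightarrow> (nat \<Rightarrow> int) \<Rightarrow> bool" where
  "chamber n x \<longleftrightarrow> (\<forall>i<n. 0 < x i) \<and> (\<forall>i. Suc i < n \<longrightarrow> x i < x (Suc i))"

definition move :: "nat set \<Rightarrow> (nat \<Rightarrow> int) \<Rightarrow> nat \<Rightarrow> int" where
  "move E x = (\<lambda>i. x i + (if i \<in> E then 1 else - 1))"

text \<open>The end point is \<open>y\<close>. Only positions reached after a step are tested; that
  the start lies in the chamber is a separate assumption where it matters.\<close>

fun vicious :: "nat \<Rightarrow> (nat \<Rightarrow> int) \<Rightarrow> (nat \<Rightarrow> int) \<Rightarrow> nat set list \<Rightarrow> bool" where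
  "vicious n y x [] \<longleftrightarrow> (\<forall>i<n. x i = y i)"
| "vicious n y x (E # Es) \<longleftrightarrow> E \<subseteq> {..<n} \<and> chamber n (move E x) \<and> vicious n y (move E x) Es"

lemma chamber_strict_mono:
  assumes "chamber n x" "i < j" "j < n"
  shows "x i < x j"
  using assms(2,3)
proof (induction j)
  case (Suc j)
  have "x j < x (Suc j)" using assms(1) Suc.prems by (auto simp: chamber_def)
  then show ?case using Suc by (cases "i = j") auto
qed simp

text \<open>Increasing sequences with the same image coincide. If \<open>x\<close> and
  \<open>y\<close> differ, some \<open>x i\<close> is therefore missed by \<open>y\<close>, and row
  \<open>i\<close> of the matrix vanishes.\<close>

lemma det_delta:
  fixes x y :: "nat \<Rightarrow> int"
  assumes "chamber n x" "chamber n y"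
  shows "det (mat n n (\<lambda>(i, j). pwalks 0 (x i) (y j))) = (if \<forall>i<n. x i = y i then 1 else 0)"
proof -
  have entry: "pwalks 0 (x i) (y j) = (if x i = y j then 1 else 0)" if "i < n" "j < n" for i j
  proof -
    have "x i > 0" "y j > 0" using assms that by (auto simp: chamber_def)
    then show ?thesis by (auto simp: pwalks_def)
  qed
  have inj: "inj_on x {..<n}" "inj_on y {..<n}"
    using chamber_strict_mono[OF assms(1)] chamber_strict_mono[OF assms(2)]
    by (auto intro!: linorder_inj_onI' simp: less_imp_neq)
  show ?thesis
  proof (cases "\<forall>i<n. x i = y i")
    case True
    have "mat n n (\<lambda>(i, j). pwalks 0 (x i) (y j)) = 1\<^sub>m n"
    proof (rule eq_matI)
      fix i j assume "i < dim_row (1\<^sub>m n)" "j < dim_col (1\<^sub>m n)"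
      then have ij: "i < n" "j < n" by auto
      then have "y i = y j \<longleftrightarrow> i = j" using inj(2) by (auto simp: inj_on_def)
      then show "mat n n (\<lambda>(i, j). pwalks 0 (x i) (y j)) $$ (i, j) = 1\<^sub>m n $$ (i, j)"
        using ij entry[OF ij] True by simp
    qed auto
    then show ?thesis using True by simp
  next
    case False
    have "\<exists>i<n. x i \<notin> y ` {..<n}"
    proof (rule ccontr)
      assume "\<not> ?thesis"
      then have sub: "x ` {..<n} \<subseteq> y ` {..<n}" by auto
      then have eq: "x ` {..<n} = y ` {..<n}"
        using inj by (intro card_subset_eq) (auto simp: card_image)
      have "x i = y i" if "i < n" for i
        using that
      proof (induction i rule: less_induct)
        case (less i)
        have "x i \<in> y ` {..<n}" "y i \<in> x ` {..<n}" using eq less.prems by blast+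
        then obtain j k where j: "j < n" "x i = y j" and k: "k < n" "y i = x k" by auto
        have "\<not> j < i" using less.IH[of j] j less.prems inj_onD[OF inj(1), of i j] by auto
        moreover have "\<not> k < i" using less.IH[of k] k less.prems inj_onD[OF inj(2), of i k] by auto
        \<comment> \<open>Otherwise \<open>x i < x k = y i < y j = x i\<close>.\<close>
        moreover have "\<not> (i < j \<and> i < k)"
          using chamber_strict_mono[OF assms(1), of i k] chamber_strict_mono[OF assms(2), of i j] j k by auto
        ultimately have "i = j \<or> i = k" by linarith
        then show ?case using j(2) k(2) by metis
      qed
      then show False using False by auto
    qed
    then obtain i where i: "i < n" "x i \<notin> y ` {..<n}" by auto
    have "(\<Prod>j = 0..<n. mat n n (\<lambda>(i, j). pwalks 0 (x i) (y j)) $$ (j, p j)) = 0"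
      if p: "p permutes {0..<n}" for p
    proof -
      have "p i < n" using i(1) permutes_in_image[OF p, of i] by simp
      then have "x i \<noteq> y (p i)" using i by auto
      then show ?thesis
        using i(1) \<open>p i < n\<close> by (intro prod_zero bexI[of _ i]) (auto simp: entry)
    qed
    then have "det (mat n n (\<lambda>(i, j). pwalks 0 (x i) (y j))) = 0"
      unfolding det_def by (auto intro!: sum.neutral)
    then show ?thesis using False by simp
  qed
qed

text \<open>On the wall at 0 a row vanishes by the reflection formula, and on a wall between two
  walkers two rows coincide.\<close>

lemma det_pwalks_outside:
  assumes "\<not> chamber n x" "\<And>i. i < n \<Longrightarrow> 0 \<le> x i" "\<And>i. Suc i < n \<Longrightarrow> x i \<le> x (Suc i)"
  shows "det (mat n n (\<lambda>(i, j). pwalks t (x i) (y j))) = 0"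
proof -
  from assms consider (zero) i where "i < n" "x i = 0" | (eq) i where "Suc i < n" "x i = x (Suc i)"
    unfolding chamber_def by (metis order_neq_le_trans)
  then show ?thesis
  proof cases
    case zero
    have "(\<Prod>j = 0..<n. mat n n (\<lambda>(i, j). pwalks t (x i) (y j)) $$ (j, p j)) = 0"
      if "p permutes {0..<n}" for p
      using zero permutes_in_image[OF that, of i] by (intro prod_zero bexI[of _ i]) auto
    then show ?thesis unfolding det_def by (auto intro!: sum.neutral)
  next
    case eq
    then show ?thesis
      by (intro det_identical_rows[of _ n i "Suc i"]) (auto intro!: eq_vecI)
  qed
qed

text \<open>By the one-step recursion each row is a sum of two rows; expanding by multilinearity,
  \<open>E\<close> collects the rows in which the up-step is chosen.\<close>

lemma det_pwalks_Suc:
  "det (mat n n (\<lambda>(i, j). pwalks (Suc t) (x i) (y j)))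
   = (\<Sum>E\<in>Pow {..<n}. det (mat n n (\<lambda>(i, j). pwalks t (move E x i) (y j))))"
proof -
  let ?P = "{p. p permutes {0..<n}}"
  have lt: "p i < n" if "p permutes {..<n}" "i < n" for p i
    using permutes_in_image[OF that(1), of i] that(2) by simp
  have "det (mat n n (\<lambda>(i, j). pwalks (Suc t) (x i) (y j)))
      = (\<Sum>p\<in>?P. signof p * (\<Prod>i\<in>{..<n}. pwalks t (x i + 1) (y (p i)) + pwalks t (x i - 1) (y (p i))))"
    unfolding det_def using lt
    by (auto intro!: sum.cong prod.cong simp: pwalks_Suc atLeast0LessThan add.commute)
  also have "\<dots> = (\<Sum>p\<in>?P. \<Sum>E\<in>Pow {..<n}. signof p * (\<Prod>i\<in>{..<n}. pwalks t (move E x i) (y (p i))))"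
  proof (intro sum.cong refl, subst prod_add, simp, subst sum_distrib_left, intro sum.cong refl)
    fix p E assume "E \<in> Pow {..<n}"
    then have E: "E \<subseteq> {..<n}" by auto
    have "(\<Prod>i\<in>{..<n}. pwalks t (move E x i) (y (p i)))
        = (\<Prod>i\<in>E. pwalks t (move E x i) (y (p i))) * (\<Prod>i\<in>{..<n} - E. pwalks t (move E x i) (y (p i)))"
      by (simp add: prod.subset_diff[OF E] mult.commute)
    then show "signof p * ((\<Prod>i\<in>E. pwalks t (x i + 1) (y (p i))) * (\<Prod>i\<in>{..<n} - E. pwalks t (x i - 1) (y (p i))))
      = signof p * (\<Prod>i\<in>{..<n}. pwalks t (move E x i) (y (p i)))"
      by (simp add: move_def)
  qed
  also have "\<dots> = (\<Sum>E\<in>Pow {..<n}. \<Sum>p\<in>?P. signof p * (\<Prod>i\<in>{..<n}. pwalks t (move E x i) (y (p i))))"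
    by (rule sum.swap)
  also have "\<dots> = (\<Sum>E\<in>Pow {..<n}. det (mat n n (\<lambda>(i, j). pwalks t (move E x i) (y j))))"
    unfolding det_def using lt
    by (auto intro!: sum.cong prod.cong simp: atLeast0LessThan)
  finally show ?thesis .
qed

lemma finite_subset_lists: "finite {Es. length Es = t \<and> (\<forall>E\<in>set Es. E \<subseteq> {..<n::nat})}"
  using finite_lists_length_eq[of "Pow {..<n}" t] by (auto elim!: rev_finite_subset)

lemma vicious_subset: "vicious n y x Es \<Longrightarrow> E \<in> set Es \<Longrightarrow> E \<subseteq> {..<n}"
  by (induction Es arbitrary: x) auto

lemma finite_vicious: "finite {Es. length Es = t \<and> vicious n y x Es}"
  by (rule finite_subset[OF _ finite_subset_lists[of t n]]) (auto dest: vicious_subset)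

text \<open>As all walkers move simultaneously and keep the same parity, a family leaves the chamber
  only through its walls, where the determinant vanishes.\<close>
lemma card_vicious:
  assumes "chamber n y" "chamber n x" "\<And>i. Suc i < n \<Longrightarrow> even (x i + x (Suc i))"
  shows "int (card {Es. length Es = t \<and> vicious n y x Es})
       = det (mat n n (\<lambda>(i, j). pwalks t (x i) (y j)))"
  using assms(2,3)
proof (induction t arbitrary: x)
  case 0
  have "{Es. length Es = 0 \<and> vicious n y x Es} = (if \<forall>i<n. x i = y i then {[]} else {})"
    by auto
  then show ?case using det_delta[OF 0(1) assms(1)] by simp
next
  case (Suc t)
  let ?V = "\<lambda>t x. {Es. length Es = t \<and> vicious n y x Es}"
  let ?A = "{E\<in>Pow {..<n}. chamber n (move E x)}"
  have eq: "?V (Suc t) x = (\<Union>E\<in>?A. (#) E ` ?V t (move E x))"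
  proof (intro subset_antisym subsetI)
    fix Es assume "Es \<in> ?V (Suc t) x"
    then show "Es \<in> (\<Union>E\<in>?A. (#) E ` ?V t (move E x))" by (cases Es) auto
  qed auto
  have "card (?V (Suc t) x) = (\<Sum>E\<in>?A. card ((#) E ` ?V t (move E x)))"
    unfolding eq by (rule card_UN_disjoint) (auto simp: finite_vicious)
  also have "\<dots> = (\<Sum>E\<in>?A. card (?V t (move E x)))"
    by (intro sum.cong refl card_image) auto
  finally have "int (card (?V (Suc t) x)) = (\<Sum>E\<in>?A. int (card (?V t (move E x))))" by simp
  also have "\<dots> = (\<Sum>E\<in>?A. det (mat n n (\<lambda>(i, j). pwalks t (move E x i) (y j))))"
    by (intro sum.cong refl Suc.IH) (use Suc.prems in \<open>auto simp: move_def\<close>)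
  also have "\<dots> = (\<Sum>E\<in>Pow {..<n}. det (mat n n (\<lambda>(i, j). pwalks t (move E x i) (y j))))"
  proof (rule sum.mono_neutral_left)
    show "\<forall>E\<in>Pow {..<n} - ?A. det (mat n n (\<lambda>(i, j). pwalks t (move E x i) (y j))) = 0"
    proof (intro ballI det_pwalks_outside)
      fix E i
      show "i < n \<Longrightarrow> 0 \<le> move E x i" using Suc.prems(1) by (force simp: chamber_def move_def)
      assume i: "Suc i < n"
      have "x i < x (Suc i)" "even (x i + x (Suc i))" using Suc.prems i by (auto simp: chamber_def)
      then have "x i + 2 \<le> x (Suc i)" by presburger
      then show "move E x i \<le> move E x (Suc i)" by (auto simp: move_def)
    qed auto
  qed auto
  also have "\<dots> = det (mat n n (\<lambda>(i, j). pwalks (Suc t) (x i) (y j)))"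
    by (rule det_pwalks_Suc[symmetric])
  finally show ?case .
qed

section \<open>Walker families and their number\<close>

definition walker_pos :: "nat set list \<Rightarrow> nat \<Rightarrow> nat \<Rightarrow> int" where
  "walker_pos Es t i = 2 * int i + 2 + (\<Sum>s<t. if i \<in> Es ! s then 1 else - 1)"

definition walker_families :: "nat \<Rightarrow> nat \<Rightarrow> nat set list set" where
  "walker_families n m = {Es. length Es = 2 * m \<and> (\<forall>E\<in>set Es. E \<subseteq> {..<n}) \<and>
     (\<forall>t\<le>2 * m. chamber n (walker_pos Es t)) \<and> (\<forall>i<n. walker_pos Es (2 * m) i = 2 * int i + 2)}"

lemma vicious_iff:
  "vicious n y x Es \<longleftrightarrow> (\<forall>E\<in>set Es. E \<subseteq> {..<n}) \<and>
     (\<forall>t<length Es. chamber n (\<lambda>i. x i + (\<Sum>s<Suc t. if i \<in> Es ! s then 1 else - 1))) \<and>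
     (\<forall>i<n. x i + (\<Sum>s<length Es. if i \<in> Es ! s then 1 else - 1) = y i)"
proof (induction Es arbitrary: x)
  case (Cons E Es)
  have *: "x i + (\<Sum>s<Suc t. if i \<in> (E # Es) ! s then 1 else - 1)
     = move E x i + (\<Sum>s<t. if i \<in> Es ! s then 1 else - 1)" for i t
    by (simp add: sum.lessThan_Suc_shift move_def del: sum.lessThan_Suc)
  show ?case
    unfolding vicious.simps Cons.IH list.set length_Cons * All_less_Suc2 by (auto simp del: sum.lessThan_Suc)
qed simp

lemma card_walker_families:
  "int (card (walker_families n m)) = det (mat n n (\<lambda>(i, j). int (catalan (m + 1 + i + j))))"
proof -
  let ?x = "\<lambda>i. 2 * int i + 2"
  have ch: "chamber n ?x" by (auto simp: chamber_def)
  have "Es \<in> walker_families n m \<longleftrightarrow> length Es = 2 * m \<and> vicious n ?x ?x Es" for Es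
  proof -
    have "(\<forall>t\<le>2 * m. chamber n (walker_pos Es t)) \<longleftrightarrow>
          chamber n (walker_pos Es 0) \<and> (\<forall>t<2 * m. chamber n (walker_pos Es (Suc t)))"
      unfolding less_Suc_eq_le[symmetric] by (rule All_less_Suc2)
    moreover have "chamber n (walker_pos Es 0)" using ch by (simp add: walker_pos_def chamber_def)
    ultimately show ?thesis
      unfolding walker_families_def vicious_iff walker_pos_def[abs_def] by auto
  qed
  then have "walker_families n m = {Es. length Es = 2 * m \<and> vicious n ?x ?x Es}" by blast
  then show ?thesis
    using card_vicious[OF ch ch, of "2 * m"] det_pwalks_eq_det_catalan[of n m] by simp
qed

lemma finite_walker_families: "finite (walker_families n m)"
  by (rule finite_subset[OF _ finite_subset_lists[of "2 * m" n]]) (auto simp: walker_families_def)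

section \<open>Creation and annihilation operators\<close>

text \<open>The Jordan-Wigner sign of moving \<open>e\<^sub>k\<close> into its sorted position. Only
  elements below \<open>k\<close> are counted, so the cardinality is that of a finite set even for
  infinite \<open>S\<close>.\<close>

definition jw_sign :: "nat \<Rightarrow> nat set \<Rightarrow> complex" where
  "jw_sign k S = (-1) ^ card {l\<in>S. l < k}"

text \<open>A function \<open>\<phi> :: nat set \<Rightarrow> complex\<close> stands for \<open>\<Sum> \<phi> S e\<^sub>S\<close> in the exterior algebra on generators
  \<open>e\<^sub>k\<close>; \<open>cr k\<close> and \<open>an k\<close> are the exterior product with \<open>e\<^sub>k\<close> and its adjoint.\<close>
definition cr :: "nat \<Rightarrow> (nat set \<Rightarrow> complex) \<Rightarrow> nat set \<Rightarrow> complex" where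
  "cr k \<phi> S = (if k \<in> S then jw_sign k S * \<phi> (S - {k}) else 0)"

definition an :: "nat \<Rightarrow> (nat set \<Rightarrow> complex) \<Rightarrow> nat set \<Rightarrow> complex" where
  "an k \<phi> S = (if k \<notin> S then jw_sign k S * \<phi> (insert k S) else 0)"

lemma jw_sign_insert:
  assumes "a \<notin> S"
  shows "jw_sign k (insert a S) = (if a < k then - jw_sign k S else jw_sign k S)"
proof (cases "a < k")
  case True
  then have "{l\<in>insert a S. l < k} = insert a {l\<in>S. l < k}" by auto
  moreover have "finite {l\<in>S. l < k}" by simp
  ultimately show ?thesis using assms True by (simp add: jw_sign_def)
next
  case False
  then have "{l\<in>insert a S. l < k} = {l\<in>S. l < k}" by auto
  then show ?thesis using False by (simp add: jw_sign_def)
qed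

lemma jw_sign_remove:
  assumes "a \<in> S"
  shows "jw_sign k (S - {a}) = (if a < k then - jw_sign k S else jw_sign k S)"
  using jw_sign_insert[of a "S - {a}" k] assms by (auto simp: insert_absorb)

lemma jw_sign_square [simp]: "jw_sign k S * jw_sign k S = 1" "jw_sign k S * (jw_sign k S * z) = z"
proof -
  show *: "jw_sign k S * jw_sign k S = 1"
    unfolding jw_sign_def power_mult_distrib[symmetric] by simp
  show "jw_sign k S * (jw_sign k S * z) = z"
    using * by (simp add: mult.assoc[symmetric])
qed

lemma cr_cr: "cr k (cr l \<phi>) S = - cr l (cr k \<phi>) S"
proof (cases "k = l \<or> k \<notin> S \<or> l \<notin> S")
  case True
  then show ?thesis by (auto simp: cr_def)
next
  case False
  then have "S - {k} - {l} = S - {l} - {k}" by auto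
  with False show ?thesis by (auto simp: cr_def jw_sign_remove)
qed

text \<open>Canonical anticommutation relation: for \<open>k \<noteq> l\<close>, exactly one of the
  two signs changes when the order of the operators is reversed.\<close>

lemma an_cr: "an k (cr l \<phi>) S = (if k = l then \<phi> S else 0) - cr l (an k \<phi>) S"
proof (cases "k = l")
  case True
  then show ?thesis
    by (cases "k \<in> S") (auto simp: cr_def an_def jw_sign_insert jw_sign_remove insert_absorb)
next
  case False
  show ?thesis
  proof (cases "k \<notin> S \<and> l \<in> S")
    case True
    then have "insert k S - {l} = insert k (S - {l})" using False by auto
    with True False show ?thesis by (auto simp: cr_def an_def jw_sign_insert jw_sign_remove)
  qed (use False in \<open>auto simp: cr_def an_def\<close>)
qed

lemma cr_linear:
  "cr k (\<lambda>S. \<phi> S + \<psi> S) S = cr k \<phi> S + cr k \<psi> S"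
  "cr k (\<lambda>S. c * \<phi> S) S = c * cr k \<phi> S"
  "cr k (\<lambda>S. - \<phi> S) S = - cr k \<phi> S"
  "cr k (\<lambda>S. \<phi> S - \<psi> S) S = cr k \<phi> S - cr k \<psi> S"
  "cr k (\<lambda>S. \<Sum>a\<in>A. f a S) S = (\<Sum>a\<in>A. cr k (f a) S)"
  by (auto simp: cr_def algebra_simps sum_distrib_left)

lemma an_linear:
  "an k (\<lambda>S. \<phi> S + \<psi> S) S = an k \<phi> S + an k \<psi> S"
  "an k (\<lambda>S. c * \<phi> S) S = c * an k \<phi> S"
  "an k (\<lambda>S. - \<phi> S) S = - an k \<phi> S"
  "an k (\<lambda>S. \<phi> S - \<psi> S) S = an k \<phi> S - an k \<psi> S"
  "an k (\<lambda>S. \<Sum>a\<in>A. f a S) S = (\<Sum>a\<in>A. an k (f a) S)"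
  by (auto simp: an_def algebra_simps sum_distrib_left)

text \<open>The matrix unit that sends \<open>e\<^sub>l\<close> to \<open>e\<^sub>k\<close>, acting
  on the exterior algebra as a derivation.\<close>

definition hop :: "nat \<Rightarrow> nat \<Rightarrow> (nat set \<Rightarrow> complex) \<Rightarrow> nat set \<Rightarrow> complex" where
  "hop k l \<phi> = cr k (an l \<phi>)"

lemma hop_linear:
  "hop k l (\<lambda>S. c * \<phi> S) S = c * hop k l \<phi> S"
  "hop k l (\<lambda>S. \<Sum>a\<in>A. f a S) S = (\<Sum>a\<in>A. hop k l (f a) S)"
  unfolding hop_def by (simp_all add: cr_linear an_linear[abs_def])

lemma hop_cr: "hop k l (cr q \<phi>) S = cr q (hop k l \<phi>) S + (if l = q then cr k \<phi> S else 0)"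
proof -
  have "an l (cr q \<phi>) = (\<lambda>S. (if l = q then \<phi> S else 0) - cr q (an l \<phi>) S)"
    by (rule ext) (rule an_cr)
  moreover have "cr k (\<lambda>S. if l = q then \<phi> S else 0) S = (if l = q then cr k \<phi> S else 0)"
    by (simp add: cr_def)
  ultimately show ?thesis
    by (simp add: hop_def cr_linear cr_cr[of k q])
qed

lemma hop_same: "hop k k \<phi> S = (if k \<in> S then \<phi> S else 0)"
  by (auto simp: hop_def cr_def an_def jw_sign_remove insert_absorb)

text \<open>Elements below both indices are counted twice and cancel, which leaves the sign
  convention of \<open>wedge_act\<close>.\<close>

lemma jw_sign_mult:
  assumes "k \<notin> R" "l \<notin> R" "k \<noteq> l"
  shows "jw_sign k R * jw_sign l R = (-1) ^ card {r\<in>R. min k l < r \<and> r < max k l}"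
proof -
  have *: "jw_sign k R * jw_sign l R = (-1) ^ card {r\<in>R. k < r \<and> r < l}" if "k < l" "k \<notin> R" for k l
  proof -
    have *: "{r\<in>R. r < l} = {r\<in>R. r < k} \<union> {r\<in>R. k < r \<and> r < l}"
      using that by (auto simp: not_less le_less)
    have "card {r\<in>R. r < l} = card {r\<in>R. r < k} + card {r\<in>R. k < r \<and> r < l}"
      unfolding * by (rule card_Un_disjoint) auto
    then have "jw_sign l R = jw_sign k R * (-1) ^ card {r\<in>R. k < r \<and> r < l}"
      by (simp add: jw_sign_def power_add)
    then show ?thesis by simp
  qed
  show ?thesis
  proof (cases "k < l")
    case True
    then show ?thesis using *[of k l] assms by simp
  next
    case False
    then have "l < k" using assms by simp
    then show ?thesis using *[of l k] assms by (simp add: mult.commute)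
  qed
qed

lemma hop_diff:
  assumes "k \<noteq> l"
  shows "hop k l \<phi> S = (if k \<in> S \<and> l \<notin> S
    then (-1) ^ card {r\<in>S - {k}. min k l < r \<and> r < max k l} * \<phi> (insert l (S - {k})) else 0)"
  using assms jw_sign_mult[of k "S - {k}" l]
  by (auto simp: hop_def cr_def an_def jw_sign_remove mult.assoc[symmetric])

section \<open>The tensor power as one large exterior algebra\<close>

text \<open>The index \<open>p * (2 * n) + i\<close> stands for the basis vector \<open>i\<close> in the tensor factor \<open>p\<close>. With
  \<open>k = s * n + r\<close> and \<open>r < n\<close>, this is \<open>p\<^sub>r\<close> in factor \<open>s div 2\<close> for even \<open>s\<close> and \<open>q\<^sub>r\<close> for odd \<open>s\<close>.\<close>
definition enc :: "nat \<Rightarrow> nat set list \<Rightarrow> nat set" where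
  "enc n T = {p * (2 * n) + i | p i. p < length T \<and> i \<in> T ! p}"

definition dec :: "nat \<Rightarrow> nat \<Rightarrow> nat set \<Rightarrow> nat set list" where
  "dec n m S = map (\<lambda>p. {i. i < 2 * n \<and> p * (2 * n) + i \<in> S}) [0..<m]"

lemma index_eq_iff:
  fixes n :: nat
  assumes "i < n" "j < n"
  shows "p * n + i = q * n + j \<longleftrightarrow> p = q \<and> i = j"
proof
  assume "p * n + i = q * n + j"
  then have "(p * n + i) div n = (q * n + j) div n" "(p * n + i) mod n = (q * n + j) mod n" by auto
  then show "p = q \<and> i = j" using assms by auto
qed auto

lemma index_less:
  fixes n :: nat
  assumes "i < n" "p < q"
  shows "p * n + i < q * n"
proof -
  have "p * n + i < Suc p * n" using assms by simp
  also have "\<dots> \<le> q * n" using assms by (intro mult_right_mono) auto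
  finally show ?thesis .
qed

lemma tbasis_nth: "T \<in> tbasis n m \<Longrightarrow> p < m \<Longrightarrow> T ! p \<subseteq> {..<2 * n}"
  by (auto simp: tbasis_def)

lemma length_tbasis: "T \<in> tbasis n m \<Longrightarrow> length T = m"
  by (simp add: tbasis_def)

lemma mem_enc:
  assumes "T \<in> tbasis n m" "p < m" "i < 2 * n"
  shows "p * (2 * n) + i \<in> enc n T \<longleftrightarrow> i \<in> T ! p"
proof
  assume "p * (2 * n) + i \<in> enc n T"
  then obtain q j where qj: "p * (2 * n) + i = q * (2 * n) + j" "q < m" "j \<in> T ! q"
    using assms by (auto simp: enc_def tbasis_def)
  then have "j < 2 * n" using tbasis_nth[OF assms(1)] by auto
  then show "i \<in> T ! p" using qj index_eq_iff[OF assms(3)] by metis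
qed (use assms in \<open>auto simp: enc_def tbasis_def\<close>)

lemma enc_subset: "T \<in> tbasis n m \<Longrightarrow> enc n T \<subseteq> {..<2 * n * m}"
proof
  fix k assume T: "T \<in> tbasis n m" and "k \<in> enc n T"
  then obtain p i where k: "k = p * (2 * n) + i" "p < m" "i \<in> T ! p"
    unfolding enc_def length_tbasis[OF T] by blast
  then have "i < 2 * n" using tbasis_nth[OF T] by auto
  then show "k \<in> {..<2 * n * m}" using index_less[of i "2 * n" p m] k by (simp add: mult.commute)
qed

lemma dec_in_tbasis: "dec n m S \<in> tbasis n m"
  by (auto simp: dec_def tbasis_def)

lemma enc_dec:
  assumes "S \<subseteq> {..<2 * n * m}"
  shows "enc n (dec n m S) = S"
proof (intro subset_antisym subsetI)
  fix k assume "k \<in> S"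
  then have k: "k < m * (2 * n)" using assms by (auto simp: mult.commute)
  then have "0 < 2 * n" by (cases "n = 0") auto
  then have "k div (2 * n) < m" "k mod (2 * n) < 2 * n" using k by (auto simp: less_mult_imp_div_less)
  then show "k \<in> enc n (dec n m S)"
    unfolding enc_def mem_Collect_eq using \<open>k \<in> S\<close>
    by - (rule exI[of _ "k div (2 * n)"], rule exI[of _ "k mod (2 * n)"],
        simp only: div_mult_mod_eq, simp add: dec_def div_mult_mod_eq del: mult_2 mult.assoc)
qed (auto simp: enc_def dec_def)

lemma dec_enc: "T \<in> tbasis n m \<Longrightarrow> dec n m (enc n T) = T"
proof (rule nth_equalityI)
  assume T: "T \<in> tbasis n m"
  show "length (dec n m (enc n T)) = length T" using T by (simp add: dec_def length_tbasis)
  fix p assume "p < length (dec n m (enc n T))"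
  then have p: "p < m" by (simp add: dec_def)
  then have "dec n m (enc n T) ! p = {i. i < 2 * n \<and> i \<in> T ! p}"
    using mem_enc[OF T p] by (auto simp: dec_def)
  then show "dec n m (enc n T) ! p = T ! p" using tbasis_nth[OF T p] by auto
qed

text \<open>The action of matrices on the exterior algebra of
  \<open>V \<otimes> \<complex>\<^sup>m\<close>: each matrix unit hops inside every one of the
  \<open>m\<close> blocks.\<close>

definition rho :: "nat \<Rightarrow> nat \<Rightarrow> (nat \<Rightarrow> nat \<Rightarrow> complex) \<Rightarrow> (nat set \<Rightarrow> complex) \<Rightarrow> nat set \<Rightarrow> complex" where
  "rho n m X \<phi> S = (\<Sum>p<m. \<Sum>i<2*n. \<Sum>j<2*n. X i j * hop (p * (2 * n) + i) (p * (2 * n) + j) \<phi> S)"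

lemma enc_update:
  assumes T: "T \<in> tbasis n m" and p: "p < m" and ij: "i < 2 * n" "j < 2 * n" "i \<noteq> j" "i \<in> T ! p"
  shows "enc n (T[p := insert j (T ! p - {i})])
    = insert (p * (2 * n) + j) (enc n T - {p * (2 * n) + i})"
proof -
  have T': "T[p := insert j (T ! p - {i})] \<in> tbasis n m"
    using T p ij tbasis_nth[OF T p] by (auto simp: tbasis_def dest!: set_update_subset_insert[THEN subsetD])
  have eq: "k \<in> enc n U \<longleftrightarrow> k div (2 * n) < m \<and> k mod (2 * n) \<in> U ! (k div (2 * n))"
    if "U \<in> tbasis n m" for U k
  proof
    assume "k \<in> enc n U"
    then have "\<exists>q j. k = q * (2 * n) + j \<and> q < m \<and> j \<in> U ! q"
      unfolding enc_def length_tbasis[OF that] by blast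
    then obtain q j where qj: "k = q * (2 * n) + j" "q < m" "j \<in> U ! q" by blast
    then have "j < 2 * n" using tbasis_nth[OF that] by auto
    then show "k div (2 * n) < m \<and> k mod (2 * n) \<in> U ! (k div (2 * n))" using qj by simp
  next
    assume "k div (2 * n) < m \<and> k mod (2 * n) \<in> U ! (k div (2 * n))"
    then show "k \<in> enc n U"
      unfolding enc_def mem_Collect_eq length_tbasis[OF that]
      by - (rule exI[of _ "k div (2 * n)"], rule exI[of _ "k mod (2 * n)"], simp only: div_mult_mod_eq)
  qed
  have dm: "k = p * (2 * n) + r \<longleftrightarrow> k div (2 * n) = p \<and> k mod (2 * n) = r" if "r < 2 * n" for k r
  proof
    assume "k div (2 * n) = p \<and> k mod (2 * n) = r"
    then show "k = p * (2 * n) + r" using div_mult_mod_eq[of k "2 * n"] by metis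
  qed (use that in simp)
  show ?thesis
    unfolding set_eq_iff
  proof (intro allI)
    fix k
    show "k \<in> enc n (T[p := insert j (T ! p - {i})])
      \<longleftrightarrow> k \<in> insert (p * (2 * n) + j) (enc n T - {p * (2 * n) + i})"
      unfolding eq[OF T'] insert_iff Diff_iff empty_iff eq[OF T] dm[OF ij(1)] dm[OF ij(2)]
      using p ij length_tbasis[OF T] by (cases "k div (2 * n) = p") auto
  qed
qed

text \<open>Both generators lie in block \<open>p\<close>, and so does everything strictly between
  them. Hence the sign sees only the factor \<open>p\<close>, and no sign arises from the other
  tensor factors. The second factor of the summand is the coefficient of \<open>X i j\<close> in
  \<open>wedge_act\<close>.\<close>

lemma hop_enc:
  assumes T: "T \<in> tbasis n m" and p: "p < m" and ij: "i < 2 * n" "j < 2 * n"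
  shows "hop (p * (2 * n) + i) (p * (2 * n) + j) \<phi> (enc n T) =
    (\<Sum>S\<in>Pow {..<2*n}. \<phi> (enc n (T[p := S])) *
      (if j \<notin> S then 0 else if i = j then (if T ! p = S then 1 else 0) else if i \<in> S then 0
       else if T ! p = insert i (S - {j}) then (-1) ^ card {k\<in>S. min i j < k \<and> k < max i j} else 0))"
    (is "_ = (\<Sum>S\<in>_. ?f S)")
proof (cases "i = j")
  case True
  have "(\<Sum>S\<in>Pow {..<2*n}. ?f S) = (\<Sum>S\<in>Pow {..<2*n}. if S = T ! p then (if j \<in> T ! p then \<phi> (enc n T) else 0) else 0)"
    using True length_tbasis[OF T] p by (intro sum.cong) auto
  also have "\<dots> = (if j \<in> T ! p then \<phi> (enc n T) else 0)"
    using tbasis_nth[OF T p] by (simp add: sum.delta)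
  finally show ?thesis using True mem_enc[OF T p ij(2)] by (simp add: hop_same)
next
  case False
  let ?S = "insert j (T ! p - {i})"
  let ?k = "p * (2 * n) + i" and ?l = "p * (2 * n) + j"
  let ?c = "(-1) ^ card {k\<in>?S. min i j < k \<and> k < max i j} :: complex"
  have iff: "j \<in> S \<and> i \<notin> S \<and> T ! p = insert i (S - {j}) \<longleftrightarrow> S = ?S \<and> i \<in> T ! p \<and> j \<notin> T ! p" for S
    using False by auto
  have "(\<Sum>S\<in>Pow {..<2*n}. ?f S)
      = (\<Sum>S\<in>Pow {..<2*n}. if S = ?S then (if i \<in> T ! p \<and> j \<notin> T ! p then \<phi> (enc n (T[p := ?S])) * ?c else 0) else 0)"
  proof (intro sum.cong refl)
    fix S
    show "?f S = (if S = ?S then (if i \<in> T ! p \<and> j \<notin> T ! p then \<phi> (enc n (T[p := ?S])) * ?c else 0) else 0)"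
      using False iff[of S] by (auto split: if_splits)
  qed
  also have "\<dots> = (if i \<in> T ! p \<and> j \<notin> T ! p then \<phi> (enc n (T[p := ?S])) * ?c else 0)"
    using tbasis_nth[OF T p] ij by (subst sum.delta) auto
  also have "\<dots> = hop ?k ?l \<phi> (enc n T)"
  proof (cases "i \<in> T ! p \<and> j \<notin> T ! p")
    case True
    have "{r\<in>enc n T - {?k}. min ?k ?l < r \<and> r < max ?k ?l}
        = (\<lambda>r. p * (2 * n) + r) ` {r\<in>?S. min i j < r \<and> r < max i j}" (is "?A = ?B")
    proof (intro subset_antisym subsetI)
      fix r assume r: "r \<in> ?A"
      define s where "s = r - p * (2 * n)"
      have s: "r = p * (2 * n) + s" "min i j < s" "s < max i j"
        using r by (auto simp: s_def min_def max_def split: if_splits)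
      then have "s < 2 * n" using ij by auto
      then have "s \<in> T ! p" using r s mem_enc[OF T p] by auto
      then show "r \<in> ?B" using s by auto
    next
      fix r assume "r \<in> ?B"
      then obtain s where s: "r = p * (2 * n) + s" "s \<in> ?S" "min i j < s" "s < max i j" by auto
      then have "s \<in> T ! p" "s \<noteq> i" "s < 2 * n" using ij by (auto simp: min_def max_def split: if_splits)
      then show "r \<in> ?A" using s mem_enc[OF T p, of s] by auto
    qed
    then have "card ?A = card {r\<in>?S. min i j < r \<and> r < max i j}"
      by (simp add: card_image inj_on_def)
    then show ?thesis
      using True False mem_enc[OF T p] ij enc_update[OF T p ij False]
      by (simp add: hop_diff mult.commute)
  next
    case no: False
    then show ?thesis using False mem_enc[OF T p] ij by (auto simp: hop_diff)
  qed
  finally show ?thesis by simp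
qed

lemma finite_tbasis: "finite (tbasis n m)"
  using finite_lists_length_eq[of "Pow {..<2*n}" m]
  by (auto simp: tbasis_def Pow_def elim!: rev_finite_subset)

text \<open>The basis tensors that contribute to the coefficient at \<open>T\<close> through factor
  \<open>p\<close> are the updates \<open>T[p := S]\<close>; for these, \<open>hop_enc\<close>
  identifies the two actions entry by entry.\<close>

lemma tensor_act_eq_rho:
  assumes T: "T \<in> tbasis n m"
  shows "tensor_act n m X (\<lambda>T. if T \<in> tbasis n m then \<phi> (enc n T) else 0) T = rho n m X \<phi> (enc n T)"
proof -
  let ?agree = "\<lambda>p Bs. \<forall>q<m. q \<noteq> p \<longrightarrow> T ! q = Bs ! q"
  let ?W = "\<lambda>p i j S. (if j \<notin> S then 0 else if i = j then (if T ! p = S then 1 else 0) else if i \<in> S then 0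
       else if T ! p = insert i (S - {j}) then (-1) ^ card {k\<in>S. min i j < k \<and> k < max i j} else 0) :: complex"
  have wedge: "wedge_act n X S (T ! p) = (\<Sum>i<2*n. \<Sum>j<2*n. X i j * ?W p i j S)"
    if "S \<subseteq> {..<2*n}" for S p
  proof -
    have "wedge_act n X S (T ! p) = (\<Sum>j\<in>S. \<Sum>i<2*n. X i j * ?W p i j S)"
      unfolding wedge_act_def by (intro sum.cong refl) auto
    also have "\<dots> = (\<Sum>j<2*n. \<Sum>i<2*n. X i j * ?W p i j S)"
      by (rule sum.mono_neutral_left) (use that in auto)
    finally show ?thesis by (subst sum.swap)
  qed
  have "tensor_act n m X (\<lambda>T. if T \<in> tbasis n m then \<phi> (enc n T) else 0) T
      = (\<Sum>Bs\<in>tbasis n m. \<Sum>p<m. if ?agree p Bs then \<phi> (enc n Bs) * wedge_act n X (Bs ! p) (T ! p) else 0)"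
    unfolding tensor_act_def tensor_act_basis_def
    by (intro sum.cong refl)
      (auto simp: length_tbasis length_tbasis[OF T] sum_distrib_left if_distrib[of "\<lambda>x. _ * x"] intro!: sum.cong)
  also have "\<dots> = (\<Sum>p<m. \<Sum>Bs | Bs \<in> tbasis n m \<and> ?agree p Bs. \<phi> (enc n Bs) * wedge_act n X (Bs ! p) (T ! p))"
    by (subst sum.swap) (simp add: sum.inter_filter finite_tbasis)
  also have "\<dots> = (\<Sum>p<m. \<Sum>S\<in>Pow {..<2*n}. \<phi> (enc n (T[p := S])) * wedge_act n X S (T ! p))"
  proof (intro sum.cong refl)
    fix p assume "p \<in> {..<m}"
    then have p: "p < m" by simp
    have l: "length T = m" using T by (rule length_tbasis)
    have "{Bs. Bs \<in> tbasis n m \<and> ?agree p Bs} = (\<lambda>S. T[p := S]) ` Pow {..<2*n}"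
    proof (intro subset_antisym subsetI)
      fix Bs assume Bs: "Bs \<in> {Bs. Bs \<in> tbasis n m \<and> ?agree p Bs}"
      then have lB: "length Bs = m" by (auto simp: tbasis_def)
      have "Bs = T[p := Bs ! p]"
      proof (rule nth_equalityI)
        fix i assume "i < length Bs"
        then show "Bs ! i = T[p := Bs ! p] ! i" using Bs l lB by (cases "i = p") simp_all
      qed (simp add: l lB)
      then show "Bs \<in> (\<lambda>S. T[p := S]) ` Pow {..<2*n}" using Bs tbasis_nth[of Bs n m p] p by auto
    next
      fix Bs assume "Bs \<in> (\<lambda>S. T[p := S]) ` Pow {..<2*n}"
      then show "Bs \<in> {Bs. Bs \<in> tbasis n m \<and> ?agree p Bs}"
        using T p by (auto simp: tbasis_def dest!: set_update_subset_insert[THEN subsetD])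
    qed
    moreover have "inj_on (\<lambda>S. T[p := S]) (Pow {..<2*n})"
      by (rule inj_onI) (metis l p nth_list_update_eq)
    ultimately show "(\<Sum>Bs | Bs \<in> tbasis n m \<and> ?agree p Bs. \<phi> (enc n Bs) * wedge_act n X (Bs ! p) (T ! p))
      = (\<Sum>S\<in>Pow {..<2*n}. \<phi> (enc n (T[p := S])) * wedge_act n X S (T ! p))"
      using l p by (simp add: sum.reindex)
  qed
  also have "\<dots> = (\<Sum>p<m. \<Sum>i<2*n. \<Sum>j<2*n. X i j * (\<Sum>S\<in>Pow {..<2*n}. \<phi> (enc n (T[p := S])) * ?W p i j S))"
  proof (intro sum.cong refl)
    fix p
    have "(\<Sum>S\<in>Pow {..<2*n}. \<phi> (enc n (T[p := S])) * wedge_act n X S (T ! p))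
       = (\<Sum>S\<in>Pow {..<2*n}. \<Sum>i<2*n. \<Sum>j<2*n. X i j * (\<phi> (enc n (T[p := S])) * ?W p i j S))"
    proof (rule sum.cong[OF refl])
      fix S assume "S \<in> Pow {..<2*n}"
      then have S: "S \<subseteq> {..<2*n}" by simp
      show "\<phi> (enc n (T[p := S])) * wedge_act n X S (T ! p)
         = (\<Sum>i<2*n. \<Sum>j<2*n. X i j * (\<phi> (enc n (T[p := S])) * ?W p i j S))"
        unfolding wedge[OF S] sum_distrib_left by (intro sum.cong refl mult.left_commute)
    qed
    also have "\<dots> = (\<Sum>i<2*n. \<Sum>j<2*n. \<Sum>S\<in>Pow {..<2*n}. X i j * (\<phi> (enc n (T[p := S])) * ?W p i j S))"
      by (subst sum.swap, intro sum.cong refl, subst sum.swap, rule refl)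
    finally show "(\<Sum>S\<in>Pow {..<2*n}. \<phi> (enc n (T[p := S])) * wedge_act n X S (T ! p))
       = (\<Sum>i<2*n. \<Sum>j<2*n. X i j * (\<Sum>S\<in>Pow {..<2*n}. \<phi> (enc n (T[p := S])) * ?W p i j S))"
      by (simp only: sum_distrib_left)
  qed
  also have "\<dots> = rho n m X \<phi> (enc n T)"
    unfolding rho_def by (intro sum.cong refl) (simp only: hop_enc[OF T] lessThan_iff)
  finally show ?thesis .
qed

text \<open>Invariance is an equality of functions on all lists, so the coefficients outside
  \<open>tbasis\<close> have to be settled as well.\<close>

lemma tensor_act_outside:
  assumes "T \<notin> tbasis n m"
  shows "tensor_act n m X w T = 0"
  unfolding tensor_act_def
proof (intro sum.neutral ballI)
  fix Bs assume Bs: "Bs \<in> tbasis n m"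
  have "(if length T = length Bs \<and> (\<forall>q<length Bs. q \<noteq> p \<longrightarrow> T ! q = Bs ! q)
         then wedge_act n X (Bs ! p) (T ! p) else 0) = 0" if p: "p < length Bs" for p
  proof (rule ccontr)
    assume ne: "\<not> ?thesis"
    then have l: "length T = length Bs" and eq: "\<forall>q<length Bs. q \<noteq> p \<longrightarrow> T ! q = Bs ! q"
      and w: "wedge_act n X (Bs ! p) (T ! p) \<noteq> 0" by (auto split: if_splits)
    have B: "Bs ! p \<subseteq> {..<2 * n}" using tbasis_nth[OF Bs] p length_tbasis[OF Bs] by simp
    have "T ! p \<subseteq> {..<2 * n}"
    proof (rule ccontr)
      assume no: "\<not> T ! p \<subseteq> {..<2 * n}"
      have "wedge_act n X (Bs ! p) (T ! p) = 0"
        unfolding wedge_act_def using no B by (intro sum.neutral ballI) auto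
      then show False using w by simp
    qed
    then have "T \<in> tbasis n m"
      using Bs l eq tbasis_nth[OF Bs] by (auto simp: tbasis_def in_set_conv_nth) (metis lessThan_iff subsetD)
    then show False using assms by simp
  qed
  then show "w Bs * tensor_act_basis n X Bs T = 0"
    unfolding tensor_act_basis_def by (simp add: sum.neutral)
qed

section \<open>The upper bound\<close>

lemma an_an: "an k (an l \<phi>) S = - an l (an k \<phi>) S"
proof (cases "k = l \<or> k \<in> S \<or> l \<in> S")
  case True
  then show ?thesis by (auto simp: an_def)
next
  case False
  then have "insert k (insert l S) = insert l (insert k S)" by auto
  with False show ?thesis by (auto simp: an_def jw_sign_insert)
qed

lemma hop_an: "hop k l (an q \<phi>) S = an q (hop k l \<phi>) S - (if q = k then an l \<phi> S else 0)"
proof -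
  have "an l (an q \<phi>) = (\<lambda>S. - an q (an l \<phi>) S)" by (rule ext) (rule an_an)
  then show ?thesis by (simp add: hop_def an_cr cr_linear)
qed

text \<open>The commutation relations of matrix units, from which the commutator of a lowering
  operator with its adjoint is computed.\<close>

lemma hop_hop:
  "hop k l (hop p q \<phi>) S = hop p q (hop k l \<phi>) S
     + (if l = p then hop k q \<phi> S else 0) - (if q = k then hop p l \<phi> S else 0)"
proof -
  have "hop k l (an q \<phi>) = (\<lambda>S. an q (hop k l \<phi>) S - (if q = k then an l \<phi> S else 0))"
    by (rule ext) (rule hop_an)
  moreover have "cr p (\<lambda>S. if q = k then an l \<phi> S else 0) S = (if q = k then cr p (an l \<phi>) S else 0)"
    by (simp add: cr_def)
  ultimately show ?thesis by (simp add: hop_def[of p] hop_cr cr_linear) (simp add: hop_def)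
qed

text \<open>The Hermitian form for which the \<open>e\<^sub>S\<close> with
  \<open>S \<subseteq> D\<close> are orthonormal; with respect to it \<open>hop k l\<close> and
  \<open>hop l k\<close> are adjoint for \<open>k\<close>, \<open>l\<close> in
  \<open>D\<close>.\<close>

definition ip :: "nat set \<Rightarrow> (nat set \<Rightarrow> complex) \<Rightarrow> (nat set \<Rightarrow> complex) \<Rightarrow> complex" where
  "ip D \<phi> \<psi> = (\<Sum>S\<in>Pow D. cnj (\<phi> S) * \<psi> S)"

lemma cnj_jw_sign [simp]: "cnj (jw_sign k S) = jw_sign k S"
  by (simp add: jw_sign_def)

lemma ip_cnj: "cnj (ip D \<phi> \<psi>) = ip D \<psi> \<phi>"
  by (simp add: ip_def mult.commute)

lemma ip_cr:
  assumes "finite D" "k \<in> D"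
  shows "ip D (cr k \<phi>) \<psi> = ip D \<phi> (an k \<psi>)"
proof -
  have "ip D (cr k \<phi>) \<psi> = (\<Sum>S | S \<in> Pow D \<and> k \<in> S. jw_sign k S * cnj (\<phi> (S - {k})) * \<psi> S)"
    unfolding ip_def using assms by (intro sum.mono_neutral_cong_right) (auto simp: cr_def)
  also have "\<dots> = (\<Sum>S | S \<in> Pow D \<and> k \<notin> S. cnj (\<phi> S) * (jw_sign k S * \<psi> (insert k S)))"
    by (rule sum.reindex_bij_witness[of _ "insert k" "\<lambda>S. S - {k}"])
      (use assms in \<open>auto simp: insert_absorb jw_sign_remove\<close>)
  also have "\<dots> = ip D \<phi> (an k \<psi>)"
    unfolding ip_def using assms by (intro sum.mono_neutral_cong_left) (auto simp: an_def)
  finally show ?thesis .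
qed

lemma ip_hop:
  assumes "finite D" "k \<in> D" "l \<in> D"
  shows "ip D (hop l k \<phi>) \<psi> = ip D \<phi> (hop k l \<psi>)"
proof -
  have "ip D (hop l k \<phi>) \<psi> = ip D (an k \<phi>) (an l \<psi>)"
    using assms by (simp add: hop_def ip_cr)
  also have "\<dots> = cnj (ip D (an l \<psi>) (an k \<phi>))" by (simp add: ip_cnj)
  also have "ip D (an l \<psi>) (an k \<phi>) = ip D (cr k (an l \<psi>)) \<phi>"
    using assms by (simp add: ip_cr)
  finally show ?thesis by (simp add: ip_cnj hop_def)
qed

text \<open>With \<open>F = \<Sum> \<sigma> hop k l\<close> and its adjoint \<open>F\<^sup>*\<close>, disjointness of the index pairs gives
  \<open>[F, F\<^sup>*] = \<Sum> (N\<^sub>k - N\<^sub>l)\<close>, so \<open>F u = 0\<close> implies \<open>|F\<^sup>* u|\<^sup>2 = w |u|\<^sup>2\<close>.\<close>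
lemma lowest_weight_nonneg:
  fixes k l :: "nat \<Rightarrow> nat" and \<sigma> :: "nat \<Rightarrow> complex"
  assumes fin: "finite A" "finite D" and D: "\<And>s. s \<in> A \<Longrightarrow> k s \<in> D" "\<And>s. s \<in> A \<Longrightarrow> l s \<in> D"
    and inj: "inj_on k A" "inj_on l A"
    and kl: "\<And>s s'. s \<in> A \<Longrightarrow> s' \<in> A \<Longrightarrow> k s \<noteq> l s'"
    and \<sigma>: "\<And>s. s \<in> A \<Longrightarrow> \<sigma> s = 1 \<or> \<sigma> s = - 1"
    and killed: "\<And>S. (\<Sum>s\<in>A. \<sigma> s * hop (k s) (l s) u S) = 0"
    and weight: "\<And>S. u S \<noteq> 0 \<Longrightarrow> (\<Sum>s\<in>A. of_bool (k s \<in> S) - of_bool (l s \<in> S)) = (w :: int)"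
    and S0: "S0 \<subseteq> D" "u S0 \<noteq> 0"
  shows "w \<ge> 0"
proof -
  define v where "v = (\<lambda>S. \<Sum>s\<in>A. \<sigma> s * hop (l s) (k s) u S)"
  have Fu: "(\<lambda>S. \<Sum>s\<in>A. \<sigma> s * hop (k s) (l s) u S) = (\<lambda>S. 0)" using killed by simp
  have Fv: "(\<Sum>s\<in>A. \<sigma> s * hop (k s) (l s) v S) = of_int w * u S" for S
  proof -
    have "(\<Sum>s\<in>A. \<sigma> s * hop (k s) (l s) v S)
        = (\<Sum>s\<in>A. \<Sum>s'\<in>A. \<sigma> s * \<sigma> s' * hop (k s) (l s) (hop (l s') (k s') u) S)"
      unfolding v_def by (simp add: hop_linear sum_distrib_left mult.assoc)
    also have "\<dots> = (\<Sum>s\<in>A. \<Sum>s'\<in>A. \<sigma> s * \<sigma> s' * hop (l s') (k s') (hop (k s) (l s) u) S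
        + (if s' = s then hop (k s) (k s) u S - hop (l s) (l s) u S else 0))"
    proof (intro sum.cong refl)
      fix s s' assume s: "s \<in> A" "s' \<in> A"
      have sq: "\<sigma> s * \<sigma> s = 1" using \<sigma>[OF s(1)] by auto
      have "l s = l s' \<longleftrightarrow> s' = s" "k s' = k s \<longleftrightarrow> s' = s"
        using s inj by (auto simp: inj_on_def)
      then have "hop (k s) (l s) (hop (l s') (k s') u) S = hop (l s') (k s') (hop (k s) (l s) u) S
        + (if s' = s then hop (k s) (k s) u S - hop (l s) (l s) u S else 0)"
        by (subst hop_hop) auto
      then show "\<sigma> s * \<sigma> s' * hop (k s) (l s) (hop (l s') (k s') u) S
        = \<sigma> s * \<sigma> s' * hop (l s') (k s') (hop (k s) (l s) u) S
        + (if s' = s then hop (k s) (k s) u S - hop (l s) (l s) u S else 0)"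
        by (cases "s' = s") (simp_all add: sq)
    qed
    also have "\<dots> = (\<Sum>s\<in>A. \<Sum>s'\<in>A. \<sigma> s * \<sigma> s' * hop (l s') (k s') (hop (k s) (l s) u) S)
        + (\<Sum>s\<in>A. hop (k s) (k s) u S - hop (l s) (l s) u S)"
      using fin(1) by (simp add: sum.distrib)
    also have "(\<Sum>s\<in>A. \<Sum>s'\<in>A. \<sigma> s * \<sigma> s' * hop (l s') (k s') (hop (k s) (l s) u) S)
       = (\<Sum>s'\<in>A. \<sigma> s' * hop (l s') (k s') (\<lambda>S. \<Sum>s\<in>A. \<sigma> s * hop (k s) (l s) u S) S)"
      by (subst sum.swap) (simp add: hop_linear sum_distrib_left mult_ac)
    also have "\<dots> = 0" unfolding Fu by (simp add: hop_def cr_def an_def cong: if_cong)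
    also have "(\<Sum>s\<in>A. hop (k s) (k s) u S - hop (l s) (l s) u S)
        = of_int (\<Sum>s\<in>A. of_bool (k s \<in> S) - of_bool (l s \<in> S)) * u S"
      by (simp add: hop_same sum_distrib_right) (intro sum.cong refl, auto)
    also have "\<dots> = of_int w * u S" using weight[of S] by (cases "u S = 0") auto
    finally show ?thesis by simp
  qed
  have "ip D v v = (\<Sum>s\<in>A. \<sigma> s * ip D (hop (l s) (k s) u) v)"
  proof -
    have "cnj (v S) * v S = (\<Sum>s\<in>A. \<sigma> s * (cnj (hop (l s) (k s) u S) * v S))" for S
    proof -
      have "cnj (v S) = (\<Sum>s\<in>A. \<sigma> s * cnj (hop (l s) (k s) u S))"
        unfolding v_def cnj_sum by (intro sum.cong refl) (use \<sigma> in fastforce)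
      then show ?thesis by (simp add: sum_distrib_right mult.assoc)
    qed
    then have "ip D v v = (\<Sum>S\<in>Pow D. \<Sum>s\<in>A. \<sigma> s * (cnj (hop (l s) (k s) u S) * v S))"
      unfolding ip_def by simp
    then show ?thesis by (subst (asm) sum.swap) (simp add: ip_def sum_distrib_left)
  qed
  also have "\<dots> = (\<Sum>s\<in>A. \<sigma> s * ip D u (hop (k s) (l s) v))"
    using fin D by (intro sum.cong refl) (simp add: ip_hop)
  also have "\<dots> = ip D u (\<lambda>S. \<Sum>s\<in>A. \<sigma> s * hop (k s) (l s) v S)"
    unfolding ip_def by (simp add: sum_distrib_left) (subst sum.swap, simp add: mult_ac)
  also have "\<dots> = of_int w * ip D u u" unfolding Fv by (simp add: ip_def sum_distrib_left mult_ac)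
  finally have eq: "ip D v v = of_int w * ip D u u" .
  have ip: "ip D f f = of_real (\<Sum>S\<in>Pow D. (cmod (f S))\<^sup>2)" for f
    unfolding ip_def of_real_sum by (intro sum.cong refl) (simp only: complex_norm_square mult.commute)
  have "complex_of_real (\<Sum>S\<in>Pow D. (cmod (v S))\<^sup>2) = of_real (of_int w * (\<Sum>S\<in>Pow D. (cmod (u S))\<^sup>2))"
    using eq unfolding ip by simp
  then have "(\<Sum>S\<in>Pow D. (cmod (v S))\<^sup>2) = of_int w * (\<Sum>S\<in>Pow D. (cmod (u S))\<^sup>2)"
    by (simp only: of_real_eq_iff)
  moreover have "(\<Sum>S\<in>Pow D. (cmod (v S))\<^sup>2) \<ge> 0" by (intro sum_nonneg) auto
  moreover have "(\<Sum>S\<in>Pow D. (cmod (u S))\<^sup>2) > 0"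
    using S0 fin by (intro sum_pos2[of _ S0]) auto
  ultimately have "(of_int w :: real) \<ge> 0"
    by (metis zero_le_mult_iff not_less order_less_imp_le)
  then show ?thesis by simp
qed


section \<open>Root vectors of the symplectic Lie algebra\<close>

definition bar :: "nat \<Rightarrow> nat \<Rightarrow> nat" where
  "bar n i = (if i < n then i + n else i - n)"

lemma sp_iff:
  "X \<in> sp n \<longleftrightarrow> (\<forall>i j. (i \<ge> 2 * n \<or> j \<ge> 2 * n) \<longrightarrow> X i j = 0) \<and>
     (\<forall>i<2*n. \<forall>j<2*n. (if i < n then 1 else - 1) * X (bar n i) j = (if j < n then 1 else - 1) * X (bar n j) i)"
proof -
  have 1: "(\<Sum>k<2*n. X k i * symp_form n k j) = - (if j < n then 1 else - 1) * X (bar n j) i"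
    if "j < 2 * n" for i j
  proof -
    have "(\<Sum>k<2*n. X k i * symp_form n k j)
        = (\<Sum>k<2*n. if k = bar n j then - (if j < n then 1 else - 1) * X (bar n j) i else 0)"
      using that by (intro sum.cong refl) (auto simp: symp_form_def bar_def)
    also have "\<dots> = - (if j < n then 1 else - 1) * X (bar n j) i"
      using that by (subst sum.delta) (auto simp: bar_def)
    finally show ?thesis .
  qed
  have 2: "(\<Sum>k<2*n. symp_form n i k * X k j) = (if i < n then 1 else - 1) * X (bar n i) j"
    if "i < 2 * n" for i j
  proof -
    have "(\<Sum>k<2*n. symp_form n i k * X k j)
        = (\<Sum>k<2*n. if k = bar n i then (if i < n then 1 else - 1) * X (bar n i) j else 0)"
      using that by (intro sum.cong refl) (auto simp: symp_form_def bar_def)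
    also have "\<dots> = (if i < n then 1 else - 1) * X (bar n i) j"
      using that by (subst sum.delta) (auto simp: bar_def)
    finally show ?thesis .
  qed
  have "(\<Sum>k<2*n. X k i * symp_form n k j) + (\<Sum>k<2*n. symp_form n i k * X k j) = 0 \<longleftrightarrow>
      (if i < n then 1 else - 1) * X (bar n i) j = (if j < n then 1 else - 1) * X (bar n j) i"
    if "i < 2 * n" "j < 2 * n" for i j
    unfolding 1[OF that(2)] 2[OF that(1)] minus_mult_left[symmetric] by (simp only: neg_eq_iff_add_eq_0[symmetric] minus_minus) auto
  then show ?thesis unfolding sp_def by auto
qed

definition munit :: "nat \<Rightarrow> nat \<Rightarrow> nat \<Rightarrow> nat \<Rightarrow> complex" where
  "munit a b i j = (if i = a \<and> j = b then 1 else 0)"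

text \<open>For the simple roots \<epsilon>_(i+1) - \<epsilon>_i and 2 \<epsilon>_0, whose dominant
  open chamber is \<open>chamber\<close>, the first two kinds are the lowering operators; the third
  kind spans the Cartan subalgebra.\<close>

lemma munit_sp:
  "Suc i < n \<Longrightarrow> (\<lambda>a b. munit i (Suc i) a b - munit (n + Suc i) (n + i) a b) \<in> sp n"
  "0 < n \<Longrightarrow> munit n 0 \<in> sp n"
  "r < n \<Longrightarrow> (\<lambda>a b. munit r r a b - munit (n + r) (n + r) a b) \<in> sp n"
  unfolding sp_iff by (auto simp: munit_def bar_def)

lemma rho_munit:
  assumes "a < 2 * n" "b < 2 * n"
  shows "rho n m (munit a b) \<phi> S = (\<Sum>p<m. hop (p * (2 * n) + a) (p * (2 * n) + b) \<phi> S)"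
proof -
  have "(\<Sum>i<2*n. \<Sum>j<2*n. munit a b i j * f i j) = f a b" for f :: "nat \<Rightarrow> nat \<Rightarrow> complex"
  proof -
    have "(\<Sum>i<2*n. \<Sum>j<2*n. munit a b i j * f i j)
        = (\<Sum>i<2*n. \<Sum>j<2*n. if j = b then (if i = a then f i j else 0) else 0)"
      by (intro sum.cong refl) (simp add: munit_def)
    also have "\<dots> = f a b" using assms by (simp add: sum.delta)
    finally show ?thesis .
  qed
  then show ?thesis unfolding rho_def by simp
qed

lemma rho_diff: "rho n m (\<lambda>a b. X a b - Y a b) \<phi> S = rho n m X \<phi> S - rho n m Y \<phi> S"
  by (simp add: rho_def left_diff_distrib sum_subtractf)

lemma sum_even_odd: "(\<Sum>s<2*m. f s) = (\<Sum>p<m. f (2 * p) + f (2 * p + 1))"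
  for f :: "nat \<Rightarrow> 'a :: comm_monoid_add"
  by (induction m) (simp_all add: add.assoc)

text \<open>Sorted by half-steps, the operator moves a \<open>p\<close> from \<open>Suc i\<close> to
  \<open>i\<close> on even half-steps and a \<open>q\<close> from \<open>i\<close> to
  \<open>Suc i\<close>, with a minus sign, on odd ones.\<close>

lemma rho_root:
  assumes "Suc i < n"
  shows "rho n m (\<lambda>a b. munit i (Suc i) a b - munit (n + Suc i) (n + i) a b) \<phi> S
    = (\<Sum>s<2*m. (if even s then 1 else - 1) *
        hop (s * n + (if even s then i else Suc i)) (s * n + (if even s then Suc i else i)) \<phi> S)"
proof -
  have "rho n m (\<lambda>a b. munit i (Suc i) a b - munit (n + Suc i) (n + i) a b) \<phi> S
    = (\<Sum>p<m. hop (p * (2 * n) + i) (p * (2 * n) + Suc i) \<phi> S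
         - hop (p * (2 * n) + (n + Suc i)) (p * (2 * n) + (n + i)) \<phi> S)"
    using assms by (simp add: rho_diff rho_munit sum_subtractf)
  also have "\<dots> = (\<Sum>p<m. hop (2 * p * n + i) (2 * p * n + Suc i) \<phi> S
         - hop ((2 * p + 1) * n + Suc i) ((2 * p + 1) * n + i) \<phi> S)"
    by (simp add: algebra_simps)
  finally show ?thesis unfolding sum_even_odd by simp
qed

lemma rho_weight:
  assumes "r < n"
  shows "rho n m (\<lambda>a b. munit r r a b - munit (n + r) (n + r) a b) \<phi> S
    = of_int (\<Sum>s<2*m. (if even s then 1 else - 1) * of_bool (s * n + r \<in> S)) * \<phi> S"
proof -
  have "rho n m (\<lambda>a b. munit r r a b - munit (n + r) (n + r) a b) \<phi> S
    = (\<Sum>p<m. hop (p * (2 * n) + r) (p * (2 * n) + r) \<phi> S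
         - hop (p * (2 * n) + (n + r)) (p * (2 * n) + (n + r)) \<phi> S)"
    using assms by (simp add: rho_diff rho_munit sum_subtractf)
  also have "\<dots> = (\<Sum>p<m. of_int (of_bool (2 * p * n + r \<in> S) - of_bool ((2 * p + 1) * n + r \<in> S)) * \<phi> S)"
    by (intro sum.cong refl) (simp add: hop_same algebra_simps)
  finally show ?thesis unfolding sum_even_odd by (simp add: sum_distrib_right)
qed

lemma rho_long_root:
  assumes "0 < n"
  shows "rho n m (munit n 0) \<phi> S = (\<Sum>p<m. hop ((2 * p + 1) * n) (2 * p * n) \<phi> S)"
  using assms by (simp add: rho_munit algebra_simps)

section \<open>Heights and leading terms\<close>

text \<open>The height orders index sets lexicographically, earlier half-steps first, such that every
  lowering operator increases the height.\<close>
definition height_exp :: "nat \<Rightarrow> nat \<Rightarrow> nat \<Rightarrow> nat" where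
  "height_exp n m k = (2 * m - 1 - k div n) * n + k mod n"

definition index_height :: "nat \<Rightarrow> nat \<Rightarrow> nat \<Rightarrow> int" where
  "index_height n m k = (if even (k div n) then - 1 else 1) * 2 ^ height_exp n m k"

definition height :: "nat \<Rightarrow> nat \<Rightarrow> nat set \<Rightarrow> int" where
  "height n m S = (\<Sum>k\<in>S. index_height n m k)"

lemma sum_2_less: "(\<Sum>e<N. 2 ^ e) < (2 ^ N :: int)"
  by (induction N) auto

lemma sum_height_exp_less:
  assumes "t \<le> 2 * m"
  shows "(\<Sum>k\<in>{t * n..<2 * m * n}. 2 ^ height_exp n m k :: int) < 2 ^ ((2 * m - t) * n)"
proof -
  let ?K = "{t * n..<2 * m * n}"
  have div: "t \<le> k div n" "k div n < 2 * m" "0 < n" if "k \<in> ?K" for k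
  proof -
    show "0 < n" using that by (cases "n = 0") auto
    then show "t \<le> k div n" "k div n < 2 * m"
      using that by (auto simp: less_eq_div_iff_mult_less_eq less_mult_imp_div_less)
  qed
  have inj: "inj_on (height_exp n m) ?K"
  proof (rule inj_onI)
    fix k l assume kl: "k \<in> ?K" "l \<in> ?K" "height_exp n m k = height_exp n m l"
    then have "2 * m - 1 - k div n = 2 * m - 1 - l div n \<and> k mod n = l mod n"
      using div[OF kl(1)] unfolding height_exp_def
      by (subst (asm) index_eq_iff) auto
    then have "k div n = l div n" "k mod n = l mod n" using div[OF kl(1)] div[OF kl(2)] by linarith+
    then show "k = l" by (metis div_mult_mod_eq)
  qed
  have "(\<Sum>k\<in>?K. 2 ^ height_exp n m k :: int) = (\<Sum>e\<in>height_exp n m ` ?K. 2 ^ e)"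
    by (simp add: sum.reindex[OF inj])
  also have "\<dots> \<le> (\<Sum>e<(2 * m - t) * n. 2 ^ e)"
  proof (rule sum_mono2)
    show "height_exp n m ` ?K \<subseteq> {..<(2 * m - t) * n}"
    proof
      fix e assume "e \<in> height_exp n m ` ?K"
      then obtain k where k: "k \<in> ?K" "e = (2 * m - 1 - k div n) * n + k mod n"
        by (auto simp: height_exp_def)
      moreover have "2 * m - 1 - k div n < 2 * m - t" using div[OF k(1)] by linarith
      ultimately show "e \<in> {..<(2 * m - t) * n}"
        using index_less[of "k mod n" n "2 * m - 1 - k div n" "2 * m - t"] div[OF k(1)] by simp
    qed
  qed auto
  also have "\<dots> < 2 ^ ((2 * m - t) * n)"
    by (rule sum_2_less)
  finally show ?thesis .
qed

text \<open>The exponents from half-step \<open>t\<close> on are distinct and below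
  \<open>(2 * m - t) * n\<close>. So the choice of a suffix cannot compensate the height gained by
  one lowering hop before \<open>t\<close>.\<close>

lemma height_suffix_less:
  assumes "t \<le> 2 * m" "R \<subseteq> {t * n..<2 * m * n}" "R' \<subseteq> {t * n..<2 * m * n}"
  shows "height n m R - height n m R' < 2 ^ ((2 * m - t) * n)"
proof -
  let ?K = "{t * n..<2 * m * n}"
  have *: "height n m Q = (\<Sum>k\<in>?K. of_bool (k \<in> Q) * index_height n m k)" if "Q \<subseteq> ?K" for Q
    unfolding height_def using that by (intro sum.mono_neutral_cong_left) auto
  have "height n m R - height n m R' = (\<Sum>k\<in>?K. (of_bool (k \<in> R) - of_bool (k \<in> R')) * index_height n m k)"
    by (simp add: *[OF assms(2)] *[OF assms(3)] sum_subtractf left_diff_distrib)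
  also have "\<dots> \<le> (\<Sum>k\<in>?K. 2 ^ height_exp n m k)"
    by (intro sum_mono) (auto simp: index_height_def)
  finally show ?thesis using sum_height_exp_less[OF assms(1), of n] by linarith
qed

lemma hop_nonzero:
  assumes "hop k l \<phi> S \<noteq> 0" "k \<noteq> l"
  shows "k \<in> S" "l \<notin> S" "\<phi> (insert l (S - {k})) \<noteq> 0"
  using assms by (auto simp: hop_diff split: if_splits)

text \<open>Let \<open>F\<close> be the signed sum of the hops. At a set with the prefix of
  \<open>S0\<close>, a hop before half-step \<open>t\<close> would come from a set lower than
  \<open>S0\<close>. So \<open>F \<phi> = 0\<close> implies that the hops from \<open>t\<close> on
  kill the part of \<open>\<phi>\<close> with this prefix; that part has constant weight
  \<open>w\<close>, and \<open>lowest_weight_nonneg\<close> applies.\<close>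

lemma prefix_weight_nonneg:
  fixes k l :: "nat \<Rightarrow> nat" and \<sigma> :: "nat \<Rightarrow> complex"
  assumes supp: "\<And>S. \<phi> S \<noteq> 0 \<Longrightarrow> S \<subseteq> {..<2 * m * n}"
    and S0: "\<phi> S0 \<noteq> 0" and min: "\<And>S. \<phi> S \<noteq> 0 \<Longrightarrow> height n m S0 \<le> height n m S"
    and t: "t \<le> 2 * m"
    and A: "finite A" "\<And>s. s \<in> A \<Longrightarrow> k s < 2 * m * n" "\<And>s. s \<in> A \<Longrightarrow> l s < 2 * m * n"
    and inj: "inj_on k A" "inj_on l A"
    and kl: "\<And>s s'. s \<in> A \<Longrightarrow> s' \<in> A \<Longrightarrow> k s \<noteq> l s'"
    and \<sigma>: "\<And>s. s \<in> A \<Longrightarrow> \<sigma> s = 1 \<or> \<sigma> s = - 1"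
    and split: "\<And>s. s \<in> A \<Longrightarrow> k s < t * n \<longleftrightarrow> l s < t * n"
    and gap: "\<And>s. s \<in> A \<Longrightarrow> k s < t * n \<Longrightarrow>
       index_height n m (l s) + 2 ^ ((2 * m - t) * n) \<le> index_height n m (k s)"
    and killed: "\<And>S. (\<Sum>s\<in>A. \<sigma> s * hop (k s) (l s) \<phi> S) = 0"
    and weight: "\<And>S. \<phi> S \<noteq> 0 \<Longrightarrow> S \<inter> {..<t * n} = S0 \<inter> {..<t * n} \<Longrightarrow>
       (\<Sum>s | s \<in> A \<and> t * n \<le> k s. of_bool (k s \<in> S) - of_bool (l s \<in> S)) = (w :: int)"
  shows "w \<ge> 0"
proof -
  let ?I = "{..<t * n}" and ?D = "{..<2 * m * n}"
  define B where "B = {s. s \<in> A \<and> t * n \<le> k s}"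
  define u where "u = (\<lambda>S. if S \<inter> ?I = S0 \<inter> ?I then \<phi> S else 0)"
  have B: "s \<in> A" "t * n \<le> k s" "t * n \<le> l s" if "s \<in> B" for s
    using that split[of s] by (auto simp: B_def not_less[symmetric])
  \<comment> \<open>The source of such a hop would be lower by at least
    \<open>2 ^ ((2 * m - t) * n)\<close>, which exceeds any difference of suffixes, against the
    minimality of \<open>S0\<close>.\<close>
  have low: "hop (k s) (l s) \<phi> S = 0" if s: "s \<in> A" "k s < t * n" and S: "S \<inter> ?I = S0 \<inter> ?I" for s S
  proof (rule ccontr)
    assume "hop (k s) (l s) \<phi> S \<noteq> 0"
    from hop_nonzero[OF this kl[OF s(1) s(1)]]
    have kS: "k s \<in> S" "l s \<notin> S" and ne: "\<phi> (insert (l s) (S - {k s})) \<noteq> 0" by auto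
    have "insert (l s) (S - {k s}) \<subseteq> ?D" using supp[OF ne] .
    then have SD: "S \<subseteq> ?D" using A(2)[OF s(1)] by auto
    have S0D: "S0 \<subseteq> ?D" using supp[OF S0] .
    have fin: "finite S" "finite S0" using SD S0D finite_subset by blast+
    have part: "height n m Q = height n m (Q \<inter> ?I) + height n m (Q \<inter> {t * n..<2 * m * n})"
      if "Q \<subseteq> ?D" for Q
    proof -
      have eq: "Q = (Q \<inter> ?I) \<union> (Q \<inter> {t * n..<2 * m * n})" using that by auto
      have "finite Q" using that finite_subset by blast
      then show ?thesis unfolding height_def
        by (subst eq, intro sum.union_disjoint) auto
    qed
    have "height n m (insert (l s) (S - {k s})) = height n m S + index_height n m (l s) - index_height n m (k s)"
      using kS fin by (simp add: height_def sum_diff1)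
    moreover have "height n m S0 \<le> height n m (insert (l s) (S - {k s}))" by (rule min[OF ne])
    moreover have "height n m (S \<inter> {t * n..<2 * m * n}) - height n m (S0 \<inter> {t * n..<2 * m * n}) < 2 ^ ((2 * m - t) * n)"
      by (rule height_suffix_less[OF t]) auto
    ultimately show False using gap[OF s] part[OF SD] part[OF S0D] S by simp
  qed
  show ?thesis
  proof (rule lowest_weight_nonneg[of B ?D k l \<sigma> u w S0])
    show "finite B" using A(1) by (simp add: B_def)
    show "inj_on k B" "inj_on l B" using inj by (auto simp: B_def inj_on_def)
    show "S0 \<subseteq> ?D" "u S0 \<noteq> 0" using supp[OF S0] S0 by (auto simp: u_def)
    show "(\<Sum>s\<in>B. of_bool (k s \<in> S) - of_bool (l s \<in> S)) = w" if "u S \<noteq> 0" for S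
      using that weight[of S] by (auto simp: u_def B_def split: if_splits)
    fix S
    have hop_u: "hop (k s) (l s) u S = (if S \<inter> ?I = S0 \<inter> ?I then hop (k s) (l s) \<phi> S else 0)" if "s \<in> B" for s
    proof -
      have "insert (l s) (S - {k s}) \<inter> ?I = S \<inter> ?I" using B[OF that] by auto
      then show ?thesis using kl[of s s] B[OF that] by (simp add: hop_diff u_def)
    qed
    show "(\<Sum>s\<in>B. \<sigma> s * hop (k s) (l s) u S) = 0"
    proof (cases "S \<inter> ?I = S0 \<inter> ?I")
      case True
      have "(\<Sum>s\<in>B. \<sigma> s * hop (k s) (l s) u S) = (\<Sum>s\<in>B. \<sigma> s * hop (k s) (l s) \<phi> S)"
        using True by (simp add: hop_u)
      also have "\<dots> = (\<Sum>s\<in>A. \<sigma> s * hop (k s) (l s) \<phi> S)"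
      proof (rule sum.mono_neutral_left)
        show "\<forall>s\<in>A - B. \<sigma> s * hop (k s) (l s) \<phi> S = 0"
          using low[OF _ _ True] by (simp add: B_def not_le)
      qed (use A(1) in \<open>auto simp: B_def\<close>)
      finally show ?thesis using killed by simp
    qed (simp add: hop_u)
  qed (use B A \<sigma> kl in auto)
qed

definition steps_of :: "nat \<Rightarrow> nat \<Rightarrow> nat set \<Rightarrow> nat set list" where
  "steps_of n m S = map (\<lambda>s. {r. r < n \<and> (s * n + r \<in> S \<longleftrightarrow> even s)}) [0..<2 * m]"

text \<open>The coordinate \<open>r\<close> of the weight carried by the first \<open>t\<close>
  half-steps: each \<open>p\<^sub>r\<close> counts \<open>1\<close>, each \<open>q\<^sub>r\<close>
  counts \<open>- 1\<close>.\<close>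

definition prefix_weight :: "nat \<Rightarrow> nat \<Rightarrow> nat \<Rightarrow> nat set \<Rightarrow> int" where
  "prefix_weight n r t S = (\<Sum>s<t. (if even s then 1 else - 1) * of_bool (s * n + r \<in> S))"

lemma prefix_weight_cong:
  assumes "S \<inter> {..<t * n} = S' \<inter> {..<t * n}" "r < n"
  shows "prefix_weight n r t S = prefix_weight n r t S'"
  unfolding prefix_weight_def
proof (intro sum.cong refl)
  fix s assume "s \<in> {..<t}"
  then have "s * n + r \<in> {..<t * n}" using index_less[OF assms(2), of s t] by simp
  then have "s * n + r \<in> S \<longleftrightarrow> s * n + r \<in> S'" using assms(1) by blast
  then show "(if even s then 1 else - 1) * of_bool (s * n + r \<in> S)
    = ((if even s then 1 else - 1) * of_bool (s * n + r \<in> S') :: int)" by simp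
qed

lemma prefix_weight_suffix:
  assumes "t \<le> u"
  shows "(\<Sum>s\<in>{t..<u}. (if even s then 1 else - 1) * of_bool (s * n + r \<in> S))
    = prefix_weight n r u S - prefix_weight n r t S"
  unfolding prefix_weight_def lessThan_atLeast0 by (rule sum_diff_nat_ivl[symmetric]) (use assms in auto)

text \<open>If \<open>b\<close> tells whether the generator is present, an even half-step moves the
  walker by \<open>2 * b - 1\<close> and an odd one by \<open>1 - 2 * b\<close>. The constants
  cancel within each tensor factor, and after an odd number of half-steps one \<open>- 1\<close> is
  left.\<close>

lemma walker_pos_steps_of:
  assumes "t \<le> 2 * m" "r < n"
  shows "walker_pos (steps_of n m S) t r = 2 * int r + 2 + 2 * prefix_weight n r t S - of_bool (odd t)"
  using assms(1)
proof (induction t)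
  case (Suc t)
  then have "walker_pos (steps_of n m S) (Suc t) r = walker_pos (steps_of n m S) t r
     + (if s_in then 1 else - 1)" if "s_in \<longleftrightarrow> (t * n + r \<in> S \<longleftrightarrow> even t)" for s_in
    using that assms(2) by (simp add: walker_pos_def steps_of_def)
  then show ?case using Suc by (auto simp: prefix_weight_def)
qed (simp add: walker_pos_def prefix_weight_def)

lemma chamberI:
  assumes "0 < n \<Longrightarrow> 0 < x 0" "\<And>i. Suc i < n \<Longrightarrow> x i < x (Suc i)"
  shows "chamber n x"
proof -
  have "0 < x i" if "i < n" for i
    using that
  proof (induction i)
    case (Suc i)
    then show ?case using assms(2)[of i] by simp
  qed (use assms(1) in auto)
  then show ?thesis using assms(2) by (simp add: chamber_def)
qed

lemma index_le_iff: "r < n \<Longrightarrow> t * n \<le> s * n + r \<longleftrightarrow> t \<le> s" for r n s t :: nat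
  using index_less[of r n s t] mult_le_mono1[of t s n] by (cases "t \<le> s") (auto intro: trans_le_add1)

lemma index_height_eq:
  "r < n \<Longrightarrow> index_height n m (s * n + r) = (if even s then - 1 else 1) * 2 ^ ((2 * m - 1 - s) * n + r)"
  by (simp add: index_height_def height_exp_def)

text \<open>The witness is the set of least height in the support. Its total weight is 0, so a sign
  condition on the weight of suffixes is one on prefixes: the short root operators keep neighbouring
  walkers apart, and the long root operator keeps walker 0 positive.\<close>

lemma invariant_leading_term:
  assumes "n \<ge> 1" and supp: "\<And>S. \<phi> S \<noteq> 0 \<Longrightarrow> S \<subseteq> {..<2 * m * n}"
    and inv: "\<And>X S. X \<in> sp n \<Longrightarrow> rho n m X \<phi> S = 0" and "\<phi> S1 \<noteq> 0"
  shows "\<exists>S. \<phi> S \<noteq> 0 \<and> steps_of n m S \<in> walker_families n m"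
proof -
  have "finite {S. \<phi> S \<noteq> 0}"
    by (rule finite_subset[of _ "Pow {..<2 * m * n}"]) (use supp in auto)
  moreover have "{S. \<phi> S \<noteq> 0} \<noteq> {}" using assms(4) by auto
  ultimately obtain S0 where S0: "\<phi> S0 \<noteq> 0" and min: "\<And>S. \<phi> S \<noteq> 0 \<Longrightarrow> height n m S0 \<le> height n m S"
    using arg_min_if_finite[of "{S. \<phi> S \<noteq> 0}" "height n m"] by (metis (mono_tags, lifting) mem_Collect_eq not_le)
  let ?sg = "\<lambda>s. if even s then 1 else - 1"
  \<comment> \<open>Invariance under the Cartan subalgebra.\<close>
  have total: "prefix_weight n r (2 * m) S = 0" if "\<phi> S \<noteq> 0" "r < n" for r S
    using inv[OF munit_sp(3)[OF that(2)], of S] that(1)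
    unfolding rho_weight[OF that(2)] prefix_weight_def[symmetric] by simp
  have root: "prefix_weight n i t S0 \<le> prefix_weight n (Suc i) t S0" if i: "Suc i < n" and t: "t \<le> 2 * m" for i t
  proof -
    define k where "k = (\<lambda>s. s * n + (if even s then i else Suc i))"
    define l where "l = (\<lambda>s. s * n + (if even s then Suc i else i))"
    have "0 \<le> prefix_weight n (Suc i) t S0 - prefix_weight n i t S0"
    proof (rule prefix_weight_nonneg[where \<phi> = \<phi> and m = m and n = n and A = "{..<2 * m}" and k = k and l = l and \<sigma> = ?sg, OF supp S0 min t])
      show "inj_on k {..<2 * m}" "inj_on l {..<2 * m}"
        using i by (auto simp: k_def l_def inj_on_def index_eq_iff split: if_splits)
      show "k s \<noteq> l s'" for s s' using i by (auto simp: k_def l_def index_eq_iff)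
      show "(\<Sum>s<2 * m. ?sg s * hop (k s) (l s) \<phi> S) = 0" for S
        using inv[OF munit_sp(1)[OF i], of S] unfolding rho_root[OF i] k_def l_def .
      show "k s < t * n \<longleftrightarrow> l s < t * n" for s
        using i index_le_iff[of i n t s] index_le_iff[of "Suc i" n t s]
        by (auto simp: k_def l_def not_le[symmetric] simp del: add_Suc_right)
      show "k s < 2 * m * n" "l s < 2 * m * n" if "s \<in> {..<2 * m}" for s
        using that i index_less[of _ n s "2 * m"] by (auto simp: k_def l_def simp del: add_Suc_right)
      show "index_height n m (l s) + 2 ^ ((2 * m - t) * n) \<le> index_height n m (k s)"
        if "s \<in> {..<2 * m}" "k s < t * n" for s
      proof -
        have "\<not> t \<le> s" using that(2) i index_le_iff[of i n t s] index_le_iff[of "Suc i" n t s]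
          by (auto simp: k_def not_le[symmetric] simp del: add_Suc_right split: if_splits)
        then have "2 * m - t \<le> 2 * m - 1 - s" by linarith
        then have "(2 * m - t) * n \<le> (2 * m - 1 - s) * n + i"
          by (meson mult_le_mono1 trans_le_add1)
        then have "(2::int) ^ ((2 * m - t) * n) \<le> 2 ^ ((2 * m - 1 - s) * n + i)"
          by (intro power_increasing) auto
        \<comment> \<open>For either parity of \<open>s\<close>, exchanging \<open>l s\<close> for
          \<open>k s\<close> raises the height by exactly
          \<open>2 ^ ((2 * m - 1 - s) * n + i)\<close>.\<close>
        then show ?thesis using i
          by (auto simp: k_def l_def index_height_eq simp del: add_Suc_right) (simp_all add: add_Suc_right)
      qed
      show "(\<Sum>s | s \<in> {..<2 * m} \<and> t * n \<le> k s. of_bool (k s \<in> S) - of_bool (l s \<in> S))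
          = prefix_weight n (Suc i) t S0 - prefix_weight n i t S0"
        if S: "\<phi> S \<noteq> 0" "S \<inter> {..<t * n} = S0 \<inter> {..<t * n}" for S
      proof -
        have iff: "t * n \<le> k s \<longleftrightarrow> t \<le> s" for s
          using i index_le_iff[of "if even s then i else Suc i" n t s] by (simp add: k_def)
        have "{s. s \<in> {..<2 * m} \<and> t * n \<le> k s} = {t..<2 * m}" unfolding iff by auto
        then have "(\<Sum>s | s \<in> {..<2 * m} \<and> t * n \<le> k s. of_bool (k s \<in> S) - of_bool (l s \<in> S))
          = (\<Sum>s\<in>{t..<2 * m}. of_bool (k s \<in> S) - of_bool (l s \<in> S) :: int)"
          by (rule arg_cong)
        also have "\<dots>
          = (\<Sum>s\<in>{t..<2 * m}. ?sg s * of_bool (s * n + i \<in> S)) - (\<Sum>s\<in>{t..<2 * m}. ?sg s * of_bool (s * n + Suc i \<in> S))"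
          unfolding sum_subtractf[symmetric] by (intro sum.cong refl) (simp add: k_def l_def)
        also have "\<dots> = prefix_weight n (Suc i) t S - prefix_weight n i t S"
          using i S by (simp add: prefix_weight_suffix[OF t] total del: add_Suc_right)
        also have "\<dots> = prefix_weight n (Suc i) t S0 - prefix_weight n i t S0"
          using prefix_weight_cong[OF S(2), of i] prefix_weight_cong[OF S(2), of "Suc i"] i by simp
        finally show ?thesis .
      qed
    qed auto
    then show ?thesis by simp
  qed
  \<comment> \<open>The long root operator turns \<open>p\<^sub>0\<close> into
    \<open>q\<^sub>0\<close> within one tensor factor; its hops respect a cut only if the cut falls
    between factors, hence at even times.\<close>
  have long: "prefix_weight n 0 (2 * p) S0 \<ge> 0" if p: "p \<le> m" for p
  proof (rule prefix_weight_nonneg[where \<phi> = \<phi> and m = m and n = n and A = "{..<m}" and k = "\<lambda>q. (2 * q + 1) * n" and l = "\<lambda>q. 2 * q * n"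
        and \<sigma> = "\<lambda>_. 1" and t = "2 * p", OF supp S0 min])
    have n: "0 < n" using assms(1) by simp
    show "(2 * q + 1) * n \<noteq> 2 * q' * n" for q q' using n by (simp only: mult_cancel2) presburger
    show "inj_on (\<lambda>q. (2 * q + 1) * n) {..<m}" "inj_on (\<lambda>q. 2 * q * n) {..<m}"
      using n by (auto simp: inj_on_def)
    show "(\<Sum>q<m. 1 * hop ((2 * q + 1) * n) (2 * q * n) \<phi> S) = 0" for S
      using inv[OF munit_sp(2)[OF n], of S] unfolding rho_long_root[OF n] by simp
    have lt: "s * n < u * n \<longleftrightarrow> s < u" for s u using n by simp
    show "(2 * q + 1) * n < 2 * p * n \<longleftrightarrow> 2 * q * n < 2 * p * n" for q
      unfolding lt by presburger
    show "(2 * q + 1) * n < 2 * m * n" "2 * q * n < 2 * m * n" if "q \<in> {..<m}" for q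
      using that unfolding lt by auto
    show "index_height n m (2 * q * n) + 2 ^ ((2 * m - 2 * p) * n) \<le> index_height n m ((2 * q + 1) * n)"
      if "(2 * q + 1) * n < 2 * p * n" for q
    proof -
      have "2 * q + 1 < 2 * p" using that unfolding lt .
      then have "(2 * m - 2 * p) * n \<le> (2 * m - 1 - (2 * q + 1)) * n" by (intro mult_le_mono1) linarith
      then have "(2::int) ^ ((2 * m - 2 * p) * n) \<le> 2 ^ ((2 * m - 1 - (2 * q + 1)) * n)"
        by (intro power_increasing) auto
      moreover have "index_height n m (2 * q * n) \<le> 0"
        using index_height_eq[OF n, of m "2 * q"] by simp
      moreover have "index_height n m ((2 * q + 1) * n) = 2 ^ ((2 * m - 1 - (2 * q + 1)) * n)"
        using index_height_eq[OF n, of m "2 * q + 1"] by simp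
      ultimately show ?thesis by linarith
    qed
    show "(\<Sum>q | q \<in> {..<m} \<and> 2 * p * n \<le> (2 * q + 1) * n.
        of_bool ((2 * q + 1) * n \<in> S) - of_bool (2 * q * n \<in> S)) = prefix_weight n 0 (2 * p) S0"
      if S: "\<phi> S \<noteq> 0" "S \<inter> {..<2 * p * n} = S0 \<inter> {..<2 * p * n}" for S
    proof -
      let ?f = "\<lambda>q. of_bool ((2 * q + 1) * n \<in> S) - of_bool (2 * q * n \<in> S) :: int"
      have eq: "{q. q \<in> {..<m} \<and> 2 * p * n \<le> (2 * q + 1) * n} = {..<m} - {..<p}"
        unfolding not_less[symmetric] lt by auto
      have pw: "prefix_weight n 0 (2 * q) S = - (\<Sum>q'<q. ?f q')" for q
        unfolding prefix_weight_def sum_even_odd by (simp add: sum_negf[symmetric])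
      have "(\<Sum>q\<in>{..<m} - {..<p}. ?f q) = (\<Sum>q<m. ?f q) - (\<Sum>q<p. ?f q)"
        using p by (intro sum_diff) auto
      also have "\<dots> = prefix_weight n 0 (2 * p) S" using pw[of m] pw[of p] total[OF S(1) n] by simp
      finally show ?thesis unfolding eq using prefix_weight_cong[OF S(2) n] by simp
    qed
  qed (use p in auto)
  have nonneg: "0 < walker_pos (steps_of n m S0) t 0" if t: "t \<le> 2 * m" for t
  proof -
    have n: "0 < n" using assms(1) by simp
    show ?thesis
    proof (cases "even t")
      case True
      then obtain p where p: "t = 2 * p" by blast
      then show ?thesis using long[of p] t walker_pos_steps_of[OF t n, of S0] by simp
    next
      case False
      then obtain p where p: "t = Suc (2 * p)" by (metis oddE Suc_eq_plus1)
      \<comment> \<open>The last half-step before an odd time concerns \<open>p\<^sub>0\<close> and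
        cannot decrease the weight, so the position is still at least \<open>2 - 1\<close>.\<close>
      then have "prefix_weight n 0 t S0 \<ge> prefix_weight n 0 (2 * p) S0" by (simp add: prefix_weight_def)
      then show ?thesis using long[of p] p t walker_pos_steps_of[OF t n, of S0] by simp
    qed
  qed
  have "steps_of n m S0 \<in> walker_families n m"
    unfolding walker_families_def mem_Collect_eq
  proof (intro conjI allI impI ballI)
    show "length (steps_of n m S0) = 2 * m" by (simp add: steps_of_def)
    show "E \<subseteq> {..<n}" if "E \<in> set (steps_of n m S0)" for E using that by (auto simp: steps_of_def)
    show "chamber n (walker_pos (steps_of n m S0) t)" if t: "t \<le> 2 * m" for t
    proof (rule chamberI)
      show "0 < walker_pos (steps_of n m S0) t 0" by (rule nonneg[OF t])
      show "walker_pos (steps_of n m S0) t i < walker_pos (steps_of n m S0) t (Suc i)" if i: "Suc i < n" for i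
        using root[OF i t] i by (simp add: walker_pos_steps_of[OF t])
    qed
    show "walker_pos (steps_of n m S0) (2 * m) i = 2 * int i + 2" if "i < n" for i
      using walker_pos_steps_of[of "2 * m" m i n S0] that total[OF S0 that] by simp
  qed
  then show ?thesis using S0 by blast
qed

lemma inj_steps_of: "inj_on (steps_of n m) (Pow {..<2 * m * n})"
proof (rule inj_onI)
  fix S S' assume S: "S \<in> Pow {..<2 * m * n}" "S' \<in> Pow {..<2 * m * n}" and eq: "steps_of n m S = steps_of n m S'"
  have "k \<in> S \<longleftrightarrow> k \<in> S'" if "k < 2 * m * n" for k
  proof -
    have n: "0 < n" using that by (cases "n = 0") auto
    have s: "k div n < 2 * m" using that by (simp add: less_mult_imp_div_less)
    have "steps_of n m S ! (k div n) = steps_of n m S' ! (k div n)" by (simp add: eq)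
    then have "{r. r < n \<and> (k div n * n + r \<in> S \<longleftrightarrow> even (k div n))}
      = {r. r < n \<and> (k div n * n + r \<in> S' \<longleftrightarrow> even (k div n))}"
      using s by (simp add: steps_of_def)
    moreover have "k mod n < n" using n by simp
    ultimately have "k div n * n + k mod n \<in> S \<longleftrightarrow> k div n * n + k mod n \<in> S'" by blast
    then show ?thesis by (simp only: div_mult_mod_eq)
  qed
  then show "S = S'" using S by blast
qed


lemma hop_outside:
  assumes "\<And>S. \<phi> S \<noteq> 0 \<Longrightarrow> S \<subseteq> D" "k \<in> D" "\<not> S \<subseteq> D"
  shows "hop k l \<phi> S = 0"
proof (cases "k = l")
  case True
  then show ?thesis using assms by (auto simp: hop_same)
next
  case False
  then show ?thesis using assms(1)[of "insert l (S - {k})"] assms(2,3) by (auto simp: hop_diff)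
qed

lemma rho_outside:
  assumes "\<And>S. \<phi> S \<noteq> 0 \<Longrightarrow> S \<subseteq> {..<2 * m * n}" "\<not> S \<subseteq> {..<2 * m * n}"
  shows "rho n m X \<phi> S = 0"
  unfolding rho_def
proof (intro sum.neutral ballI)
  fix p i j assume "p \<in> {..<m}" "i \<in> {..<2 * n}" "j \<in> {..<2 * n}"
  then have "p * (2 * n) + i \<in> {..<2 * m * n}" using index_less[of i "2 * n" p m] by (simp add: mult_ac)
  then have "hop (p * (2 * n) + i) (p * (2 * n) + j) \<phi> S = 0" by (intro hop_outside[OF assms(1) _ assms(2)])
  then show "X i j * hop (p * (2 * n) + i) (p * (2 * n) + j) \<phi> S = 0" by simp
qed

lemma fun_sum_apply: "(\<Sum>a\<in>A. g a) x = (\<Sum>a\<in>A. g a x)"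
  for g :: "'a \<Rightarrow> 'b \<Rightarrow> 'c :: comm_monoid_add"
  by (induction A rule: infinite_finite_induct) auto

text \<open>Along \<open>enc\<close> the invariant becomes an element of the exterior algebra with a
  leading term at a walker family. Thus coefficients at walker families determine an
  invariant.\<close>

lemma invariant_nonzero_at_walker:
  assumes "n \<ge> 1" "w \<in> invariants n m" "w \<noteq> 0"
  shows "\<exists>T\<in>tbasis n m. steps_of n m (enc n T) \<in> walker_families n m \<and> w T \<noteq> 0"
proof -
  define \<phi> where "\<phi> = (\<lambda>S. if S \<subseteq> {..<2 * m * n} then w (dec n m S) else 0)"
  have D: "2 * n * m = 2 * m * n" by simp
  have w: "w = (\<lambda>T. if T \<in> tbasis n m then \<phi> (enc n T) else 0)"
  proof
    fix T
    show "w T = (if T \<in> tbasis n m then \<phi> (enc n T) else 0)"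
      using assms(2) enc_subset[of T n m] unfolding D
      by (auto simp: \<phi>_def dec_enc invariants_def tvectors_def)
  qed
  have supp: "S \<subseteq> {..<2 * m * n}" if "\<phi> S \<noteq> 0" for S
    using that by (auto simp: \<phi>_def split: if_splits)
  have inv: "rho n m X \<phi> S = 0" if X: "X \<in> sp n" for X S
  proof (cases "S \<subseteq> {..<2 * m * n}")
    case True
    have "tensor_act n m X w (dec n m S) = 0" using assms(2) X by (simp add: invariants_def)
    moreover have "tensor_act n m X w (dec n m S) = rho n m X \<phi> (enc n (dec n m S))"
      by (subst w) (rule tensor_act_eq_rho[OF dec_in_tbasis])
    ultimately show ?thesis using enc_dec[of S n m] True unfolding D by simp
  qed (use rho_outside[OF supp] in blast)
  obtain T1 where "w T1 \<noteq> 0" using assms(3) by (auto simp: fun_eq_iff)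
  then have "\<phi> (enc n T1) \<noteq> 0" using w by metis
  from invariant_leading_term[OF assms(1) supp inv this]
  obtain S where S: "\<phi> S \<noteq> 0" "steps_of n m S \<in> walker_families n m" by blast
  have "enc n (dec n m S) = S" using enc_dec[of S n m] supp[OF S(1)] unfolding D by simp
  moreover have "w (dec n m S) \<noteq> 0" using S(1) by (auto simp: \<phi>_def split: if_splits)
  ultimately show ?thesis using S(2) dec_in_tbasis[of n m S] by (intro bexI[of _ "dec n m S"]) auto
qed

lemma tensor_act_linear:
  "tensor_act n m X (u + v) = tensor_act n m X u + tensor_act n m X v"
  "tensor_act n m X (cscale c u) = cscale c (tensor_act n m X u)"
  by (auto simp: tensor_act_def cscale_def fun_eq_iff algebra_simps sum.distrib sum_distrib_left)

lemma subspace_invariants: "module.subspace cscale (invariants n m)"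
proof -
  interpret V: vector_space cscale by (rule vector_space_cscale)
  have "tensor_act n m X 0 = 0" for X by (simp add: tensor_act_def fun_eq_iff)
  then show ?thesis
    by (intro V.subspaceI)
      (auto simp: invariants_def tvectors_def tensor_act_linear, auto simp: cscale_def fun_eq_iff)
qed

text \<open>Restricting coefficients to the set \<open>L\<close> of walker tensors is injective on
  invariants, because a difference of invariants is invariant. The image lies in the span of
  \<open>card L\<close> delta functions.\<close>

lemma mult_trivial_le:
  assumes "n \<ge> 1"
  shows "mult_trivial n m \<le> card (walker_families n m)"
proof -
  interpret V: vector_space cscale by (rule vector_space_cscale)
  interpret P: vector_space_pair cscale cscale by unfold_locales
  let ?W = "invariants n m"
  define L where "L = {T \<in> tbasis n m. steps_of n m (enc n T) \<in> walker_families n m}"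
  define f where "f = (\<lambda>w::nat set list \<Rightarrow> complex. \<lambda>T. if T \<in> L then w T else 0)"
  define \<delta> where "\<delta> = (\<lambda>T T'::nat set list. if T' = T then 1 else 0 :: complex)"
  have finL: "finite L" using finite_tbasis[of n m] by (simp add: L_def)
  have "card L \<le> card (walker_families n m)"
  proof (rule card_inj_on_le)
    show "inj_on (\<lambda>T. steps_of n m (enc n T)) L"
    proof (rule inj_onI)
      fix T T' assume T: "T \<in> L" "T' \<in> L" and eq: "steps_of n m (enc n T) = steps_of n m (enc n T')"
      have "enc n T \<subseteq> {..<2 * n * m}" "enc n T' \<subseteq> {..<2 * n * m}" using T enc_subset by (auto simp: L_def)
      then have "enc n T = enc n T'" using eq inj_onD[OF inj_steps_of[of n m], of "enc n T" "enc n T'"] by (simp add: mult_ac)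
      moreover have "dec n m (enc n T) = T" "dec n m (enc n T') = T'" using T by (auto simp: L_def dec_enc)
      ultimately show "T = T'" by metis
    qed
  qed (auto simp: L_def finite_walker_families)
  moreover have lin: "Vector_Spaces.linear cscale cscale f"
    by unfold_locales (auto simp: f_def cscale_def fun_eq_iff)
  moreover have "inj_on f (V.span ?W)"
    unfolding V.span_eq_iff[THEN iffD2, OF subspace_invariants]
  proof (rule inj_onI)
    fix x y assume xy: "x \<in> ?W" "y \<in> ?W" "f x = f y"
    have "x - y \<in> ?W" using xy V.subspace_diff[OF subspace_invariants] by blast
    moreover have "(x - y) T = 0" if "T \<in> L" for T
      using fun_cong[OF xy(3), of T] that by (simp add: f_def)
    ultimately have "x - y = 0" using invariant_nonzero_at_walker[OF assms, of "x - y" m] by (auto simp: L_def)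
    then show "x = y" by simp
  qed
  moreover have "f ` ?W \<subseteq> V.span (\<delta> ` L)"
  proof
    fix v assume "v \<in> f ` ?W"
    then obtain w where v: "v = f w" by auto
    have "v = (\<Sum>T\<in>L. cscale (w T) (\<delta> T))"
      by (rule ext) (simp add: v f_def fun_sum_apply cscale_def \<delta>_def finL if_distrib[of "\<lambda>x. _ * x"] cong: if_cong)
    moreover have "(\<Sum>T\<in>L. cscale (w T) (\<delta> T)) \<in> V.span (\<delta> ` L)"
      by (intro V.span_sum V.span_scale V.span_base imageI)
    ultimately show "v \<in> V.span (\<delta> ` L)" by simp
  qed
  ultimately have L: "card L \<le> card (walker_families n m)" and inj: "inj_on f (V.span ?W)"
    and span: "f ` ?W \<subseteq> V.span (\<delta> ` L)" by auto
  obtain B where B: "B \<subseteq> ?W" "V.independent B" "?W \<subseteq> V.span B" "card B = V.dim ?W"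
    by (rule V.basis_exists)
  have sub: "V.span B \<subseteq> V.span ?W" using B(1) by (rule V.span_mono)
  have "V.independent (f ` B)"
    using P.linear_independent_injective_image[OF lin B(2)] inj_on_subset[OF inj sub] by blast
  moreover have "f ` B \<subseteq> V.span (\<delta> ` L)" using B(1) span by blast
  ultimately have "card (f ` B) \<le> card (\<delta> ` L)"
    using V.independent_span_bound[of "\<delta> ` L" "f ` B"] finL by blast
  moreover have "card (f ` B) = card B"
    using inj_on_subset[OF inj] sub V.span_superset[of B] by (intro card_image) blast
  ultimately show ?thesis
    using L B(4) card_image_le[OF finL, of \<delta>] unfolding mult_trivial_def by simp
qed

section \<open>The lower bound\<close>

lemma rho_linear:
  "rho n m X (\<lambda>S. c * \<phi> S) S = c * rho n m X \<phi> S"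
  "rho n m X (\<lambda>S. \<Sum>a\<in>A. f a S) S = (\<Sum>a\<in>A. rho n m X (f a) S)"
proof -
  show "rho n m X (\<lambda>S. c * \<phi> S) S = c * rho n m X \<phi> S"
    by (simp add: rho_def hop_linear sum_distrib_left mult.left_commute)
  show "rho n m X (\<lambda>S. \<Sum>a\<in>A. f a S) S = (\<Sum>a\<in>A. rho n m X (f a) S)"
  proof -
    let ?g = "\<lambda>a p i j. X i j * hop (p * (2 * n) + i) (p * (2 * n) + j) (f a) S"
    have "(\<Sum>a\<in>A. \<Sum>p<m. \<Sum>i<2*n. \<Sum>j<2*n. ?g a p i j) = (\<Sum>p<m. \<Sum>a\<in>A. \<Sum>i<2*n. \<Sum>j<2*n. ?g a p i j)"
      by (rule sum.swap)
    also have "\<dots> = (\<Sum>p<m. \<Sum>i<2*n. \<Sum>a\<in>A. \<Sum>j<2*n. ?g a p i j)"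
      by (intro sum.cong refl sum.swap)
    also have "\<dots> = (\<Sum>p<m. \<Sum>i<2*n. \<Sum>j<2*n. \<Sum>a\<in>A. ?g a p i j)"
      by (intro sum.cong refl sum.swap)
    finally show ?thesis by (simp only: rho_def hop_linear sum_distrib_left)
  qed
qed

lemma rho_cr:
  assumes "a < m" "r < 2 * n"
  shows "rho n m X (cr (a * (2 * n) + r) \<phi>) S = cr (a * (2 * n) + r) (rho n m X \<phi>) S
    + (\<Sum>i<2*n. X i r * cr (a * (2 * n) + i) \<phi> S)"
proof -
  let ?q = "a * (2 * n) + r"
  have "rho n m X (cr ?q \<phi>) S = (\<Sum>p<m. \<Sum>i<2*n. \<Sum>j<2*n. X i j * cr ?q (hop (p * (2 * n) + i) (p * (2 * n) + j) \<phi>) S)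
     + (\<Sum>p<m. \<Sum>i<2*n. \<Sum>j<2*n. if p * (2 * n) + j = ?q then X i j * cr (p * (2 * n) + i) \<phi> S else 0)"
    unfolding rho_def hop_cr sum.distrib[symmetric]
    by (intro sum.cong refl) (simp add: distrib_left)
  also have "(\<Sum>p<m. \<Sum>i<2*n. \<Sum>j<2*n. X i j * cr ?q (hop (p * (2 * n) + i) (p * (2 * n) + j) \<phi>) S)
     = cr ?q (rho n m X \<phi>) S"
    unfolding rho_def[abs_def] by (simp only: cr_linear)
  also have "(\<Sum>p<m. \<Sum>i<2*n. \<Sum>j<2*n. if p * (2 * n) + j = ?q then X i j * cr (p * (2 * n) + i) \<phi> S else 0)
     = (\<Sum>p<m. \<Sum>i<2*n. \<Sum>j<2*n. if j = r then (if p = a then X i j * cr (p * (2 * n) + i) \<phi> S else 0) else 0)"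
    using assms by (intro sum.cong refl) (auto simp: index_eq_iff)
  also have "\<dots> = (\<Sum>p<m. if p = a then (\<Sum>i<2*n. X i r * cr (p * (2 * n) + i) \<phi> S) else 0)"
    using assms(2) by (intro sum.cong refl) (simp add: sum.delta)
  also have "\<dots> = (\<Sum>i<2*n. X i r * cr (a * (2 * n) + i) \<phi> S)"
    using assms(1) by (simp add: sum.delta)
  finally show ?thesis .
qed

text \<open>Left exterior multiplication by the quadratic element that pairs the blocks
  \<open>fst ab\<close> and \<open>snd ab\<close> by the symplectic form.\<close>

definition omega :: "nat \<Rightarrow> nat \<times> nat \<Rightarrow> (nat set \<Rightarrow> complex) \<Rightarrow> nat set \<Rightarrow> complex" where
  "omega n ab \<phi> S = (\<Sum>r<2*n. \<Sum>s<2*n.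
     symp_form n r s * cr (fst ab * (2 * n) + r) (cr (snd ab * (2 * n) + s) \<phi>) S)"

lemma symp_form_sum_right:
  "r < 2 * n \<Longrightarrow> (\<Sum>s<2*n. symp_form n r s * f s) = (if r < n then 1 else - 1) * f (bar n r)"
proof -
  assume r: "r < 2 * n"
  have "(\<Sum>s<2*n. symp_form n r s * f s) = (\<Sum>s<2*n. if s = bar n r then (if r < n then 1 else - 1) * f (bar n r) else 0)"
    using r by (intro sum.cong refl) (auto simp: symp_form_def bar_def)
  also have "\<dots> = (if r < n then 1 else - 1) * f (bar n r)"
    using r by (subst sum.delta) (auto simp: bar_def)
  finally show ?thesis .
qed

lemma symp_form_antisym: "symp_form n r s = - symp_form n s r"
  by (auto simp: symp_form_def)

text \<open>The definition of \<open>sp\<close> says that the form is invariant; this is the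
  invariance of the bivector with the same coefficients. It follows by evaluating the defining
  relation at \<open>bar n r\<close> and \<open>bar n s\<close>.\<close>

lemma sp_dual:
  assumes "X \<in> sp n" "r < 2 * n" "s < 2 * n"
  shows "(\<Sum>i<2*n. symp_form n r i * X s i) + (\<Sum>i<2*n. symp_form n i s * X r i) = 0"
proof -
  have b: "bar n r < 2 * n" "bar n s < 2 * n" "bar n (bar n r) = r" "bar n (bar n s) = s"
    "bar n r < n \<longleftrightarrow> \<not> r < n" "bar n s < n \<longleftrightarrow> \<not> s < n"
    using assms(2,3) by (auto simp: bar_def)
  have "(if bar n r < n then 1 else - 1) * X (bar n (bar n r)) (bar n s)
      = (if bar n s < n then 1 else - 1) * X (bar n (bar n s)) (bar n r)"
    using assms(1) b(1,2) unfolding sp_iff by blast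
  moreover have "(\<Sum>i<2*n. symp_form n i s * X r i) = - (\<Sum>i<2*n. symp_form n s i * X r i)"
    unfolding sum_negf[symmetric] by (intro sum.cong refl) (simp add: symp_form_antisym[of n _ s])
  ultimately show ?thesis
    using b by (simp add: symp_form_sum_right assms split: if_splits)
qed

text \<open>By the derivation rule each of the two generators contributes one extra sum. After
  renaming summation indices, the coefficients of these sums add up to the left side of
  \<open>sp_dual\<close>.\<close>

lemma rho_omega:
  assumes X: "X \<in> sp n" and "fst ab < m" "snd ab < m"
  shows "rho n m X (omega n ab \<phi>) S = omega n ab (rho n m X \<phi>) S"
proof -
  obtain a b where ab: "ab = (a, b)" by (cases ab)
  let ?k = "\<lambda>r. a * (2 * n) + r" and ?l = "\<lambda>s. b * (2 * n) + s"
  let ?c = "\<lambda>r s. cr (?k r) (cr (?l s) \<phi>) S"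
  have cc: "rho n m X (cr (?k r) (cr (?l s) \<phi>)) S = cr (?k r) (cr (?l s) (rho n m X \<phi>)) S
     + (\<Sum>i<2*n. X i s * ?c r i) + (\<Sum>i<2*n. X i r * ?c i s)" if "r < 2 * n" "s < 2 * n" for r s
  proof -
    have "rho n m X (cr (?l s) \<phi>) = (\<lambda>S. cr (?l s) (rho n m X \<phi>) S + (\<Sum>i<2*n. X i s * cr (?l i) \<phi> S))"
      using assms that by (intro ext rho_cr) (auto simp: ab)
    then show ?thesis using assms that by (simp add: rho_cr ab cr_linear)
  qed
  have "rho n m X (omega n ab \<phi>) S = (\<Sum>r<2*n. \<Sum>s<2*n. symp_form n r s * rho n m X (cr (?k r) (cr (?l s) \<phi>)) S)"
    unfolding omega_def[abs_def] ab fst_conv snd_conv by (simp only: rho_linear)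
  also have "\<dots> = omega n ab (rho n m X \<phi>) S
      + (\<Sum>r<2*n. \<Sum>s<2*n. \<Sum>i<2*n. symp_form n r s * X i s * ?c r i)
      + (\<Sum>r<2*n. \<Sum>s<2*n. \<Sum>i<2*n. symp_form n r s * X i r * ?c i s)"
    unfolding omega_def ab fst_conv snd_conv sum.distrib[symmetric]
    by (intro sum.cong refl) (simp add: cc distrib_left sum_distrib_left mult.assoc sum.distrib)
  also have "(\<Sum>r<2*n. \<Sum>s<2*n. \<Sum>i<2*n. symp_form n r s * X i s * ?c r i)
      = (\<Sum>r<2*n. \<Sum>s<2*n. (\<Sum>i<2*n. symp_form n r i * X s i) * ?c r s)"
    unfolding sum_distrib_right by (rule sum.cong[OF refl], rule sum.swap)
  also have "(\<Sum>r<2*n. \<Sum>s<2*n. \<Sum>i<2*n. symp_form n r s * X i r * ?c i s)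
      = (\<Sum>r<2*n. \<Sum>s<2*n. (\<Sum>i<2*n. symp_form n i s * X r i) * ?c r s)"
  proof -
    have "(\<Sum>r<2*n. \<Sum>s<2*n. \<Sum>i<2*n. symp_form n r s * X i r * ?c i s)
      = (\<Sum>r<2*n. \<Sum>i<2*n. \<Sum>s<2*n. symp_form n r s * X i r * ?c i s)"
      by (intro sum.cong refl sum.swap)
    also have "\<dots> = (\<Sum>i<2*n. \<Sum>r<2*n. \<Sum>s<2*n. symp_form n r s * X i r * ?c i s)"
      by (rule sum.swap)
    also have "\<dots> = (\<Sum>i<2*n. \<Sum>s<2*n. \<Sum>r<2*n. symp_form n r s * X i r * ?c i s)"
      by (intro sum.cong refl sum.swap)
    finally show ?thesis unfolding sum_distrib_right .
  qed
  finally show ?thesis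
    unfolding add.assoc sum.distrib[symmetric] distrib_right[symmetric]
    using sp_dual[OF X, unfolded sum.distrib[symmetric]] by simp
qed

definition vac :: "nat set \<Rightarrow> complex" where
  "vac S = (if S = {} then 1 else 0)"

definition omegas :: "nat \<Rightarrow> (nat \<times> nat) list \<Rightarrow> nat set \<Rightarrow> complex" where
  "omegas n M = foldr (omega n) M vac"

lemma rho_omegas:
  assumes "X \<in> sp n" "\<And>ab. ab \<in> set M \<Longrightarrow> fst ab < m \<and> snd ab < m"
  shows "rho n m X (omegas n M) S = 0"
  using assms(2)
proof (induction M arbitrary: S)
  case Nil
  have "hop k l vac S = 0" for k l by (simp add: hop_def cr_def an_def vac_def)
  then show ?case by (simp add: omegas_def rho_def)
next
  case (Cons ab M)
  have "rho n m X (omegas n M) = (\<lambda>S. 0)" using Cons by auto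
  then have "omega n ab (rho n m X (omegas n M)) S = 0"
    by (simp add: omega_def cr_def cong: if_cong)
  moreover have "omegas n (ab # M) = omega n ab (omegas n M)" by (simp add: omegas_def)
  ultimately show ?case using rho_omega[OF assms(1), of ab m "omegas n M" S] Cons.prems by simp
qed

section \<open>Monomial expansion\<close>

text \<open>The triple \<open>(i, a, b)\<close> stands for the monomial with
  \<open>p\<^sub>i\<close> in factor \<open>a\<close> and \<open>q\<^sub>i\<close> in factor
  \<open>b\<close>.\<close>

definition pair_cr :: "nat \<Rightarrow> nat \<times> nat \<times> nat \<Rightarrow> (nat set \<Rightarrow> complex) \<Rightarrow> nat set \<Rightarrow> complex" where
  "pair_cr n = (\<lambda>(i, a, b) \<phi>. cr (2 * a * n + i) (cr ((2 * b + 1) * n + i) \<phi>))"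

lemma sum_halves: "(\<Sum>r<2*n. f r) = (\<Sum>i<n. f i + f (n + i))"
  for f :: "nat \<Rightarrow> 'a :: comm_monoid_add"
proof -
  have "(\<Sum>r<n + k. f r) = (\<Sum>i<n. f i) + (\<Sum>i<k. f (n + i))" for k
    by (induction k) (simp_all add: add.assoc)
  then show ?thesis by (simp add: mult_2 sum.distrib)
qed

text \<open>On the second half of the basis the form has sign \<open>- 1\<close>, which is cancelled
  by exchanging the two anticommuting generators. Hence the element is symmetric in \<open>a\<close>
  and \<open>b\<close>, with positive coefficients.\<close>

lemma omega_eq_pair_cr:
  "omega n (a, b) \<phi> S = (\<Sum>i<n. pair_cr n (i, a, b) \<phi> S + pair_cr n (i, b, a) \<phi> S)"
proof -
  have "omega n (a, b) \<phi> S = (\<Sum>r<2*n. (if r < n then 1 else - 1) * cr (a * (2 * n) + r) (cr (b * (2 * n) + bar n r) \<phi>) S)"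
    unfolding omega_def by (intro sum.cong refl) (simp add: symp_form_sum_right)
  also have "\<dots> = (\<Sum>i<n. cr (a * (2 * n) + i) (cr (b * (2 * n) + (n + i)) \<phi>) S
      - cr (a * (2 * n) + (n + i)) (cr (b * (2 * n) + i) \<phi>) S)"
    unfolding sum_halves by (intro sum.cong refl) (simp add: bar_def add_ac)
  also have "\<dots> = (\<Sum>i<n. pair_cr n (i, a, b) \<phi> S + pair_cr n (i, b, a) \<phi> S)"
  proof (intro sum.cong refl)
    fix i
    have "- cr (a * (2 * n) + (n + i)) (cr (b * (2 * n) + i) \<phi>) S = cr (b * (2 * n) + i) (cr (a * (2 * n) + (n + i)) \<phi>) S"
      by (subst cr_cr) simp
    moreover have "x * (2 * n) + i = 2 * x * n + i" "x * (2 * n) + (n + i) = (2 * x + 1) * n + i" for x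
      by (simp_all add: algebra_simps)
    ultimately show "cr (a * (2 * n) + i) (cr (b * (2 * n) + (n + i)) \<phi>) S - cr (a * (2 * n) + (n + i)) (cr (b * (2 * n) + i) \<phi>) S
      = pair_cr n (i, a, b) \<phi> S + pair_cr n (i, b, a) \<phi> S"
      by (simp only: pair_cr_def prod.case diff_conv_add_uminus)
  qed
  finally show ?thesis .
qed

text \<open>A list and not a set: for equal entries of \<open>ab\<close> every monomial occurs
  twice.\<close>

definition orientations :: "nat \<Rightarrow> nat \<times> nat \<Rightarrow> (nat \<times> nat \<times> nat) list" where
  "orientations n ab = concat (map (\<lambda>i. [(i, fst ab, snd ab), (i, snd ab, fst ab)]) [0..<n])"

lemma omega_eq_sum_list:
  "omega n ab \<phi> S = (\<Sum>t\<leftarrow>orientations n ab. pair_cr n t \<phi> S)"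
proof -
  have "(\<Sum>t\<leftarrow>concat (map (\<lambda>i. [(i, a, b), (i, b, a)]) [0..<k]). pair_cr n t \<phi> S)
     = (\<Sum>i<k. pair_cr n (i, a, b) \<phi> S + pair_cr n (i, b, a) \<phi> S)" for a b k
    by (induction k) (simp_all add: add_ac)
  then show ?thesis by (cases ab) (simp add: orientations_def omega_eq_pair_cr)
qed

lemma cr_sum_list: "cr k (\<lambda>S. \<Sum>c\<leftarrow>cs. f c S) S = (\<Sum>c\<leftarrow>cs. cr k (f c) S)"
  by (cases "k \<in> S") (induction cs; simp add: cr_def distrib_left)+

lemma pair_cr_sum_list: "pair_cr n t (\<lambda>S. \<Sum>c\<leftarrow>cs. f c S) S = (\<Sum>c\<leftarrow>cs. pair_cr n t (f c) S)"
  by (cases t) (simp add: pair_cr_def cr_sum_list[abs_def] cr_sum_list)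

definition pairs_vac :: "nat \<Rightarrow> (nat \<times> nat \<times> nat) list \<Rightarrow> nat set \<Rightarrow> complex" where
  "pairs_vac n c = foldr (pair_cr n) c vac"

lemma omegas_eq_sum_list:
  "omegas n M S = (\<Sum>c\<leftarrow>product_lists (map (orientations n) M). pairs_vac n c S)"
proof (induction M arbitrary: S)
  case (Cons ab M)
  let ?P = "product_lists (map (orientations n) M)"
  have "omegas n M = (\<lambda>S. \<Sum>c\<leftarrow>?P. pairs_vac n c S)" using Cons by auto
  then have "omegas n (ab # M) S = (\<Sum>t\<leftarrow>orientations n ab. \<Sum>c\<leftarrow>?P. pairs_vac n (t # c) S)"
    by (simp add: omegas_def[of n "_ # _"] omegas_def[symmetric] omega_eq_sum_list pair_cr_sum_list pairs_vac_def)
  also have "\<dots> = (\<Sum>c\<leftarrow>concat (map (\<lambda>t. map ((#) t) ?P) (orientations n ab)). pairs_vac n c S)"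
    by (induction ("orientations n ab")) (simp_all add: o_def)
  finally show ?case by simp
qed (simp add: omegas_def pairs_vac_def)

text \<open>Elements of even degree commute. So a product of pairs depends only on the multiset of
  its factors, and rearranged terms of an expansion cannot cancel.\<close>

lemma pair_cr_commute: "pair_cr n t \<circ> pair_cr n t' = pair_cr n t' \<circ> pair_cr n t"
proof -
  have neg: "cr k (\<lambda>S. - \<phi> S) = (\<lambda>S. - cr k \<phi> S)" for k \<phi> by (auto simp: cr_def)
  have sw: "cr k (cr l \<phi>) = (\<lambda>S. - cr l (cr k \<phi>) S)" for k l \<phi> by (rule ext) (rule cr_cr)
  have "cr k (cr l (cr p (cr q \<phi>))) = cr p (cr q (cr k (cr l \<phi>)))" for k l p q \<phi>
  proof -
    have "cr k (cr l (cr p (cr q \<phi>))) = cr p (cr k (cr l (cr q \<phi>)))"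
      by (subst sw[of l p], simp only: neg, subst sw[of k p], simp only: minus_minus)
    also have "cr k (cr l (cr q \<phi>)) = cr q (cr k (cr l \<phi>))"
      by (subst sw[of l q], simp only: neg, subst sw[of k q], simp only: minus_minus)
    finally show ?thesis .
  qed
  then show ?thesis by (cases t; cases t') (auto simp: pair_cr_def fun_eq_iff)
qed

lemma pairs_vac_mset:
  assumes "mset c = mset c'"
  shows "pairs_vac n c = pairs_vac n c'"
proof -
  have "foldr (pair_cr n) c = fold (pair_cr n) c" for c by (intro foldr_fold pair_cr_commute)
  moreover have "fold (pair_cr n) c = fold (pair_cr n) c'"
    by (rule fold_multiset_equiv[OF pair_cr_commute assms])
  ultimately show ?thesis by (simp add: pairs_vac_def)
qed

definition indices :: "nat \<Rightarrow> (nat \<times> nat \<times> nat) list \<Rightarrow> nat list" where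
  "indices n c = concat (map (\<lambda>(i, a, b). [2 * a * n + i, (2 * b + 1) * n + i]) c)"

lemma foldr_cr_vac: "foldr cr ks vac S \<noteq> 0 \<longleftrightarrow> distinct ks \<and> S = set ks"
proof (induction ks arbitrary: S)
  case (Cons k ks)
  have "jw_sign k S \<noteq> 0" by (simp add: jw_sign_def)
  then have "foldr cr (k # ks) vac S \<noteq> 0 \<longleftrightarrow> k \<in> S \<and> distinct ks \<and> S - {k} = set ks"
    using Cons[of "S - {k}"] by (simp add: cr_def[of k])
  also have "\<dots> \<longleftrightarrow> distinct (k # ks) \<and> S = set (k # ks)" by auto
  finally show ?case .
qed (simp add: vac_def)

lemma pairs_vac_nonzero: "pairs_vac n c S \<noteq> 0 \<longleftrightarrow> distinct (indices n c) \<and> S = set (indices n c)"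
proof -
  have "pairs_vac n c = foldr cr (indices n c) vac"
    by (induction c) (auto simp: pairs_vac_def indices_def pair_cr_def)
  then show ?thesis by (simp add: foldr_cr_vac)
qed


text \<open>In a nonzero monomial no generator repeats, so on each level \<open>i\<close> the pairs
  \<open>(a, b)\<close> form a matching, as the rearrangement inequality requires.\<close>

lemma distinct_indices:
  assumes "distinct (indices n c)"
  shows "distinct c \<and> inj_on (\<lambda>(i, a, b). 2 * a * n + i) (set c) \<and>
    inj_on (\<lambda>(i, a, b). (2 * b + 1) * n + i) (set c)"
  using assms
proof (induction c)
  case (Cons t c)
  obtain i a b where t: "t = (i, a, b)" by (cases t)
  have c: "distinct (indices n c)" and notin: "2 * a * n + i \<notin> set (indices n c)" "(2 * b + 1) * n + i \<notin> set (indices n c)"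
    using Cons.prems by (auto simp: indices_def t)
  have "2 * a' * n + i' \<in> set (indices n c)" "(2 * b' + 1) * n + i' \<in> set (indices n c)"
    if "(i', a', b') \<in> set c" for i' a' b'
    using that by (force simp: indices_def)+
  then have n1: "2 * a * n + i \<noteq> 2 * a' * n + i'" "(2 * b + 1) * n + i \<noteq> (2 * b' + 1) * n + i'"
    if "(i', a', b') \<in> set c" for i' a' b'
    using that notin by metis+
  have "t \<notin> set c" using n1(1)[of i a b] t by blast
  moreover have "(\<lambda>(i, a, b). 2 * a * n + i) t \<notin> (\<lambda>(i, a, b). 2 * a * n + i) ` set c"
    "(\<lambda>(i, a, b). (2 * b + 1) * n + i) t \<notin> (\<lambda>(i, a, b). (2 * b + 1) * n + i) ` set c"
    using n1 by (auto simp: t)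
  ultimately show ?case using Cons.IH[OF c] by simp
qed auto

section \<open>The rearrangement inequality\<close>

definition strict_chain :: "(nat \<times> nat) set \<Rightarrow> bool" where
  "strict_chain C \<longleftrightarrow> (\<forall>x\<in>C. \<forall>y\<in>C. x \<noteq> y \<longrightarrow>
     (fst x < fst y \<and> snd x < snd y) \<or> (fst y < fst x \<and> snd y < snd x))"

text \<open>Rearrangement inequality with its equality case, by induction on the size. If
  \<open>G\<close> misses the top element \<open>(\<alpha>, \<beta>)\<close> of \<open>C\<close>, it
  contains some \<open>(\<alpha>, b)\<close> and \<open>(a, \<beta>)\<close> with
  \<open>a < \<alpha>\<close> and \<open>b < \<beta>\<close>, and uncrossing these strictly
  increases the sum.\<close>

lemma strict_chain_maximizes:
  assumes "finite C" "strict_chain C" "finite G" "inj_on fst G" "inj_on snd G"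
    "fst ` G = fst ` C" "snd ` G = snd ` C"
  shows "(\<Sum>x\<in>G. fst x * snd x) \<le> (\<Sum>x\<in>C. fst x * snd x) \<and>
    ((\<Sum>x\<in>G. fst x * snd x) = (\<Sum>x\<in>C. fst x * snd x) \<longrightarrow> G = C)"
  using assms
proof (induction "card C" arbitrary: C G)
  case 0
  then show ?case by auto
next
  case (Suc N)
  have "C \<noteq> {}" using Suc.hyps(2) by auto
  then have "fst ` C \<noteq> {}" by auto
  then obtain z where z: "z \<in> C" "fst z = Max (fst ` C)"
    using Max_in[of "fst ` C"] Suc.prems(1) by (metis finite_imageI imageE)
  obtain \<alpha> \<beta> where zab: "z = (\<alpha>, \<beta>)" by (cases z)
  have big: "fst x < \<alpha> \<and> snd x < \<beta>" if "x \<in> C" "x \<noteq> z" for x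
  proof -
    have "fst x \<le> \<alpha>" using z that Suc.prems(1) zab by (metis Max_ge finite_imageI fst_conv imageI)
    then show ?thesis using Suc.prems(2) that z(1) zab by (fastforce simp: strict_chain_def)
  qed
  have zG: "\<alpha> \<in> fst ` G" "\<beta> \<in> snd ` G" using Suc.prems(6,7) z(1) zab by force+
  then obtain b a where ab: "(\<alpha>, b) \<in> G" "(a, \<beta>) \<in> G" by auto
  let ?s = "\<lambda>G. \<Sum>x\<in>G. fst x * snd x :: nat"
  have C': "card (C - {z}) = N" "finite (C - {z})" "strict_chain (C - {z})"
    using Suc.hyps(2) Suc.prems z(1) by (auto simp: strict_chain_def)
  have imC: "fst ` (C - {z}) = fst ` C - {\<alpha>}" "snd ` (C - {z}) = snd ` C - {\<beta>}"
    using big z(1) zab by force+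
  have sC: "?s C = ?s (C - {z}) + \<alpha> * \<beta>"
    using sum.remove[OF Suc.prems(1) z(1), of "\<lambda>x. fst x * snd x"] zab by simp
  show ?case
  proof (cases "z \<in> G")
    case True
    have sG: "?s G = ?s (G - {z}) + \<alpha> * \<beta>"
      using sum.remove[OF Suc.prems(3) True, of "\<lambda>x. fst x * snd x"] zab by simp
    have "fst ` (G - {z}) = fst ` G - {\<alpha>}" "snd ` (G - {z}) = snd ` G - {\<beta>}"
      using inj_on_image_set_diff[OF Suc.prems(4), of G "{z}"] inj_on_image_set_diff[OF Suc.prems(5), of G "{z}"] True zab by auto
    then have "?s (G - {z}) \<le> ?s (C - {z}) \<and> (?s (G - {z}) = ?s (C - {z}) \<longrightarrow> G - {z} = C - {z})"
      using Suc.prems C' imC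
      by (intro Suc.hyps(1)) (auto intro: inj_on_subset)
    then show ?thesis using sC sG True z(1) by auto
  next
    case False
    have ne: "a \<noteq> \<alpha>" "b \<noteq> \<beta>" using ab False zab inj_onD[OF Suc.prems(4) _ ab(1), of z]
        inj_onD[OF Suc.prems(4) _ ab] inj_onD[OF Suc.prems(5) _ ab] by auto
    have "a \<in> fst ` C" "b \<in> snd ` C" using ab Suc.prems(6,7) by force+
    then have less: "a < \<alpha>" "b < \<beta>" using ne big zab by force+
    \<comment> \<open>The two crossing pairs are traded for \<open>(a, b)\<close> and
      \<open>(\<alpha>, \<beta>)\<close>; the latter is set aside, so that the induction hypothesis
      for \<open>C - {z}\<close> applies to \<open>G'\<close>.\<close>
    define G0 where "G0 = G - {(\<alpha>, b), (a, \<beta>)}"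
    define G' where "G' = insert (a, b) G0"
    have G0: "fst x \<noteq> \<alpha>" "fst x \<noteq> a" "snd x \<noteq> b" "snd x \<noteq> \<beta>" if "x \<in> G0" for x
      using that ab inj_onD[OF Suc.prems(4), of x "(\<alpha>, b)"] inj_onD[OF Suc.prems(4), of x "(a, \<beta>)"]
        inj_onD[OF Suc.prems(5), of x "(\<alpha>, b)"] inj_onD[OF Suc.prems(5), of x "(a, \<beta>)"]
      by (auto simp: G0_def)
    have G: "G = insert (\<alpha>, b) (insert (a, \<beta>) G0)" using ab by (auto simp: G0_def)
    have fin: "finite G0" using Suc.prems(3) by (simp add: G0_def)
    have "(a, b) \<notin> G0" using G0[of "(a, b)"] by auto
    then have sG': "?s G' = a * b + ?s G0" using fin by (simp add: G'_def)
    have sG: "?s G = \<alpha> * b + (a * \<beta> + ?s G0)"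
    proof -
      have "(\<alpha>, b) \<notin> insert (a, \<beta>) G0" "(a, \<beta>) \<notin> G0"
        using ne G0[of "(\<alpha>, b)"] G0[of "(a, \<beta>)"] by auto
      then show ?thesis unfolding G using fin by simp
    qed
    have "inj_on fst G0" "inj_on snd G0" using Suc.prems by (auto simp: G0_def intro: inj_on_subset)
    moreover have "a \<notin> fst ` G0" "b \<notin> snd ` G0" using G0(2,3) by (metis imageE)+
    ultimately have inj': "inj_on fst G'" "inj_on snd G'" by (auto simp: G'_def)
    have "fst ` G' = fst ` G - {\<alpha>}" "snd ` G' = snd ` G - {\<beta>}"
      using G0 ne unfolding G G'_def by force+
    then have "?s G' \<le> ?s (C - {z})"
      using Suc.prems C' imC inj' fin Suc.hyps(1)[of "C - {z}" G'] by (simp add: G'_def)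
    moreover have "\<alpha> * b + a * \<beta> < a * b + \<alpha> * \<beta>"
    proof -
      obtain p q where "\<alpha> = a + p" "\<beta> = b + q" "0 < p" "0 < q"
        using less by (metis less_imp_add_positive)
      then show ?thesis by (simp add: algebra_simps)
    qed
    ultimately have "?s G < ?s C" using sC sG sG' by linarith
    then show ?thesis by simp
  qed
qed


section \<open>Triangularity of the products of quadratic invariants\<close>

lemma indices_subset:
  assumes "\<And>t. t \<in> set c \<Longrightarrow> fst t < n \<and> fst (snd t) < m \<and> snd (snd t) < m"
  shows "set (indices n c) \<subseteq> {..<2 * m * n}"
proof
  fix k assume "k \<in> set (indices n c)"
  then obtain i a b where t: "(i, a, b) \<in> set c" and k: "k = 2 * a * n + i \<or> k = (2 * b + 1) * n + i"
    by (auto simp: indices_def)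
  then have "i < n" "2 * a < 2 * m" "2 * b + 1 < 2 * m" using assms[OF t] by auto
  then show "k \<in> {..<2 * m * n}" using k index_less[of i n] by (metis lessThan_iff)
qed

lemma indices_mem:
  assumes "\<And>t. t \<in> set c \<Longrightarrow> fst t < n" "i < n"
  shows "2 * a * n + i \<in> set (indices n c) \<longleftrightarrow> (\<exists>b. (i, a, b) \<in> set c)"
    "(2 * b + 1) * n + i \<in> set (indices n c) \<longleftrightarrow> (\<exists>a. (i, a, b) \<in> set c)"
proof -
  have *: "k \<in> set (indices n c) \<longleftrightarrow> (\<exists>i' a' b'. (i', a', b') \<in> set c \<and> (k = 2 * a' * n + i' \<or> k = (2 * b' + 1) * n + i'))" for k
    by (force simp: indices_def)
  have eq: "x * n + i = y * n + i' \<longleftrightarrow> x = y \<and> i = i'" if "(i', a', b') \<in> set c" for x y i' a' b'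
    using index_eq_iff[OF assms(2), of i'] assms(1)[OF that] by simp
  have par: "2 * x \<noteq> 2 * y + 1" "2 * x + 1 \<noteq> 2 * y" for x y :: nat by presburger+
  show "2 * a * n + i \<in> set (indices n c) \<longleftrightarrow> (\<exists>b. (i, a, b) \<in> set c)"
  proof
    assume "2 * a * n + i \<in> set (indices n c)"
    then obtain i' a' b' where t: "(i', a', b') \<in> set c"
      "2 * a * n + i = 2 * a' * n + i' \<or> 2 * a * n + i = (2 * b' + 1) * n + i'" unfolding * by blast
    then show "\<exists>b. (i, a, b) \<in> set c" unfolding eq[OF t(1)] using par by auto
  qed (auto simp: *)
  show "(2 * b + 1) * n + i \<in> set (indices n c) \<longleftrightarrow> (\<exists>a. (i, a, b) \<in> set c)"
  proof
    assume "(2 * b + 1) * n + i \<in> set (indices n c)"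
    then obtain i' a' b' where t: "(i', a', b') \<in> set c"
      "(2 * b + 1) * n + i = 2 * a' * n + i' \<or> (2 * b + 1) * n + i = (2 * b' + 1) * n + i'" unfolding * by blast
    then show "\<exists>a. (i, a, b) \<in> set c" unfolding eq[OF t(1)] using par by auto
  qed (use * in blast)
qed

definition fibre :: "('a \<times> 'b) list \<Rightarrow> 'a \<Rightarrow> 'b set" where
  "fibre c i = {x. (i, x) \<in> set c}"

definition triples_weight :: "(nat \<times> nat \<times> nat) list \<Rightarrow> nat" where
  "triples_weight c = (\<Sum>t\<leftarrow>c. fst (snd t) * snd (snd t))"

lemma sum_list_fibres:
  fixes f :: "'b \<Rightarrow> nat"
  assumes "distinct c" "\<And>t. t \<in> set c \<Longrightarrow> fst t < (n :: nat)"
  shows "(\<Sum>t\<leftarrow>c. f (snd t)) = (\<Sum>i<n. \<Sum>x\<in>fibre c i. f x)"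
proof -
  have fin: "finite (fibre c i)" for i
    using finite_imageI[of "set c" snd] by (rule finite_subset[rotated]) (force simp: fibre_def)+
  have "(\<Sum>t\<leftarrow>c. f (snd t)) = (\<Sum>t\<in>set c. f (snd t))"
    using assms(1) by (simp add: sum_list_distinct_conv_sum_set)
  also have "set c = (SIGMA i:{..<n}. fibre c i)" using assms(2) by (auto simp: fibre_def)
  also have "(\<Sum>t\<in>(SIGMA i:{..<n}. fibre c i). f (snd t)) = (\<Sum>i<n. \<Sum>x\<in>fibre c i. f x)"
    using sum.Sigma[of "{..<n}" "fibre c" "\<lambda>_ x. f x"] fin by (simp add: case_prod_beta)
  finally show ?thesis .
qed

text \<open>Lists with the same monomial have, on each level, fibres with the same first and the
  same second coordinates. The rearrangement inequality then compares them level by level.\<close>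

lemma indices_maximal:
  assumes c: "distinct (indices n c)" "\<And>t. t \<in> set c \<Longrightarrow> fst t < n"
    and d: "distinct d" "\<And>t. t \<in> set d \<Longrightarrow> fst t < n" "\<And>i. i < n \<Longrightarrow> strict_chain (fibre d i)"
    and eq: "set (indices n c) = set (indices n d)"
  shows "triples_weight c \<le> triples_weight d \<and> (triples_weight c = triples_weight d \<longrightarrow> mset c = mset d)"
proof -
  let ?s = "\<lambda>G. \<Sum>x\<in>G. fst x * snd x :: nat"
  note dc = distinct_indices[OF c(1)]
  have fin: "finite (fibre e i)" for e :: "(nat \<times> nat \<times> nat) list" and i
    using finite_imageI[of "set e" snd] by (rule finite_subset[rotated]) (force simp: fibre_def)+
  have each: "?s (fibre c i) \<le> ?s (fibre d i) \<and> (?s (fibre c i) = ?s (fibre d i) \<longrightarrow> fibre c i = fibre d i)"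
    if i: "i < n" for i
  proof (rule strict_chain_maximizes)
    show "inj_on fst (fibre c i)"
    proof (rule inj_onI)
      fix x y assume "x \<in> fibre c i" "y \<in> fibre c i" "fst x = fst y"
      then show "x = y" using inj_onD[of "\<lambda>(i, a, b). 2 * a * n + i" "set c" "(i, x)" "(i, y)"] dc
        by (auto simp: fibre_def case_prod_beta)
    qed
    show "inj_on snd (fibre c i)"
    proof (rule inj_onI)
      fix x y assume "x \<in> fibre c i" "y \<in> fibre c i" "snd x = snd y"
      then show "x = y" using inj_onD[of "\<lambda>(i, a, b). (2 * b + 1) * n + i" "set c" "(i, x)" "(i, y)"] dc
        by (auto simp: fibre_def case_prod_beta)
    qed
    have im: "a \<in> fst ` fibre e i \<longleftrightarrow> (\<exists>b. (i, a, b) \<in> set e)" "b \<in> snd ` fibre e i \<longleftrightarrow> (\<exists>a. (i, a, b) \<in> set e)"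
      for e :: "(nat \<times> nat \<times> nat) list" and a b by (force simp: fibre_def)+
    have "a \<in> fst ` fibre c i \<longleftrightarrow> a \<in> fst ` fibre d i" for a
      using indices_mem(1)[where c = c and a = a, OF c(2) i] indices_mem(1)[where c = d and a = a, OF d(2) i]
      unfolding im eq by (rule trans[OF sym])
    then show "fst ` fibre c i = fst ` fibre d i" by blast
    have "b \<in> snd ` fibre c i \<longleftrightarrow> b \<in> snd ` fibre d i" for b
      using indices_mem(2)[where c = c and b = b, OF c(2) i] indices_mem(2)[where c = d and b = b, OF d(2) i]
      unfolding im eq by (rule trans[OF sym])
    then show "snd ` fibre c i = snd ` fibre d i" by blast
  qed (use fin d(3) i in auto)
  have wc: "triples_weight c = (\<Sum>i<n. ?s (fibre c i))"
    unfolding triples_weight_def using sum_list_fibres[of c n "\<lambda>x. fst x * snd x"] dc c(2) by simp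
  have wd: "triples_weight d = (\<Sum>i<n. ?s (fibre d i))"
    unfolding triples_weight_def using sum_list_fibres[of d n "\<lambda>x. fst x * snd x"] d(1,2) by simp
  have le: "triples_weight c \<le> triples_weight d"
    unfolding wc wd using each by (intro sum_mono) auto
  moreover have "mset c = mset d" if e: "triples_weight c = triples_weight d"
  proof -
    have "?s (fibre c i) = ?s (fibre d i)" if "i < n" for i
      using e each that unfolding wc wd
      by (metis (no_types, lifting) finite_lessThan lessThan_iff sum_mono_inv)
    then have "fibre c i = fibre d i" if "i < n" for i using each that by blast
    then have "t \<in> set c \<longleftrightarrow> t \<in> set d" for t
      using c(2)[of t] d(2)[of t] unfolding fibre_def
      by (metis (mono_tags, lifting) mem_Collect_eq prod.collapse)
    then have "set c = set d" by blast
    then show ?thesis using set_eq_iff_mset_eq_distinct[of c d] dc d(1) by blast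
  qed
  ultimately show ?thesis by blast
qed

lemma orientations_mem:
  "t \<in> set (orientations n ab) \<longleftrightarrow> fst t < n \<and> (snd t = ab \<or> snd t = (snd ab, fst ab))"
  by (cases t; cases ab) (auto simp: orientations_def)

text \<open>Swapping the orientation of a pair does not change the product of its entries, so every
  term of the expansion has the weight of \<open>M\<close>. The last part recovers \<open>M\<close>
  if all pairs are written in increasing order.\<close>

lemma orientation_choice:
  assumes "list_all2 (\<lambda>t ys. t \<in> set ys) c (map (orientations n) M)"
  shows "(\<forall>t\<in>set c. fst t < n) \<and> triples_weight c = (\<Sum>ab\<leftarrow>M. fst ab * snd ab) \<and>
    ((\<forall>t\<in>set c. fst (snd t) \<le> snd (snd t)) \<and> (\<forall>ab\<in>set M. fst ab \<le> snd ab) \<longrightarrow> map snd c = M)"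
  using assms
proof (induction M arbitrary: c)
  case (Cons ab M)
  then obtain t c' where c: "c = t # c'" "t \<in> set (orientations n ab)"
    "list_all2 (\<lambda>t ys. t \<in> set ys) c' (map (orientations n) M)"
    by (auto simp: list_all2_Cons2)
  show ?case using Cons.IH[OF c(3)] c(1,2)
    by (cases ab; cases t) (auto simp: orientations_mem triples_weight_def)
qed (simp add: triples_weight_def)

lemma product_lists_choice:
  assumes "c \<in> set (product_lists (map (orientations n) M))"
  shows "list_all2 (\<lambda>t ys. t \<in> set ys) c (map (orientations n) M)"
  using assms by (simp add: product_lists_set)

lemma triples_weight_map: "triples_weight e = (\<Sum>ab\<leftarrow>map snd e. fst ab * snd ab)"
  by (simp add: triples_weight_def o_def)

text \<open>A nonzero coefficient needs a term \<open>c\<close> of the expansion with the monomial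
  of \<open>d\<close>. Its weight is that of \<open>e\<close> and at most that of \<open>d\<close>;
  in case of equality \<open>c\<close> is a permutation of \<open>d\<close>, so all its pairs are in
  increasing order and are those of \<open>e\<close>.\<close>

lemma omegas_triangular:
  assumes d: "distinct d" "\<And>t. t \<in> set d \<Longrightarrow> fst t < n" "\<And>i. i < n \<Longrightarrow> strict_chain (fibre d i)"
      "\<And>t. t \<in> set d \<Longrightarrow> fst (snd t) \<le> snd (snd t)"
    and e: "\<And>t. t \<in> set e \<Longrightarrow> fst (snd t) \<le> snd (snd t)"
    and ne: "omegas n (map snd e) (set (indices n d)) \<noteq> 0"
  shows "triples_weight e < triples_weight d \<or> mset (map snd e) = mset (map snd d)"
proof -
  let ?S = "set (indices n d)" and ?P = "product_lists (map (orientations n) (map snd e))"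
  have "\<exists>c\<in>set ?P. pairs_vac n c ?S \<noteq> 0"
  proof (rule ccontr)
    assume "\<not> ?thesis"
    then have "map (\<lambda>c. pairs_vac n c ?S) ?P = map (\<lambda>c. 0) ?P" by (intro map_cong refl) auto
    then have "(\<Sum>c\<leftarrow>?P. pairs_vac n c ?S) = (\<Sum>c\<leftarrow>?P. 0)" by (rule arg_cong)
    then show False using ne unfolding omegas_eq_sum_list by (simp only: sum_list_0)
  qed
  then obtain c where c: "c \<in> set ?P" "distinct (indices n c)" "?S = set (indices n c)"
    unfolding pairs_vac_nonzero by blast
  note oc = orientation_choice[OF product_lists_choice[OF c(1)]]
  have we: "triples_weight c = triples_weight e" using oc by (simp add: triples_weight_map[of e])
  have mx: "triples_weight c \<le> triples_weight d" "triples_weight c = triples_weight d \<Longrightarrow> mset c = mset d"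
    using indices_maximal[of n c d] c(2,3) oc d by auto
  show ?thesis
  proof (cases "triples_weight c = triples_weight d")
    case True
    then have cd: "mset c = mset d" by (rule mx(2))
    then have "set c = set d" by (rule mset_eq_setD)
    then have "map snd c = map snd e" using oc d(4) e by auto
    then have "mset (map snd e) = image_mset snd (mset c)" by (metis mset_map)
    then show ?thesis using cd by simp
  qed (use mx(1) we in simp)
qed

lemma distinct_indicesI:
  assumes "distinct d" "\<And>t. t \<in> set d \<Longrightarrow> fst t < n" "\<And>i. i < n \<Longrightarrow> strict_chain (fibre d i)"
  shows "distinct (indices n d)"
  using assms
proof (induction d)
  case (Cons t d)
  obtain i a b where t: "t = (i, a, b)" by (cases t)
  have i: "i < n" using Cons.prems(2)[of t] t by simp
  have lt: "fst t' < n" if "t' \<in> set d" for t' using Cons.prems(2) that by simp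
  have "strict_chain (fibre d j)" if "j < n" for j
    using Cons.prems(3)[OF that] by (auto simp: strict_chain_def fibre_def)
  then have "distinct (indices n d)" using Cons.prems by (intro Cons.IH) auto
  moreover have other: "a' \<noteq> a \<and> b' \<noteq> b" if "(i, a', b') \<in> set d" for a' b'
  proof -
    have "(a, b) \<noteq> (a', b')" using that Cons.prems(1) t by auto
    then show ?thesis using Cons.prems(3)[OF i] that t by (fastforce simp: strict_chain_def fibre_def)
  qed
  moreover have "2 * a * n + i \<notin> set (indices n d)" using indices_mem(1)[where c = d and a = a, OF lt i] other by blast
  moreover have "(2 * b + 1) * n + i \<notin> set (indices n d)" using indices_mem(2)[where c = d and b = b, OF lt i] other by blast
  moreover have "2 * a * n + i \<noteq> (2 * b + 1) * n + i" unfolding index_eq_iff[OF i i] by presburger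
  ultimately show ?case by (auto simp: t indices_def)
qed (simp add: indices_def)

text \<open>Every term of the expansion that hits this monomial has the weight of \<open>d\<close>,
  hence is a permutation of \<open>d\<close> and has the same value. The coefficient is this value
  times a positive count, as \<open>d\<close> itself occurs.\<close>

lemma omegas_diagonal:
  assumes d: "distinct d" "\<And>t. t \<in> set d \<Longrightarrow> fst t < n" "\<And>i. i < n \<Longrightarrow> strict_chain (fibre d i)"
  shows "omegas n (map snd d) (set (indices n d)) \<noteq> 0"
proof -
  let ?S = "set (indices n d)" and ?P = "product_lists (map (orientations n) (map snd d))"
  have v0: "pairs_vac n d ?S \<noteq> 0" using distinct_indicesI[OF d] by (simp add: pairs_vac_nonzero)
  have val: "pairs_vac n c ?S = (if pairs_vac n c ?S \<noteq> 0 then pairs_vac n d ?S else 0)" if c: "c \<in> set ?P" for c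
  proof (cases "pairs_vac n c ?S = 0")
    case False
    note oc = orientation_choice[OF product_lists_choice[OF c]]
    have "triples_weight c = triples_weight d" using oc by (simp add: triples_weight_map[of d])
    then have "mset c = mset d" using False indices_maximal[of n c d] oc d unfolding pairs_vac_nonzero by auto
    then show ?thesis using False by (simp add: pairs_vac_mset[of c d])
  qed simp
  have cnt: "(\<Sum>x\<leftarrow>xs. if Q x then v else 0) = of_nat (length (filter Q xs)) * v" for Q and xs :: "'b list" and v :: complex
    by (induction xs) (simp_all add: distrib_right)
  have "omegas n (map snd d) ?S = (\<Sum>c\<leftarrow>?P. if pairs_vac n c ?S \<noteq> 0 then pairs_vac n d ?S else 0)"
    unfolding omegas_eq_sum_list by (rule arg_cong[of _ _ sum_list], rule map_cong[OF refl], rule val)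
  then have "omegas n (map snd d) ?S = of_nat (length (filter (\<lambda>c. pairs_vac n c ?S \<noteq> 0) ?P)) * pairs_vac n d ?S"
    unfolding cnt .
  moreover have "d \<in> set ?P"
    unfolding product_lists_set using d(2)
    by (auto simp: list_all2_conv_all_nth orientations_mem)
  then have "d \<in> set (filter (\<lambda>c. pairs_vac n c ?S \<noteq> 0) ?P)" using v0 by simp
  then have "length (filter (\<lambda>c. pairs_vac n c ?S \<noteq> 0) ?P) \<noteq> 0" by (metis length_0_conv list.set(1) empty_iff)
  ultimately show ?thesis using v0 by simp
qed

section \<open>Order ideals in the poset of intervals\<close>

definition interval_le :: "nat \<times> nat \<Rightarrow> nat \<times> nat \<Rightarrow> bool" where
  "interval_le x y \<longleftrightarrow> fst y \<le> fst x \<and> snd x \<le> snd y"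

definition max_intervals :: "(nat \<times> nat) set \<Rightarrow> (nat \<times> nat) set" where
  "max_intervals I = {x \<in> I. \<forall>y\<in>I. interval_le x y \<longrightarrow> y = x}"

text \<open>Intervals that are incomparable under inclusion are strictly ordered by both end points:
  an antichain of one order is a chain of the other.\<close>

lemma strict_chain_max_intervals: "strict_chain (max_intervals I)"
  unfolding strict_chain_def
proof (intro ballI impI)
  fix x y assume xy: "x \<in> max_intervals I" "y \<in> max_intervals I" "x \<noteq> y"
  then have "\<not> interval_le x y" "\<not> interval_le y x" by (auto simp: max_intervals_def)
  then show "(fst x < fst y \<and> snd x < snd y) \<or> (fst y < fst x \<and> snd y < snd x)"
    unfolding interval_le_def by linarith
qed

lemma ex_max_interval:
  assumes "finite I" "x \<in> I"
  shows "\<exists>y\<in>max_intervals I. interval_le x y"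
proof -
  let ?A = "{y \<in> I. interval_le x y}" and ?g = "\<lambda>y. int (fst y) - int (snd y)"
  have "finite ?A" "x \<in> ?A" using assms by (auto simp: interval_le_def)
  then obtain y where y: "y \<in> ?A" "\<And>z. z \<in> ?A \<Longrightarrow> ?g y \<le> ?g z"
    using arg_min_if_finite[of ?A ?g] by (metis (no_types, lifting) empty_iff not_le)
  have "y \<in> max_intervals I"
    unfolding max_intervals_def
  proof (intro CollectI conjI ballI impI)
    fix z assume z: "z \<in> I" "interval_le y z"
    then have "z \<in> ?A" using y(1) by (auto simp: interval_le_def)
    then have "?g y \<le> ?g z" by (rule y(2))
    then show "z = y" using z(2) by (intro prod_eqI) (auto simp: interval_le_def)
  qed (use y in auto)
  then show ?thesis using y(1) by auto
qed

definition nested_ideals :: "nat \<Rightarrow> (nat \<Rightarrow> (nat \<times> nat) set) \<Rightarrow> bool" where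
  "nested_ideals n I \<longleftrightarrow> (\<forall>i<n. finite (I i) \<and> (\<forall>x\<in>I i. fst x \<le> snd x \<and>
      (\<forall>y. interval_le y x \<and> fst y \<le> snd y \<longrightarrow> y \<in> I i))) \<and> (\<forall>i. Suc i < n \<longrightarrow> I i \<subseteq> I (Suc i))"

lemma nested_ideals_mono:
  assumes "nested_ideals n I" "i \<le> j" "j < n"
  shows "I i \<subseteq> I j"
  using assms(2,3)
proof (induction j)
  case (Suc j)
  have "I j \<subseteq> I (Suc j)" using assms(1) Suc.prems by (auto simp: nested_ideals_def)
  then show ?case using Suc by (cases "i = Suc j") auto
qed simp

text \<open>The largest ideal is generated by all maximal intervals of the whole family. Removing
  its own maximal intervals from the multiset leaves the data of the smaller ideals.\<close>

lemma ideals_determined: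
  assumes "nested_ideals n I" "nested_ideals n J"
    "(\<Sum>i<n. mset_set (max_intervals (I i))) = (\<Sum>i<n. mset_set (max_intervals (J i)))" "i < n"
  shows "I i = J i"
  using assms
proof (induction n arbitrary: i)
  case (Suc n)
  have top: "K n = {x. fst x \<le> snd x \<and> (\<exists>y. y \<in># (\<Sum>i<Suc n. mset_set (max_intervals (K i))) \<and> interval_le x y)}"
    if K: "nested_ideals (Suc n) K" for K
  proof -
    have fin: "finite (max_intervals (K i))" if "i < Suc n" for i
      using K that by (auto simp: nested_ideals_def max_intervals_def)
    then have mem: "y \<in># (\<Sum>i<Suc n. mset_set (max_intervals (K i))) \<longleftrightarrow> (\<exists>i<Suc n. y \<in> max_intervals (K i))" for y
      by (simp only: set_mset_sum[OF finite_lessThan]) auto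
    show ?thesis unfolding mem
    proof (intro subset_antisym subsetI)
      fix x assume x: "x \<in> K n"
      have n: "finite (K n)" "fst x \<le> snd x" using K x unfolding nested_ideals_def by (meson lessI)+
      then obtain y where "y \<in> max_intervals (K n)" "interval_le x y"
        using ex_max_interval[of "K n" x] x by blast
      then show "x \<in> {x. fst x \<le> snd x \<and> (\<exists>y. (\<exists>i<Suc n. y \<in> max_intervals (K i)) \<and> interval_le x y)}"
        using n(2) by blast
    next
      fix x assume "x \<in> {x. fst x \<le> snd x \<and> (\<exists>y. (\<exists>i<Suc n. y \<in> max_intervals (K i)) \<and> interval_le x y)}"
      then obtain y i where y: "fst x \<le> snd x" "i < Suc n" "y \<in> max_intervals (K i)" "interval_le x y" by blast
      then have "y \<in> K n" using nested_ideals_mono[OF K, of i n] by (auto simp: max_intervals_def)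
      then show "x \<in> K n" using K y(1,4) unfolding nested_ideals_def by (meson lessI)
    qed
  qed
  have eq: "I n = J n"
    by (subst top[OF Suc.prems(1)], subst top[OF Suc.prems(2)], simp only: Suc.prems(3))
  show ?case
  proof (cases "i = n")
    case False
    have "nested_ideals n K" if "nested_ideals (Suc n) K" for K
      using that unfolding nested_ideals_def by (meson less_SucI)
    then have "nested_ideals n I" "nested_ideals n J" using Suc.prems(1,2) by blast+
    moreover have "(\<Sum>i<n. mset_set (max_intervals (I i))) = (\<Sum>i<n. mset_set (max_intervals (J i)))"
      using Suc.prems(3) eq by simp
    moreover have "i < n" using False Suc.prems(4) by simp
    ultimately show ?thesis by (rule Suc.IH)
  qed (simp add: eq)
qed simp

section \<open>From walker families to nested ideals\<close>

lemma walker_pos_Lipschitz: "\<bar>walker_pos Es (t + k) i - walker_pos Es t i\<bar> \<le> int k"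
proof (induction k)
  case (Suc k)
  have "\<bar>walker_pos Es (Suc (t + k)) i - walker_pos Es (t + k) i\<bar> \<le> 1" by (simp add: walker_pos_def)
  then show ?case using Suc by simp
qed simp

lemma walker_pos_parity: "even (walker_pos Es t i + int t)"
  by (induction t) (auto simp: walker_pos_def)

lemma walker_pos_gap:
  assumes "Es \<in> walker_families n m" "t \<le> 2 * m" "Suc i < n"
  shows "walker_pos Es t i + 2 \<le> walker_pos Es t (Suc i)"
proof -
  have "walker_pos Es t i < walker_pos Es t (Suc i)"
    using assms by (auto simp: walker_families_def chamber_def)
  then show ?thesis using walker_pos_parity[of Es t i] walker_pos_parity[of Es t "Suc i"] by presburger
qed

lemma walker_pos_lower:
  assumes "Es \<in> walker_families n m" "t \<le> 2 * m" "i < n"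
  shows "2 * int i + 1 \<le> walker_pos Es t i"
  using assms(3)
proof (induction i)
  case 0
  then have "0 < walker_pos Es t 0" using assms(1,2) by (auto simp: walker_families_def chamber_def)
  then show ?case by simp
next
  case (Suc i)
  then show ?case using walker_pos_gap[OF assms(1,2), of i] by simp
qed

text \<open>The heights \<open>walker_pos Es t i - 2 i - 1\<close> of the walkers form a nested family of Dyck paths
  (up to the first and the last step); an interval is in the \<open>i\<close>-th ideal if the corresponding
  lattice point lies weakly below the \<open>i\<close>-th path.\<close>
definition walker_ideal :: "nat \<Rightarrow> nat set list \<Rightarrow> nat \<Rightarrow> (nat \<times> nat) set" where
  "walker_ideal m Es i = {(a, b). a \<le> b \<and> b < m \<and>
     2 * int i + 3 + int b - int a \<le> walker_pos Es (a + b + 1) i}"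

lemma finite_walker_ideal: "finite (walker_ideal m Es i)"
  by (rule finite_subset[of _ "{..<m} \<times> {..<m}"]) (auto simp: walker_ideal_def)

text \<open>Moving one end point of an interval inwards by one shifts the time by one and lowers the
  threshold by one, which unit steps can keep up with. Nestedness is the gap of 2 between
  neighbouring walkers, the amount by which the threshold grows with \<open>i\<close>.\<close>

lemma nested_walker_ideals:
  assumes "Es \<in> walker_families n m"
  shows "nested_ideals n (walker_ideal m Es)"
  unfolding nested_ideals_def
proof (intro conjI allI impI ballI)
  show "finite (walker_ideal m Es i)" for i by (rule finite_walker_ideal)
  show "fst x \<le> snd x" if "x \<in> walker_ideal m Es i" for x i using that by (auto simp: walker_ideal_def)
  show "y \<in> walker_ideal m Es i" if x: "x \<in> walker_ideal m Es i" and y: "interval_le y x \<and> fst y \<le> snd y" for x y i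
  proof -
    obtain a b c d where xy: "x = (a, b)" "y = (c, d)" by (cases x; cases y)
    have h: "a \<le> c" "c \<le> d" "d \<le> b" "b < m" "2 * int i + 3 + int b - int a \<le> walker_pos Es (a + b + 1) i"
      using x y by (auto simp: xy interval_le_def walker_ideal_def)
    have "\<bar>walker_pos Es (a + b + 1) i - walker_pos Es (a + d + 1) i\<bar> \<le> int (b - d)"
      using walker_pos_Lipschitz[of Es "a + d + 1" "b - d" i] h by simp
    moreover have "\<bar>walker_pos Es (c + d + 1) i - walker_pos Es (a + d + 1) i\<bar> \<le> int (c - a)"
      using walker_pos_Lipschitz[of Es "a + d + 1" "c - a" i] h by (simp add: add.commute)
    ultimately have "2 * int i + 3 + int d - int c \<le> walker_pos Es (c + d + 1) i" using h by linarith
    then show ?thesis using h by (simp add: xy walker_ideal_def)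
  qed
  show "walker_ideal m Es i \<subseteq> walker_ideal m Es (Suc i)" if i: "Suc i < n" for i
  proof
    fix x assume x: "x \<in> walker_ideal m Es i"
    obtain a b where ab: "x = (a, b)" by (cases x)
    have h: "a \<le> b" "b < m" "2 * int i + 3 + int b - int a \<le> walker_pos Es (a + b + 1) i"
      using x by (auto simp: ab walker_ideal_def)
    then show "x \<in> walker_ideal m Es (Suc i)"
      using walker_pos_gap[OF assms _ i, of "a + b + 1"] by (simp add: ab walker_ideal_def)
  qed
qed

text \<open>If the walker of \<open>Es'\<close> were higher at time \<open>t\<close>, its lattice
  point there would define an interval that belongs to the ideal of \<open>Es'\<close> but not to
  that of \<open>Es\<close>.\<close>

lemma walker_pos_le_of_ideal:
  assumes "Es \<in> walker_families n m" "Es' \<in> walker_families n m" "i < n" "t \<le> 2 * m"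
    and eq: "walker_ideal m Es i = walker_ideal m Es' i"
  shows "walker_pos Es' t i \<le> walker_pos Es t i"
proof (rule ccontr)
  assume "\<not> ?thesis"
  then have less: "walker_pos Es t i < walker_pos Es' t i" by simp
  define h where "h = walker_pos Es' t i - 2 * int i - 1"
  have par: "even (h + int t + 1)" using walker_pos_parity[of Es' t i] by (simp add: h_def)
  have "2 \<le> h"
    using less walker_pos_parity[of Es t i] walker_pos_parity[of Es' t i] walker_pos_lower[OF assms(1,4,3)]
    unfolding h_def by presburger
  have start: "h \<le> int t + 1"
    using walker_pos_Lipschitz[of Es' 0 t i] by (simp add: h_def walker_pos_def[of Es' 0])
  have "walker_pos Es' (2 * m) i = 2 * int i + 2" using assms(2,3) by (auto simp: walker_families_def)
  then have fin: "h \<le> 2 * int m - int t + 1"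
    using walker_pos_Lipschitz[of Es' t "2 * m - t" i] assms(4) by (simp add: h_def)
  \<comment> \<open>The solution of \<open>a + b + 1 = t\<close> and \<open>b - a = h - 2\<close>.
    It is integral by parity; \<open>2 \<le> h\<close> gives \<open>a \<le> b\<close>, the start of
    the walk gives \<open>0 \<le> a\<close>, and its end gives \<open>b < m\<close>.\<close>
  obtain a b where ab: "2 * int a = int t + 1 - h" "2 * int b = int t + h - 3"
  proof -
    have "even (int t + 1 - h)" "even (int t + h - 3)" using par by presburger+
    then obtain p q where pq: "int t + 1 - h = 2 * p" "int t + h - 3 = 2 * q" by (elim evenE)
    have "p \<ge> 0" "q \<ge> 0" using pq start \<open>2 \<le> h\<close> par by presburger+
    then show thesis using that[of "nat p" "nat q"] pq by simp
  qed
  have t: "a + b + 1 = t" using ab by linarith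
  have "a \<le> b" "b < m" "2 * int i + 3 + int b - int a = walker_pos Es' t i"
    using ab fin \<open>2 \<le> h\<close> h_def by linarith+
  then have "(a, b) \<in> walker_ideal m Es' i" unfolding walker_ideal_def using t by simp
  then have "(a, b) \<in> walker_ideal m Es i" by (simp only: eq)
  then show False
    using less t \<open>2 * int i + 3 + int b - int a = walker_pos Es' t i\<close> by (auto simp: walker_ideal_def)
qed

lemma walker_family_determined:
  assumes Es: "Es \<in> walker_families n m" "Es' \<in> walker_families n m"
    and eq: "\<And>i. i < n \<Longrightarrow> walker_ideal m Es i = walker_ideal m Es' i"
  shows "Es = Es'"
proof (rule nth_equalityI)
  have pos: "walker_pos Es t i = walker_pos Es' t i" if "i < n" "t \<le> 2 * m" for i t
    using walker_pos_le_of_ideal[OF Es that eq[OF that(1)]]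
      walker_pos_le_of_ideal[OF Es(2,1) that eq[OF that(1), symmetric]] by simp
  show len: "length Es = length Es'" using Es by (auto simp: walker_families_def)
  fix s assume "s < length Es"
  then have s: "s < 2 * m" using Es(1) by (auto simp: walker_families_def)
  have "i \<in> Es ! s \<longleftrightarrow> i \<in> Es' ! s" if "i < n" for i
    using pos[OF that, of s] pos[OF that, of "Suc s"] s
    by (auto simp: walker_pos_def split: if_splits)
  moreover have "Es ! s \<subseteq> {..<n}" "Es' ! s \<subseteq> {..<n}"
    using Es s by (auto simp: walker_families_def)
  ultimately show "Es ! s = Es' ! s" by blast
qed

text \<open>Products of \<open>omega\<close> are indexed by lists. Any enumeration without
  repetition will do, as only its set and multiset of entries are used.\<close>

definition corner_list :: "nat \<Rightarrow> nat \<Rightarrow> nat set list \<Rightarrow> (nat \<times> nat \<times> nat) list" where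
  "corner_list n m Es = (SOME d. distinct d \<and> set d = (SIGMA i:{..<n}. max_intervals (walker_ideal m Es i)))"

lemma corner_list:
  shows "distinct (corner_list n m Es)"
    and "set (corner_list n m Es) = (SIGMA i:{..<n}. max_intervals (walker_ideal m Es i))"
proof -
  have "finite (SIGMA i:{..<n}. max_intervals (walker_ideal m Es i))"
    using finite_walker_ideal by (intro finite_SigmaI) (auto simp: max_intervals_def)
  then have "\<exists>d. distinct d \<and> set d = (SIGMA i:{..<n}. max_intervals (walker_ideal m Es i))"
    using finite_distinct_list by metis
  from someI_ex[OF this] show "distinct (corner_list n m Es)"
    "set (corner_list n m Es) = (SIGMA i:{..<n}. max_intervals (walker_ideal m Es i))"
    unfolding corner_list_def by auto
qed

lemma corner_list_props:
  "t \<in> set (corner_list n m Es) \<Longrightarrow> fst t < n"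
  "t \<in> set (corner_list n m Es) \<Longrightarrow> fst (snd t) \<le> snd (snd t) \<and> snd (snd t) < m"
  "i < n \<Longrightarrow> strict_chain (fibre (corner_list n m Es) i)"
proof -
  show "t \<in> set (corner_list n m Es) \<Longrightarrow> fst t < n"
    "t \<in> set (corner_list n m Es) \<Longrightarrow> fst (snd t) \<le> snd (snd t) \<and> snd (snd t) < m"
    unfolding corner_list(2) by (auto simp: max_intervals_def walker_ideal_def)
  assume "i < n"
  then have "fibre (corner_list n m Es) i = max_intervals (walker_ideal m Es i)"
    unfolding fibre_def corner_list(2) by auto
  then show "strict_chain (fibre (corner_list n m Es) i)" by (simp add: strict_chain_max_intervals)
qed

lemma mset_set_Sigma_snd:
  assumes "\<And>i. i < n \<Longrightarrow> finite (C i)"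
  shows "image_mset snd (mset_set (SIGMA i:{..<n::nat}. C i)) = (\<Sum>i<n. mset_set (C i))"
  using assms
proof (induction n)
  case (Suc n)
  have eq: "(SIGMA i:{..<Suc n}. C i) = (SIGMA i:{..<n}. C i) \<union> Pair n ` C n" by (auto simp: less_Suc_eq)
  have "mset_set (SIGMA i:{..<Suc n}. C i) = mset_set (SIGMA i:{..<n}. C i) + mset_set (Pair n ` C n)"
    unfolding eq using Suc.prems by (intro mset_set_Union) (auto intro!: finite_SigmaI)
  moreover have "image_mset snd (mset_set (Pair n ` C n)) = mset_set (C n)"
    by (subst image_mset_mset_set[symmetric]) (auto simp: inj_on_def multiset.map_comp o_def)
  ultimately show ?case using Suc by simp
qed simp

text \<open>The invariant attached to a family remembers the intervals but not their levels;
  \<open>ideals_determined\<close> recovers the levels.\<close>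

lemma corner_list_inj:
  assumes "Es \<in> walker_families n m" "Es' \<in> walker_families n m"
    "mset (map snd (corner_list n m Es)) = mset (map snd (corner_list n m Es'))"
  shows "Es = Es'"
proof (rule walker_family_determined[OF assms(1,2)])
  have mset: "mset (map snd (corner_list n m Es)) = (\<Sum>i<n. mset_set (max_intervals (walker_ideal m Es i)))" for Es
  proof -
    have "mset (corner_list n m Es) = mset_set (set (corner_list n m Es))"
      by (rule mset_set_set[OF corner_list(1), symmetric])
    then show ?thesis
      unfolding corner_list(2) mset_map using finite_walker_ideal
      by (subst mset_set_Sigma_snd[symmetric]) (auto simp: max_intervals_def)
  qed
  show "walker_ideal m Es i = walker_ideal m Es' i" if "i < n" for i
    using ideals_determined[OF nested_walker_ideals[OF assms(1)] nested_walker_ideals[OF assms(2)] _ that]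
      assms(3) unfolding mset by blast
qed

text \<open>Each family \<open>Es\<close> yields an invariant \<open>v Es\<close> and a test tensor
  \<open>P Es\<close>. The matrix of the values \<open>v Es (P Es')\<close> has nonzero diagonal and
  is triangular with respect to \<open>triples_weight\<close>, so the invariants are
  independent.\<close>

lemma le_mult_trivial: "card (walker_families n m) \<le> mult_trivial n m"
proof -
  interpret V: vector_space cscale by (rule vector_space_cscale)
  let ?F = "walker_families n m" and ?W = "invariants n m"
  define d where "d = corner_list n m"
  define v where "v = (\<lambda>Es T. if T \<in> tbasis n m then omegas n (map snd (d Es)) (enc n T) else 0)"
  define P where "P = (\<lambda>Es. dec n m (set (indices n (d Es))))"
  have d: "distinct (d Es)" "\<And>t. t \<in> set (d Es) \<Longrightarrow> fst t < n"
    "\<And>t. t \<in> set (d Es) \<Longrightarrow> fst (snd t) \<le> snd (snd t)" "\<And>t. t \<in> set (d Es) \<Longrightarrow> snd (snd t) < m"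
    "\<And>i. i < n \<Longrightarrow> strict_chain (fibre (d Es) i)" for Es
    using corner_list(1) corner_list_props unfolding d_def by blast+
  have dm: "fst (snd t) < m" if "t \<in> set (d Es)" for t Es using d(3,4)[OF that] by simp
  have vW: "v Es \<in> ?W" for Es
  proof -
    have "tensor_act n m X (v Es) T = 0" if "X \<in> sp n" for X T
    proof (cases "T \<in> tbasis n m")
      case True
      have "tensor_act n m X (v Es) T = rho n m X (omegas n (map snd (d Es))) (enc n T)"
        unfolding v_def by (rule tensor_act_eq_rho[OF True])
      also have "\<dots> = 0" using that d(4) dm by (intro rho_omegas) auto
      finally show ?thesis .
    qed (rule tensor_act_outside)
    then show ?thesis by (auto simp: invariants_def tvectors_def fun_eq_iff v_def)
  qed
  have vP: "v Es (P Es') = omegas n (map snd (d Es)) (set (indices n (d Es')))" for Es Es'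
  proof -
    have "set (indices n (d Es')) \<subseteq> {..<2 * m * n}" using d(2,4) dm by (intro indices_subset) auto
    then have "enc n (P Es') = set (indices n (d Es'))"
      unfolding P_def by (intro enc_dec) (simp add: mult_ac)
    then show ?thesis by (simp add: v_def P_def dec_in_tbasis)
  qed
  have diag: "v Es (P Es) \<noteq> 0" for Es
    unfolding vP using d by (intro omegas_diagonal) auto
  have tri: "triples_weight (d Es) < triples_weight (d Es')"
    if "Es \<in> ?F" "Es' \<in> ?F" "Es \<noteq> Es'" "v Es (P Es') \<noteq> 0" for Es Es'
  proof -
    have "triples_weight (d Es) < triples_weight (d Es') \<or> mset (map snd (d Es)) = mset (map snd (d Es'))"
      using that(4) d unfolding vP by (intro omegas_triangular[where n = n]) auto
    then show ?thesis using corner_list_inj[OF that(1,2)] that(3) unfolding d_def by blast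
  qed
  have fin: "finite ?F" by (rule finite_walker_families)
  have zero: "c Es = 0" if sum: "(\<Sum>Es\<in>?F. cscale (c Es) (v Es)) = 0" and "Es \<in> ?F" for c Es
  proof (rule ccontr)
    assume "c Es \<noteq> 0"
    let ?A = "{Es \<in> ?F. c Es \<noteq> 0}"
    have "finite ?A" "?A \<noteq> {}" using fin \<open>Es \<in> ?F\<close> \<open>c Es \<noteq> 0\<close> by auto
    \<comment> \<open>At the test tensor of a family of least weight in the support of
      \<open>c\<close>, triangularity leaves only that family's own term.\<close>
    then obtain Es0 where E0: "Es0 \<in> ?A" "\<And>Es. Es \<in> ?A \<Longrightarrow> triples_weight (d Es0) \<le> triples_weight (d Es)"
      using arg_min_if_finite[of ?A "\<lambda>Es. triples_weight (d Es)"] by (metis (no_types, lifting) not_le)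
    have "0 = (\<Sum>Es\<in>?F. cscale (c Es) (v Es)) (P Es0)" by (simp add: sum)
    also have "\<dots> = (\<Sum>Es\<in>?F. c Es * v Es (P Es0))" by (simp add: fun_sum_apply cscale_def)
    also have "\<dots> = (\<Sum>Es\<in>?F. if Es = Es0 then c Es0 * v Es0 (P Es0) else 0)"
    proof (intro sum.cong refl)
      fix Es assume Es: "Es \<in> ?F"
      show "c Es * v Es (P Es0) = (if Es = Es0 then c Es0 * v Es0 (P Es0) else 0)"
        using tri[OF Es, of Es0] E0(1) E0(2)[of Es] Es by (cases "Es = Es0"; cases "c Es = 0") auto
    qed
    also have "\<dots> = c Es0 * v Es0 (P Es0)" using fin E0(1) by (simp add: sum.delta)
    finally show False using diag[of Es0] E0(1) by simp
  qed
  have inj: "inj_on v ?F"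
  proof (rule inj_onI, rule ccontr)
    fix Es Es' assume E: "Es \<in> ?F" "Es' \<in> ?F" "v Es = v Es'" "Es \<noteq> Es'"
    have "v Es (P Es') \<noteq> 0" "v Es' (P Es) \<noteq> 0" using diag[of Es] diag[of Es'] E(3) by auto
    then show False using tri[OF E(1,2,4)] tri[OF E(2,1)] E(4) by auto
  qed
  have "V.independent (v ` ?F)"
    unfolding V.independent_explicit_finite_subsets
  proof (intro allI impI ballI)
    fix S u x
    assume S: "S \<subseteq> v ` ?F" "finite S" "(\<Sum>w\<in>S. cscale (u w) w) = 0" "x \<in> S"
    define c where "c = (\<lambda>Es. if v Es \<in> S then u (v Es) else 0)"
    have "(\<Sum>Es\<in>?F. cscale (c Es) (v Es)) = (\<Sum>Es | Es \<in> ?F \<and> v Es \<in> S. cscale (u (v Es)) (v Es))"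
      using fin by (intro sum.mono_neutral_cong_right) (auto simp: c_def)
    also have "\<dots> = (\<Sum>w\<in>v ` {Es. Es \<in> ?F \<and> v Es \<in> S}. cscale (u w) w)"
      using inj by (subst sum.reindex) (auto intro: inj_on_subset)
    also have "v ` {Es. Es \<in> ?F \<and> v Es \<in> S} = S" using S(1) by auto
    also note S(3)
    finally have sum: "(\<Sum>Es\<in>?F. cscale (c Es) (v Es)) = 0" .
    obtain Es where Es: "Es \<in> ?F" "x = v Es" using S(1,4) by auto
    show "u x = 0" using zero[OF sum Es(1)] Es S(4) by (simp add: c_def)
  qed
  moreover obtain B where B: "B \<subseteq> ?W" "V.independent B" "?W \<subseteq> V.span B" "card B = V.dim ?W"
    by (rule V.basis_exists)
  \<comment> \<open>The ambient tensor space is finite-dimensional, so the basis \<open>B\<close> is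
    finite and bounds the size of independent sets in its span.\<close>
  moreover have "finite B"
  proof -
    define \<delta> where "\<delta> = (\<lambda>T T'::nat set list. if T' = T then 1 else 0 :: complex)"
    have "B \<subseteq> V.span (\<delta> ` tbasis n m)"
    proof
      fix w assume "w \<in> B"
      then have "w \<in> ?W" using B(1) by blast
      then have "w T = 0" if "T \<notin> tbasis n m" for T using that by (auto simp: invariants_def tvectors_def)
      then have "w = (\<Sum>T\<in>tbasis n m. cscale (w T) (\<delta> T))"
        by (intro ext) (simp add: fun_sum_apply cscale_def \<delta>_def finite_tbasis if_distrib[of "\<lambda>x. _ * x"] cong: if_cong)
      moreover have "(\<Sum>T\<in>tbasis n m. cscale (w T) (\<delta> T)) \<in> V.span (\<delta> ` tbasis n m)"
        by (intro V.span_sum V.span_scale V.span_base imageI)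
      ultimately show "w \<in> V.span (\<delta> ` tbasis n m)" by simp
    qed
    then show ?thesis using V.independent_span_bound[of "\<delta> ` tbasis n m" B] B(2) finite_tbasis by blast
  qed
  ultimately have "card (v ` ?F) \<le> card B"
    using V.independent_span_bound[of B "v ` ?F"] vW by blast
  then show ?thesis using card_image[OF inj] B(4) by (simp add: mult_trivial_def)
qed

theorem theorem4p9:
  fixes n m :: nat
  assumes "n \<ge> 1" and "m \<ge> 1"
  shows "int (mult_trivial n m) =
         det (mat n n (\<lambda>(i, j). int (catalan (m + 1 + i + j))))"
  using mult_trivial_le[OF assms(1), of m] le_mult_trivial[of n m] card_walker_families[of n m] by simp

end
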